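(* Let $(B\subseteq A,\Omega^\bullet,\Omega^{(\bullet,\bullet)},\sigma)$ be a CQH-Hermitian space and $\mathcal{F}$ a covariant Hermitian holomorphic module over $B$ with Chern connection $\nabla=\partial_{\mathcal{F}}+\overline{\partial}_{\mathcal{F}}$. For any $b\in B$, the following operators are all bounded on $\Omega^\bullet\otimes_B\mathcal{F}$, and hence uniquely extend to bounded operators on $L^2(\Omega^\bullet\otimes_B\mathcal{F})$: (1) $[\nabla,\lambda(b)]$, $[\partial_{\mathcal{F}},\lambda(b)]$, $[\overline{\partial}_{\mathcal{F}},\lambda(b)]$; (2) $[\nabla^\dagger,\lambda(b)]$, $[\partial_{\mathcal{F}}^\dagger,\lambda(b)]$, $[\overline{\partial}_{\mathcal{F}}^\dagger,\lambda(b)]$; (3) $[D_{\nabla},\lambda(b)]$, $[D_{\partial_{\mathcal{F}}},\lambda(b)]$, $[D_{\overline{\partial}_{\mathcal{F}}},\lambda(b)]$.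
   Context: All algebras are unital over $\mathbb{C}$. A differential calculus (dc) over an algebra $B$ is a differential graded algebra $(\Omega^\bullet=\bigoplus_{k\ge 0}\Omega^k,\mathrm{d})$ (product $\wedge$) with $\Omega^0=B$, generated as an algebra by the elements $a,\mathrm{d}b$, $a,b\in B$; it has total degree $m$ if $\Omega^m\ne 0$ and $\Omega^k=0$ for $k>m$. For $B$ a $*$-algebra, a $*$-dc is a dc such that $*$ extends to a conjugate-linear involution of $\Omega^\bullet$ with $\mathrm{d}(\omega^* )=(\mathrm{d}\omega)^*$ and $(\omega\wedge\nu)^*=(-1)^{kl}\nu^*\wedge\omega^*$ for $\omega\in\Omega^k$, $\nu\in\Omega^l$. A complex structure is a $\mathbb{Z}^2_{\ge0}$-algebra grading $\Omega^{(\bullet,\bullet)}$ with $\Omega^k=\bigoplus_{a+b=k}\Omega^{(a,b)}$, $(\Omega^{(a,b)})^*=\Omega^{(b,a)}$, such that $\mathrm{d}=\partial+\overline{\partial}$ with $\partial$ of degree $(1,0)$ and $\overline{\partial}$ of degree $(0,1)$. Hermitian structure $(\Omega^{(\bullet,\bullet)},\sigma)$ on a $*$-dc of total degree $2n$: a complex structure and a central real ($\sigma^*=\sigma$) form $\sigma\in\Omega^{(1,1)}$ such that, for $L_\sigma(\omega):=\sigma\wedge\omega$, the maps $L_\sigma^{n-k}:\Omega^k\to\Omega^{2n-k}$, $k=0,\dots,n-1$, are isomorphisms. Primitive forms: $P^k:=\{\alpha\in\Omega^k: L_\sigma^{n-k+1}(\alpha)=0\}$ for $k\le n$, $P^k:=0$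 for $k>n$; one has $\Omega^k=\bigoplus_j L_\sigma^j(P^{k-2j})$. The Hodge map $\ast_\sigma$ is determined by $\ast_\sigma(L_\sigma^j(\alpha))=(-1)^{k(k+1)/2}\mathbf{i}^{a-b}\frac{j!}{(n-j-k)!}L_\sigma^{n-j-k}(\alpha)$ for $\alpha\in P^k\cap\Omega^{(a,b)}$, $a+b=k$. The metric is the sesquilinear form (conjugate-linear in the first variable) $g_\sigma:\Omega^\bullet\times\Omega^\bullet\to B$, $g_\sigma(\omega,\nu)=\ast_\sigma(\ast_\sigma(\omega^* )\wedge\nu)$ for $\omega,\nu$ of equal degree, zero for different degrees. $B_{>0}$ is the set of non-zero elements of the form $\sum_i b_i^*b_i$; the structure is positive definite if $g_\sigma(\omega,\omega)\in B_{>0}$ for all $\omega\neq0$. A CQGA is a cosemisimple Hopf $*$-algebra whose Haar functional $\mathbf{h}$ is a state. A quantum homogeneous $A$-space is a left coideal subalgebra $B\subseteq A$ with $A$ faithfully flat as right $B$-module and $B^+A=AB^+$, $B^+:=\ker(\varepsilon)\cap B$; put $\pi_B(A):=A/B^+A$. A CQGA-homogeneous space is a quantum homogeneous space $B\subseteq A$ with $A,\pi_B(A)$ CQGAs, $B$ a $*$-subalgebra, and $\pi_B:A\to\pi_B(A)$ a Hopf $*$-map. ${}^A_B\mathrm{mod}_0$ is the category of left relative Hopf modules (left $A$-comodules and left $B$-modules, compatibly) finitely generated over $B$, with right $B$-action $fb=f_{(-2)}bS(f_{(-1)})f_{(0)}$ (i.e. under $\mathcal{F}\cong A\,\square_{\pi_B}(\mathcal{F}/B^+\mathcal{F})$,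 $f\mapsto f_{(-1)}\otimes[f_{(0)}]$, right multiplication by $b$ on $A$). A CQH-Hermitian space is a quadruple $(B\subseteq A,\Omega^\bullet,\Omega^{(\bullet,\bullet)},\sigma)$ with $B\subseteq A$ a CQGA-homogeneous space, $\Omega^\bullet$ a left $A$-covariant $*$-dc over $B$ (an object of ${}^A_B\mathrm{mod}_0$, $\mathrm d$ a comodule map), and $(\Omega^{(\bullet,\bullet)},\sigma)$ a positive definite Hermitian structure which is covariant (the bigrading is one of objects of ${}^A_B\mathrm{mod}_0$, $\sigma$ is coinvariant) and $\int$-closed: for $\int:=\mathbf{h}\circ\ast_\sigma:\Omega^{2n}\to\mathbb{C}$ one has $\int\circ\,\mathrm{d}=0$ on $\Omega^{2n-1}$. Modules. For a $B$-bimodule $\mathcal{F}$, $\mathcal{F}^\vee$ is the bimodule of right $B$-module maps $\mathcal{F}\to B$ and $\overline{\mathcal{F}}$ the conjugate bimodule ($b\overline{f}=\overline{fb^*}$, $\overline{f}b=\overline{b^*f}$). A weak Hermitian module is a pair $(\mathcal{F},h_{\mathcal{F}})$ with $h_{\mathcal{F}}:\overline{\mathcal{F}}\to\mathcal{F}^\vee$ a bimodule isomorphism such that $h'_{\mathcal{F}}(f,k):=h_{\mathcal{F}}(\overline{f})(k)$ satisfies $h'_{\mathcal{F}}(f,k)=h'_{\mathcal{F}}(k,f)^*$ and $h'_{\mathcal{F}}(f,f)\in B_{>0}$ for $f\ne0$. It is an Hermitian module if $g_{\mathcal{F}}(\omega\otimes f,\nu\otimes k):=h'_{\mathcal{F}}(f,g_\sigma(\omega,\nu)k)$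 makes $\Omega^\bullet\otimes_B\mathcal{F}$ a weak Hermitian module; covariant if $\mathcal{F}\in{}^A_B\mathrm{mod}_0$ and $h_{\mathcal{F}}$ is a morphism there. $L^2(\Omega^\bullet\otimes_B\mathcal{F})$ is the completion for the inner product $\langle-,-\rangle_{\mathcal{F}}:=\mathbf{h}\circ g_{\mathcal{F}}$. $\lambda(b)$ denotes left multiplication $\omega\otimes f\mapsto b\omega\otimes f$. A connection on a left $B$-module $\mathcal{F}$ is a linear map $\nabla:\mathcal{F}\to\Omega^1\otimes_B\mathcal{F}$ with $\nabla(bf)=\mathrm{d}b\otimes f+b\nabla f$, extended to $\Omega^\bullet\otimes_B\mathcal F$ by $\nabla(\omega\otimes f)=\mathrm{d}\omega\otimes f+(-1)^{|\omega|}\omega\wedge\nabla f$. A holomorphic module is a finitely generated projective left $B$-module $\mathcal{F}$ with a connection $\overline{\partial}_{\mathcal{F}}:\mathcal{F}\to\Omega^{(0,1)}\otimes_B\mathcal{F}$ for the dc $(\Omega^{(0,\bullet)},\overline{\partial})$ satisfying $\overline{\partial}_{\mathcal{F}}^2=0$; covariant if $\mathcal{F}\in{}^A_B\mathrm{mod}_0$ and $\overline{\partial}_{\mathcal{F}}$ is a comodule map. A covariant Hermitian holomorphic module is both a covariant Hermitian and a covariant holomorphic module. Its Chern connection is the unique connection $\nabla$ with $(0,1)$-part $\overline{\partial}_{\mathcal{F}}$ that is compatible with the metric in the sense of Beggs and Majid: writing the metric in the convention $\langle bf,ck\rangle=b\langle f,k\rangle c^*$, $\mathrm{d}\langle f,k\rangle=\langle\nabla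 f,k\rangle+\langle f,\nabla k\rangle$, where $\langle\omega\otimes f,k\rangle:=\omega\langle f,k\rangle$, $\langle f,\omega\otimes k\rangle:=\langle f,k\rangle\omega^*$; it is a left $A$-comodule map. $\partial_{\mathcal{F}}$ is its $(1,0)$-part, so $\nabla=\partial_{\mathcal{F}}+\overline{\partial}_{\mathcal{F}}$ on $\Omega^\bullet\otimes_B\mathcal{F}$. These operators are adjointable for $\langle-,-\rangle_{\mathcal{F}}$ on $\Omega^\bullet\otimes_B\mathcal F$, with adjoints marked $\dagger$; $D_\nabla:=\nabla+\nabla^\dagger$, $D_{\partial_{\mathcal{F}}}:=\partial_{\mathcal{F}}+\partial_{\mathcal{F}}^\dagger$, $D_{\overline{\partial}_{\mathcal{F}}}:=\overline{\partial}_{\mathcal{F}}+\overline{\partial}_{\mathcal{F}}^\dagger$. *)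

theory Defs
  imports "HOL-Analysis.Analysis" "HOL-Library.Poly_Mapping" "HOL-Algebra.Module"
begin

section \<open>Complex vector spaces, algebras and Hilbert spaces\<close>

class complex_vector = real_vector +
  fixes scaleC :: "complex \<Rightarrow> 'a \<Rightarrow> 'a"
  assumes scaleC_add_right: "scaleC c (x + y) = scaleC c x + scaleC c y"
    and scaleC_add_left: "scaleC (c + e) x = scaleC c x + scaleC e x"
    and scaleC_scaleC: "scaleC c (scaleC e x) = scaleC (c * e) x"
    and scaleC_one: "scaleC 1 x = x"
    and scaleR_scaleC: "scaleR r x = scaleC (complex_of_real r) x"

class complex_algebra_1 = complex_vector + ring_1 +
  assumes mult_scaleC_left: "scaleC c x * y = scaleC c (x * y)"
    and mult_scaleC_right: "x * scaleC c y = scaleC c (x * y)"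

text \<open>Inner products are conjugate-linear in the first variable.\<close>

class chilbert_space = complex_vector + real_normed_vector + complete_space +
  fixes cinner :: "'a \<Rightarrow> 'a \<Rightarrow> complex"
  assumes cinner_add_right: "cinner x (y + z) = cinner x y + cinner x z"
    and cinner_scaleC_right: "cinner x (scaleC c y) = c * cinner x y"
    and cinner_commute: "cinner x y = cnj (cinner y x)"
    and norm_eq_sqrt_cinner: "norm x = sqrt (Re (cinner x x))"

instantiation complex :: complex_algebra_1
begin
definition scaleC_complex :: "complex \<Rightarrow> complex \<Rightarrow> complex" where
  "scaleC_complex c x = c * x"
instance
  by standard (auto simp: scaleC_complex_def algebra_simps scaleR_conv_of_real)
end

interpretation complex_vector: vector_space "scaleC :: complex \<Rightarrow> 'a \<Rightarrow> 'a::complex_vector"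
  by standard (auto simp: scaleC_add_right scaleC_add_left scaleC_scaleC scaleC_one)

abbreviation csubspace :: "'a::complex_vector set \<Rightarrow> bool" where
  "csubspace \<equiv> module.subspace scaleC"

abbreviation clinear :: "('a::complex_vector \<Rightarrow> 'b::complex_vector) \<Rightarrow> bool" where
  "clinear \<equiv> Vector_Spaces.linear scaleC scaleC"

definition conj_linear :: "('a::complex_vector \<Rightarrow> 'b::complex_vector) \<Rightarrow> bool" where
  "conj_linear f \<longleftrightarrow> (\<forall>x y. f (x + y) = f x + f y) \<and> (\<forall>c x. f (scaleC c x) = scaleC (cnj c) (f x))"

definition biadditive :: "('a::ab_group_add \<Rightarrow> 'b::ab_group_add \<Rightarrow> 'c::ab_group_add) \<Rightarrow> bool" where
  "biadditive f \<longleftrightarrow> (\<forall>x y z. f (x + y) z = f x z + f y z) \<and> (\<forall>x y z. f x (y + z) = f x y + f x z)"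

definition alg_hom :: "('a::complex_algebra_1 \<Rightarrow> 'b::complex_algebra_1) \<Rightarrow> bool" where
  "alg_hom f \<longleftrightarrow> clinear f \<and> f 1 = 1 \<and> (\<forall>x y. f (x * y) = f x * f y)"

definition star_structure :: "('a::complex_algebra_1 \<Rightarrow> 'a) \<Rightarrow> bool" where
  "star_structure s \<longleftrightarrow> conj_linear s \<and> (\<forall>x. s (s x) = x) \<and> (\<forall>x y. s (x * y) = s y * s x)"

definition subalgebra :: "'a::complex_algebra_1 set \<Rightarrow> bool" where
  "subalgebra U \<longleftrightarrow> csubspace U \<and> 1 \<in> U \<and> (\<forall>x\<in>U. \<forall>y\<in>U. x * y \<in> U)"

definition add_subgroup :: "'a::ab_group_add set \<Rightarrow> bool" where
  "add_subgroup G \<longleftrightarrow> 0 \<in> G \<and> (\<forall>x\<in>G. \<forall>y\<in>G. x - y \<in> G)"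

abbreviation add_span :: "'a::ab_group_add set \<Rightarrow> 'a set" where
  "add_span S \<equiv> add_subgroup hull S"

text \<open>Internal direct sums \<open>X = \<Oplus>\<^sub>i V i\<close>; \<open>component V x i\<close> is the \<open>V i\<close>-component of \<open>x\<close>.\<close>

definition is_decomposition :: "('i \<Rightarrow> 'v set) \<Rightarrow> 'v::complex_vector \<Rightarrow> ('i \<Rightarrow> 'v) \<Rightarrow> bool" where
  "is_decomposition V x c \<longleftrightarrow>
     (\<forall>i. c i \<in> V i) \<and> finite {i. c i \<noteq> 0} \<and> x = (\<Sum>i | c i \<noteq> 0. c i)"

definition direct_sum :: "('i \<Rightarrow> 'v set) \<Rightarrow> 'v::complex_vector set \<Rightarrow> bool" where
  "direct_sum V X \<longleftrightarrow> csubspace X \<and> (\<forall>i. csubspace (V i) \<and> V i \<subseteq> X)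
     \<and> (\<forall>x\<in>X. \<exists>!c. is_decomposition V x c)"

definition component :: "('i \<Rightarrow> 'v set) \<Rightarrow> 'v::complex_vector \<Rightarrow> 'i \<Rightarrow> 'v" where
  "component V x = (THE c. is_decomposition V x c)"


section \<open>Tensor products\<close>

text \<open>The defining relations of \<open>M \<otimes>\<^sub>R N\<close> inside the free abelian group on \<open>M \<times> N\<close>, where \<open>M\<close>
  and \<open>N\<close> are given by carriers and additions, \<open>R\<close> acting on \<open>M\<close> from the right and on \<open>N\<close>
  from the left.\<close>

definition tensor_rel ::
  "'m set \<Rightarrow> ('m \<Rightarrow> 'm \<Rightarrow> 'm) \<Rightarrow> 'n set \<Rightarrow> ('n \<Rightarrow> 'n \<Rightarrow> 'n) \<Rightarrow> ('m \<Rightarrow> 'r \<Rightarrow> 'm) \<Rightarrow> ('r \<Rightarrow> 'n \<Rightarrow> 'n)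
    \<Rightarrow> ('m \<times> 'n \<Rightarrow>\<^sub>0 int) set" where
  "tensor_rel M addM N addN ract lact = add_span
     ({frag_of (addM x y, n) - frag_of (x, n) - frag_of (y, n) | x y n. x \<in> M \<and> y \<in> M \<and> n \<in> N}
    \<union> {frag_of (x, addN m n) - frag_of (x, m) - frag_of (x, n) | x m n. x \<in> M \<and> m \<in> N \<and> n \<in> N}
    \<union> {frag_of (ract x r, n) - frag_of (x, lact r n) | x r n. x \<in> M \<and> n \<in> N})"

definition frag_eval :: "('m \<Rightarrow> 'n \<Rightarrow> 'v::complex_vector) \<Rightarrow> ('m \<times> 'n \<Rightarrow>\<^sub>0 int) \<Rightarrow> 'v" where
  "frag_eval f z = (\<Sum>p\<in>Poly_Mapping.keys z. scaleR (of_int (Poly_Mapping.lookup z p)) (f (fst p) (snd p)))"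

text \<open>\<open>is_tensor_product ract lact t\<close>: the vector space \<open>'t\<close> together with \<open>t m n\<close> = \<open>m \<otimes> n\<close> is
  (canonically isomorphic to) the quotient of the free abelian group by these relations.\<close>

definition is_tensor_product ::
  "('m::complex_vector \<Rightarrow> 'r \<Rightarrow> 'm) \<Rightarrow> ('r \<Rightarrow> 'n::complex_vector \<Rightarrow> 'n)
    \<Rightarrow> ('m \<Rightarrow> 'n \<Rightarrow> 't::complex_vector) \<Rightarrow> bool" where
  "is_tensor_product ract lact t \<longleftrightarrow>
     surj (frag_eval t)
     \<and> (\<forall>z. frag_eval t z = 0 \<longleftrightarrow> z \<in> tensor_rel UNIV (+) UNIV (+) ract lact)
     \<and> (\<forall>c m n. t (scaleC c m) n = scaleC c (t m n))"

text \<open>The map out of a tensor product induced by a balanced biadditive \<open>f\<close>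
  (see \<open>tlift_tensor\<close> below).\<close>

definition tlift :: "('m \<Rightarrow> 'n \<Rightarrow> 't::complex_vector) \<Rightarrow> ('m \<Rightarrow> 'n \<Rightarrow> 'v::complex_vector) \<Rightarrow> 't \<Rightarrow> 'v" where
  "tlift t f x = frag_eval f (SOME z. frag_eval t z = x)"

lemma add_subgroup_add_span: "add_subgroup (add_span S)"
  by (rule hull_in) (auto simp: add_subgroup_def)

lemma add_subgroup_minus: "add_subgroup G \<Longrightarrow> x \<in> G \<Longrightarrow> - x \<in> G"
  unfolding add_subgroup_def by (metis diff_0)

lemma add_subgroup_add: "add_subgroup G \<Longrightarrow> x \<in> G \<Longrightarrow> y \<in> G \<Longrightarrow> x + y \<in> G"
  using add_subgroup_minus[of G y] unfolding add_subgroup_def by fastforce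

lemma frag_eval_superset:
  assumes "finite K" "Poly_Mapping.keys z \<subseteq> K"
  shows "frag_eval f z = (\<Sum>p\<in>K. scaleR (of_int (Poly_Mapping.lookup z p)) (f (fst p) (snd p)))"
  unfolding frag_eval_def using assms
  by (intro sum.mono_neutral_left) (auto simp: in_keys_iff)

lemma frag_eval_diff: "frag_eval f (x - y) = frag_eval f x - frag_eval f y"
proof -
  let ?K = "Poly_Mapping.keys x \<union> Poly_Mapping.keys y"
  have "Poly_Mapping.keys (x - y) \<subseteq> ?K"
    by (rule keys_diff)
  then show ?thesis
    by (simp add: frag_eval_superset[where K = ?K] lookup_minus scaleR_left_diff_distrib
        sum_subtractf)
qed

lemma frag_eval_of [simp]: "frag_eval f (frag_of (m, n)) = f m n"
  by (simp add: frag_eval_def)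

lemma frag_eval_0 [simp]: "frag_eval f 0 = 0"
  by (simp add: frag_eval_def)

lemma frag_eval_add: "frag_eval f (x + y) = frag_eval f x + frag_eval f y"
  using frag_eval_diff[of f x "- y"] frag_eval_diff[of f 0 y] by simp

lemma frag_eval_tensor_rel:
  assumes f: "biadditive f" "\<And>m r n. f (ract m r) n = f m (lact r n)"
    and z: "z \<in> tensor_rel UNIV (+) UNIV (+) ract lact"
  shows "frag_eval f z = 0"
proof -
  have "tensor_rel UNIV (+) UNIV (+) ract lact \<subseteq> {z. frag_eval f z = 0}"
    unfolding tensor_rel_def
    by (rule hull_minimal)
      (use f in \<open>auto simp: add_subgroup_def frag_eval_diff biadditive_def\<close>)
  with z show ?thesis by auto
qed

lemma tlift_tensor:
  assumes t: "is_tensor_product ract lact t"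
    and f: "biadditive f" "\<And>m r n. f (ract m r) n = f m (lact r n)"
  shows "tlift t f (t m n) = f m n"
proof -
  define z where "z = (SOME z. frag_eval t z = t m n)"
  have "\<exists>z. frag_eval t z = t m n"
    by (rule exI[of _ "frag_of (m, n)"]) (rule frag_eval_of)
  then have "frag_eval t z = t m n"
    unfolding z_def by (rule someI_ex)
  then have z: "frag_eval t (z - frag_of (m, n)) = 0"
    by (simp add: frag_eval_diff)
  have K: "\<forall>z. frag_eval t z = 0 \<longleftrightarrow> z \<in> tensor_rel UNIV (+) UNIV (+) ract lact"
    using t unfolding is_tensor_product_def by (elim conjE)
  have "z - frag_of (m, n) \<in> tensor_rel UNIV (+) UNIV (+) ract lact"
    by (rule iffD1[OF spec[OF K] z])
  then have "frag_eval f (z - frag_of (m, n)) = 0"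
    by (rule frag_eval_tensor_rel[where ract = ract and lact = lact and f = f, rotated 2])
      (use f in auto)
  then have "frag_eval f z = f m n"
    by (simp add: frag_eval_diff)
  then show ?thesis
    unfolding tlift_def z_def .
qed


subsection \<open>Tensor products over \<open>\<complex>\<close>\<close>

definition ctensor_rel :: "('a::complex_vector \<times> 'b::complex_vector \<Rightarrow>\<^sub>0 int) set" where
  "ctensor_rel = tensor_rel UNIV (+) UNIV (+) (\<lambda>x c. scaleC c x) scaleC"

lemma add_subgroup_ctensor_rel: "add_subgroup ctensor_rel"
  unfolding ctensor_rel_def tensor_rel_def by (rule add_subgroup_add_span)

quotient_type (overloaded) ('a, 'b) ctensor = "('a::complex_vector \<times> 'b::complex_vector) \<Rightarrow>\<^sub>0 int"
  / "\<lambda>x y. x - y \<in> ctensor_rel"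
proof (rule equivpI)
  note G = add_subgroup_ctensor_rel
  show "reflp (\<lambda>x y. x - y \<in> (ctensor_rel :: ('a \<times> 'b \<Rightarrow>\<^sub>0 int) set))"
    using G by (auto simp: reflp_def add_subgroup_def)
  show "symp (\<lambda>x y. x - y \<in> (ctensor_rel :: ('a \<times> 'b \<Rightarrow>\<^sub>0 int) set))"
  proof (rule sympI)
    fix x y :: "'a \<times> 'b \<Rightarrow>\<^sub>0 int"
    assume "x - y \<in> ctensor_rel"
    from add_subgroup_minus[OF G this] show "y - x \<in> ctensor_rel" by simp
  qed
  show "transp (\<lambda>x y. x - y \<in> (ctensor_rel :: ('a \<times> 'b \<Rightarrow>\<^sub>0 int) set))"
  proof (rule transpI)
    fix x y z :: "'a \<times> 'b \<Rightarrow>\<^sub>0 int"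
    assume "x - y \<in> ctensor_rel" "y - z \<in> ctensor_rel"
    from add_subgroup_add[OF G this] show "x - z \<in> ctensor_rel" by simp
  qed
qed

lift_definition ctens :: "'a::complex_vector \<Rightarrow> 'b::complex_vector \<Rightarrow> ('a, 'b) ctensor"
  is "\<lambda>a b. frag_of (a, b)" .

definition frag_scale :: "complex \<Rightarrow> ('a::complex_vector \<times> 'b \<Rightarrow>\<^sub>0 int) \<Rightarrow> ('a \<times> 'b \<Rightarrow>\<^sub>0 int)" where
  "frag_scale c = frag_extend (\<lambda>p. frag_of (scaleC c (fst p), snd p))"

lemma frag_scale_ctensor_rel:
  assumes "z \<in> ctensor_rel" shows "frag_scale c z \<in> ctensor_rel"
proof -
  have "tensor_rel UNIV (+) UNIV (+) (\<lambda>x c. scaleC c x) scaleC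
      \<subseteq> {z :: ('a \<times> 'b \<Rightarrow>\<^sub>0 int). frag_scale c z \<in> ctensor_rel}"
    unfolding tensor_rel_def
  proof (rule hull_minimal)
    have "frag_of (scaleC c x + scaleC c y, n) - frag_of (scaleC c x, n) - frag_of (scaleC c y, n)
        \<in> ctensor_rel" for x y :: 'a and n :: 'b
      unfolding ctensor_rel_def tensor_rel_def by (rule hull_inc) blast
    moreover have "frag_of (scaleC c x, m + n) - frag_of (scaleC c x, m) - frag_of (scaleC c x, n)
        \<in> ctensor_rel" for x :: 'a and m n :: 'b
      unfolding ctensor_rel_def tensor_rel_def by (rule hull_inc) blast
    moreover have "frag_of (scaleC c (scaleC r x), n) - frag_of (scaleC c x, scaleC r n)
        \<in> ctensor_rel" for x :: 'a and n :: 'b and r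
    proof -
      have "scaleC c (scaleC r x) = scaleC r (scaleC c x)"
        by (simp add: scaleC_scaleC mult.commute)
      moreover have "frag_of (scaleC r (scaleC c x), n) - frag_of (scaleC c x, scaleC r n)
          \<in> ctensor_rel"
        unfolding ctensor_rel_def tensor_rel_def by (rule hull_inc) blast
      ultimately show ?thesis by metis
    qed
    ultimately show "{frag_of (x + y, n) - frag_of (x, n) - frag_of (y, n) |x y n.
          x \<in> UNIV \<and> y \<in> UNIV \<and> n \<in> UNIV}
        \<union> {frag_of (x, m + n) - frag_of (x, m) - frag_of (x, n) |x m n.
          x \<in> UNIV \<and> m \<in> UNIV \<and> n \<in> UNIV}
        \<union> {frag_of (scaleC r x, n) - frag_of (x, scaleC r n) |x r n. x \<in> UNIV \<and> n \<in> UNIV}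
      \<subseteq> {z :: ('a \<times> 'b \<Rightarrow>\<^sub>0 int). frag_scale c z \<in> ctensor_rel}"
      by (auto simp: frag_scale_def frag_extend_diff scaleC_add_right)
    show "add_subgroup {z :: ('a \<times> 'b \<Rightarrow>\<^sub>0 int). frag_scale c z \<in> ctensor_rel}"
      using add_subgroup_ctensor_rel by (auto simp: add_subgroup_def frag_scale_def frag_extend_diff)
  qed
  with assms show ?thesis by (auto simp: ctensor_rel_def)
qed

instantiation ctensor :: (complex_vector, complex_vector) complex_vector
begin

lift_definition zero_ctensor :: "('a, 'b) ctensor" is 0 .

lift_definition plus_ctensor :: "('a, 'b) ctensor \<Rightarrow> ('a, 'b) ctensor \<Rightarrow> ('a, 'b) ctensor" is "(+)"
proof -
  fix u v x y :: "('a \<times> 'b) \<Rightarrow>\<^sub>0 int"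
  assume "u - v \<in> ctensor_rel" "x - y \<in> ctensor_rel"
  from add_subgroup_add[OF add_subgroup_ctensor_rel this]
  show "(u + x) - (v + y) \<in> ctensor_rel"
    by (simp add: algebra_simps)
qed

lift_definition uminus_ctensor :: "('a, 'b) ctensor \<Rightarrow> ('a, 'b) ctensor" is uminus
proof -
  fix u v :: "('a \<times> 'b) \<Rightarrow>\<^sub>0 int"
  assume "u - v \<in> ctensor_rel"
  from add_subgroup_minus[OF add_subgroup_ctensor_rel this]
  show "- u - - v \<in> ctensor_rel"
    by simp
qed

lift_definition minus_ctensor :: "('a, 'b) ctensor \<Rightarrow> ('a, 'b) ctensor \<Rightarrow> ('a, 'b) ctensor" is "(-)"
proof -
  fix u v x y :: "('a \<times> 'b) \<Rightarrow>\<^sub>0 int"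
  assume "u - v \<in> ctensor_rel" "x - y \<in> ctensor_rel"
  then have "(u - v) - (x - y) \<in> ctensor_rel"
    using add_subgroup_ctensor_rel by (auto simp: add_subgroup_def)
  then show "(u - x) - (v - y) \<in> ctensor_rel"
    by (simp add: algebra_simps)
qed

lift_definition scaleC_ctensor :: "complex \<Rightarrow> ('a, 'b) ctensor \<Rightarrow> ('a, 'b) ctensor" is frag_scale
proof -
  fix c and u v :: "('a \<times> 'b) \<Rightarrow>\<^sub>0 int"
  assume "u - v \<in> ctensor_rel"
  from frag_scale_ctensor_rel[OF this, of c]
  show "frag_scale c u - frag_scale c v \<in> ctensor_rel"
    by (simp add: frag_scale_def frag_extend_diff)
qed

definition scaleR_ctensor :: "real \<Rightarrow> ('a, 'b) ctensor \<Rightarrow> ('a, 'b) ctensor" where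
  "scaleR_ctensor r x = scaleC (complex_of_real r) x"

instance
proof
  fix a b c :: "('a, 'b) ctensor" and r s :: real and k e :: complex
  note G = add_subgroup_ctensor_rel[where ?'a = 'a and ?'b = 'b]
  have Z: "0 \<in> (ctensor_rel :: ('a \<times> 'b \<Rightarrow>\<^sub>0 int) set)"
    using G by (simp add: add_subgroup_def)
  have gen: "P z" if "P 0" "\<And>x n. P (frag_of (x, n))" "\<And>u v. P u \<Longrightarrow> P v \<Longrightarrow> P (u - v)"
    for P and z :: "'a \<times> 'b \<Rightarrow>\<^sub>0 int"
    by (rule frag_induction[of z UNIV P]) (use that in auto)
  show "a + b + c = a + (b + c)" by transfer (simp add: Z add.assoc)
  show "a + b = b + a" by transfer (simp add: Z add.commute)
  show "0 + a = a" by transfer (simp add: Z)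
  show "- a + a = 0" by transfer (simp add: Z)
  show "a - b = a + - b" by transfer (simp add: Z)
  have add_right: "scaleC k (a + b) = scaleC k a + scaleC k b" for k and a b :: "('a, 'b) ctensor"
    by transfer (simp add: Z frag_scale_def frag_extend_add)
  have *: "frag_scale (k + e) z - (frag_scale k z + frag_scale e z) \<in> ctensor_rel"
    for k e and z :: "'a \<times> 'b \<Rightarrow>\<^sub>0 int"
  proof (rule gen[where P = "\<lambda>z. frag_scale (k + e) z - (frag_scale k z + frag_scale e z) \<in> ctensor_rel"])
    fix x :: 'a and n :: 'b
    have "frag_of (scaleC k x + scaleC e x, n) - frag_of (scaleC k x, n) - frag_of (scaleC e x, n)
        \<in> ctensor_rel"
      unfolding ctensor_rel_def tensor_rel_def by (rule hull_inc) blast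
    then show "frag_scale (k + e) (frag_of (x, n))
        - (frag_scale k (frag_of (x, n)) + frag_scale e (frag_of (x, n))) \<in> ctensor_rel"
      by (simp add: frag_scale_def scaleC_add_left diff_diff_eq)
  next
    fix u v :: "'a \<times> 'b \<Rightarrow>\<^sub>0 int"
    assume "frag_scale (k + e) u - (frag_scale k u + frag_scale e u) \<in> ctensor_rel"
      "frag_scale (k + e) v - (frag_scale k v + frag_scale e v) \<in> ctensor_rel"
    then have "(frag_scale (k + e) u - (frag_scale k u + frag_scale e u))
        - (frag_scale (k + e) v - (frag_scale k v + frag_scale e v)) \<in> ctensor_rel"
      using G by (auto simp: add_subgroup_def)
    then show "frag_scale (k + e) (u - v) - (frag_scale k (u - v) + frag_scale e (u - v))
        \<in> ctensor_rel"
      by (simp add: frag_scale_def frag_extend_diff algebra_simps)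
  qed (simp add: frag_scale_def Z)
  have add_left: "scaleC (k + e) a = scaleC k a + scaleC e a" for k e and a :: "('a, 'b) ctensor"
    by transfer (rule *)
  have **: "frag_scale k (frag_scale e z) - frag_scale (k * e) z \<in> ctensor_rel"
    for k e and z :: "'a \<times> 'b \<Rightarrow>\<^sub>0 int"
  proof (rule gen[where P = "\<lambda>z. frag_scale k (frag_scale e z) - frag_scale (k * e) z \<in> ctensor_rel"])
    fix u v :: "'a \<times> 'b \<Rightarrow>\<^sub>0 int"
    assume "frag_scale k (frag_scale e u) - frag_scale (k * e) u \<in> ctensor_rel"
      "frag_scale k (frag_scale e v) - frag_scale (k * e) v \<in> ctensor_rel"
    then have "(frag_scale k (frag_scale e u) - frag_scale (k * e) u)
        - (frag_scale k (frag_scale e v) - frag_scale (k * e) v) \<in> ctensor_rel"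
      using G by (auto simp: add_subgroup_def)
    then show "frag_scale k (frag_scale e (u - v)) - frag_scale (k * e) (u - v) \<in> ctensor_rel"
      by (simp add: frag_scale_def frag_extend_diff algebra_simps)
  qed (simp_all add: frag_scale_def Z scaleC_scaleC)
  have assoc: "scaleC k (scaleC e a) = scaleC (k * e) a" for k e and a :: "('a, 'b) ctensor"
    by transfer (rule **)
  have ***: "frag_scale 1 z - z \<in> ctensor_rel" for z :: "'a \<times> 'b \<Rightarrow>\<^sub>0 int"
  proof (rule gen[where P = "\<lambda>z. frag_scale 1 z - z \<in> ctensor_rel"])
    fix u v :: "'a \<times> 'b \<Rightarrow>\<^sub>0 int"
    assume "frag_scale 1 u - u \<in> ctensor_rel" "frag_scale 1 v - v \<in> ctensor_rel"
    then have "(frag_scale 1 u - u) - (frag_scale 1 v - v) \<in> ctensor_rel"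
      using G by (auto simp: add_subgroup_def)
    then show "frag_scale 1 (u - v) - (u - v) \<in> ctensor_rel"
      by (simp add: frag_scale_def frag_extend_diff algebra_simps)
  qed (simp_all add: frag_scale_def Z scaleC_one)
  have one: "scaleC 1 a = a" for a :: "('a, 'b) ctensor"
    by transfer (rule ***)
  show "scaleC k (a + b) = scaleC k a + scaleC k b" by (rule add_right)
  show "scaleC (k + e) a = scaleC k a + scaleC e a" by (rule add_left)
  show "scaleC k (scaleC e a) = scaleC (k * e) a" by (rule assoc)
  show "scaleC 1 a = a" by (rule one)
  show "r *\<^sub>R a = scaleC (complex_of_real r) a" by (simp add: scaleR_ctensor_def)
  show "r *\<^sub>R (a + b) = r *\<^sub>R a + r *\<^sub>R b" by (simp add: scaleR_ctensor_def add_right)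
  show "(r + s) *\<^sub>R a = r *\<^sub>R a + s *\<^sub>R a" by (simp add: scaleR_ctensor_def add_left)
  show "r *\<^sub>R s *\<^sub>R a = (r * s) *\<^sub>R a" by (simp add: scaleR_ctensor_def assoc)
  show "1 *\<^sub>R a = a" by (simp add: scaleR_ctensor_def one)
qed

end

lemma ctensor_rel_generators:
  "frag_of (x + y, n) - frag_of (x, n) - frag_of (y, n) \<in> ctensor_rel"
  "frag_of (x, m + n) - frag_of (x, m) - frag_of (x, n) \<in> ctensor_rel"
  "frag_of (scaleC c x, n) - frag_of (x, scaleC c n) \<in> ctensor_rel"
  unfolding ctensor_rel_def tensor_rel_def by (rule hull_inc, blast)+

lemma ctens_biadditive: "biadditive ctens"
proof -
  have "ctens (x + y) n = ctens x n + ctens y n" for x y :: 'a and n :: 'b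
    by transfer (use ctensor_rel_generators(1) in \<open>simp add: diff_diff_eq\<close>)
  moreover have "ctens x (m + n) = ctens x m + ctens x n" for x :: 'a and m n :: 'b
    by transfer (use ctensor_rel_generators(2) in \<open>simp add: diff_diff_eq\<close>)
  ultimately show ?thesis by (simp add: biadditive_def)
qed

lemma ctens_scaleC:
  fixes x :: "'a::complex_vector" and y :: "'b::complex_vector"
  shows "ctens (scaleC c x) y = scaleC c (ctens x y)"
    and "ctens x (scaleC c y) = scaleC c (ctens x y)"
proof -
  have Z: "0 \<in> (ctensor_rel :: ('a \<times> 'b \<Rightarrow>\<^sub>0 int) set)"
    using add_subgroup_ctensor_rel[where ?'a = 'a and ?'b = 'b] by (simp add: add_subgroup_def)
  show 1: "ctens (scaleC c x) y = scaleC c (ctens x y)"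
    by transfer (simp add: frag_scale_def Z)
  have "ctens (scaleC c x) y = ctens x (scaleC c y)"
    by transfer (rule ctensor_rel_generators(3))
  with 1 show "ctens x (scaleC c y) = scaleC c (ctens x y)" by simp
qed

lemma frag_eval_ctens: "frag_eval ctens z = abs_ctensor z"
proof (rule frag_induction[of z UNIV "\<lambda>z. frag_eval ctens z = abs_ctensor z"])
  show "frag_eval ctens 0 = abs_ctensor 0"
    by (simp add: zero_ctensor.abs_eq)
  show "frag_eval ctens (frag_of p) = abs_ctensor (frag_of p)" for p :: "'a \<times> 'b"
    by (cases p) (simp add: ctens.abs_eq)
  show "frag_eval ctens (u - v) = abs_ctensor (u - v)"
    if "frag_eval ctens u = abs_ctensor u" "frag_eval ctens v = abs_ctensor v"
    for u v :: "'a \<times> 'b \<Rightarrow>\<^sub>0 int"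
    using that by (simp add: frag_eval_diff minus_ctensor.abs_eq)
qed simp

lemma is_tensor_product_ctens: "is_tensor_product (\<lambda>x c. scaleC c x) scaleC ctens"
proof -
  have "frag_eval ctens (rep_ctensor t) = t" for t :: "('a, 'b) ctensor"
    by (simp only: frag_eval_ctens Quotient_abs_rep[OF Quotient_ctensor])
  then have "surj (frag_eval (ctens :: 'a \<Rightarrow> 'b \<Rightarrow> _))"
    by (rule surjI)
  moreover have "frag_eval ctens z = 0 \<longleftrightarrow> z \<in> ctensor_rel" for z :: "'a \<times> 'b \<Rightarrow>\<^sub>0 int"
    by (simp add: frag_eval_ctens zero_ctensor.abs_eq ctensor.abs_eq_iff)
  ultimately show ?thesis
    unfolding is_tensor_product_def ctensor_rel_def[symmetric] by (simp add: ctens_scaleC)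
qed


lemmas ctensor_lift = tlift_tensor[OF is_tensor_product_ctens]

definition ctmap :: "('a::complex_vector \<Rightarrow> 'c::complex_vector) \<Rightarrow> ('b::complex_vector \<Rightarrow> 'd::complex_vector)
    \<Rightarrow> ('a, 'b) ctensor \<Rightarrow> ('c, 'd) ctensor" where
  "ctmap f g = tlift ctens (\<lambda>x y. ctens (f x) (g y))"

text \<open>\<open>ctzip p q\<close> sends \<open>(x \<otimes> y, u \<otimes> v)\<close> to \<open>p x u \<otimes> q y v\<close>.\<close>

definition ctzip :: "('a::complex_vector \<Rightarrow> 'c::complex_vector \<Rightarrow> 'e::complex_vector)
    \<Rightarrow> ('b::complex_vector \<Rightarrow> 'd::complex_vector \<Rightarrow> 'f::complex_vector)
    \<Rightarrow> ('a, 'b) ctensor \<Rightarrow> ('c, 'd) ctensor \<Rightarrow> ('e, 'f) ctensor" where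
  "ctzip p q s t = tlift ctens (\<lambda>x y. tlift ctens (\<lambda>u v. ctens (p x u) (q y v)) t) s"

definition ctassoc :: "(('a::complex_vector, 'b::complex_vector) ctensor, 'c::complex_vector) ctensor
    \<Rightarrow> ('a, ('b, 'c) ctensor) ctensor" where
  "ctassoc = tlift ctens (\<lambda>s z. tlift ctens (\<lambda>x y. ctens x (ctens y z)) s)"

definition ctsub :: "'a::complex_vector set \<Rightarrow> 'b::complex_vector set \<Rightarrow> ('a, 'b) ctensor set" where
  "ctsub U V = add_span {ctens x y | x y. x \<in> U \<and> y \<in> V}"


section \<open>Compact quantum group algebras\<close>

record (overloaded) ('a::complex_algebra_1) cqg_data =
  comult :: "'a \<Rightarrow> ('a, 'a) ctensor"
  counit :: "'a \<Rightarrow> complex"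
  antipode :: "'a \<Rightarrow> 'a"
  hstar :: "'a \<Rightarrow> 'a"
  haar :: "'a \<Rightarrow> complex"

locale hopf_star_algebra =
  fixes H :: "('a::complex_algebra_1) cqg_data"
  assumes star: "star_structure (hstar H)"
    and comult_linear: "clinear (comult H)"
    and comult_one: "comult H 1 = ctens 1 1"
    and comult_mult: "comult H (x * y) = ctzip (*) (*) (comult H x) (comult H y)"
    and coassoc: "ctassoc (ctmap (comult H) id (comult H x)) = ctmap id (comult H) (comult H x)"
    and counit_alg_hom: "alg_hom (counit H)"
    and counit_left: "tlift ctens (\<lambda>x y. scaleC (counit H x) y) (comult H x) = x"
    and counit_right: "tlift ctens (\<lambda>x y. scaleC (counit H y) x) (comult H x) = x"
    and antipode_linear: "clinear (antipode H)"
    and antipode_left: "tlift ctens (\<lambda>x y. antipode H x * y) (comult H x) = scaleC (counit H x) 1"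
    and antipode_right: "tlift ctens (\<lambda>x y. x * antipode H y) (comult H x) = scaleC (counit H x) 1"
    and comult_star: "comult H (hstar H x) = ctmap (hstar H) (hstar H) (comult H x)"
    and counit_star: "counit H (hstar H x) = cnj (counit H x)"

definition subcoalgebra :: "('a::complex_algebra_1) cqg_data \<Rightarrow> 'a set \<Rightarrow> bool" where
  "subcoalgebra H D \<longleftrightarrow> csubspace D \<and> (\<forall>x\<in>D. comult H x \<in> ctsub D D)"

definition simple_subcoalgebra :: "('a::complex_algebra_1) cqg_data \<Rightarrow> 'a set \<Rightarrow> bool" where
  "simple_subcoalgebra H D \<longleftrightarrow> subcoalgebra H D \<and> D \<noteq> {0}
     \<and> (\<forall>E. subcoalgebra H E \<and> E \<subseteq> D \<longrightarrow> E = {0} \<or> E = D)"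

definition cosemisimple :: "('a::complex_algebra_1) cqg_data \<Rightarrow> bool" where
  "cosemisimple H \<longleftrightarrow> direct_sum (\<lambda>D. if simple_subcoalgebra H D then D else {0}) UNIV"

locale cqga = hopf_star_algebra +
  assumes cosemisimple: "cosemisimple H"
    and haar_linear: "clinear (haar H)"
    and haar_one: "haar H 1 = 1"
    and haar_right: "tlift ctens (\<lambda>x y. scaleC (haar H y) x) (comult H x) = scaleC (haar H x) 1"
    and haar_left: "tlift ctens (\<lambda>x y. scaleC (haar H x) y) (comult H x) = scaleC (haar H x) 1"
    and haar_state: "haar H (hstar H x * x) \<in> nonneg_Reals"


section \<open>Faithful flatness\<close>

definition left_module :: "('b::ring_1, 'u) module \<Rightarrow> bool" where
  "left_module M \<longleftrightarrow> abelian_group M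
     \<and> (\<forall>b. \<forall>x\<in>carrier M. b \<odot>\<^bsub>M\<^esub> x \<in> carrier M)
     \<and> (\<forall>b c. \<forall>x\<in>carrier M. (b + c) \<odot>\<^bsub>M\<^esub> x = b \<odot>\<^bsub>M\<^esub> x \<oplus>\<^bsub>M\<^esub> c \<odot>\<^bsub>M\<^esub> x)
     \<and> (\<forall>b. \<forall>x\<in>carrier M. \<forall>y\<in>carrier M. b \<odot>\<^bsub>M\<^esub> (x \<oplus>\<^bsub>M\<^esub> y) = b \<odot>\<^bsub>M\<^esub> x \<oplus>\<^bsub>M\<^esub> b \<odot>\<^bsub>M\<^esub> y)
     \<and> (\<forall>b c. \<forall>x\<in>carrier M. (b * c) \<odot>\<^bsub>M\<^esub> x = b \<odot>\<^bsub>M\<^esub> (c \<odot>\<^bsub>M\<^esub> x))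
     \<and> (\<forall>x\<in>carrier M. 1 \<odot>\<^bsub>M\<^esub> x = x)"

definition left_module_map ::
  "('b::ring_1, 'u) module \<Rightarrow> ('b, 'v) module \<Rightarrow> ('u \<Rightarrow> 'v) \<Rightarrow> bool" where
  "left_module_map M N f \<longleftrightarrow> f ` carrier M \<subseteq> carrier N
     \<and> (\<forall>x\<in>carrier M. \<forall>y\<in>carrier M. f (x \<oplus>\<^bsub>M\<^esub> y) = f x \<oplus>\<^bsub>N\<^esub> f y)
     \<and> (\<forall>b. \<forall>x\<in>carrier M. f (b \<odot>\<^bsub>M\<^esub> x) = b \<odot>\<^bsub>N\<^esub> f x)"

definition module_exact ::
  "('b, 'u) module \<Rightarrow> ('b, 'u) module \<Rightarrow> ('b, 'u) module \<Rightarrow> ('u \<Rightarrow> 'u) \<Rightarrow> ('u \<Rightarrow> 'u) \<Rightarrow> bool" where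
  "module_exact M N P f g \<longleftrightarrow> f ` carrier M = {y \<in> carrier N. g y = \<zero>\<^bsub>P\<^esub>}"

text \<open>Exactness of \<open>A \<otimes>\<^sub>B M \<rightarrow> A \<otimes>\<^sub>B N \<rightarrow> A \<otimes>\<^sub>B P\<close>, where \<open>A \<otimes>\<^sub>B M\<close> is the free abelian group on
  \<open>A \<times> M\<close> modulo \<open>tensor_relations ract M\<close>.\<close>

definition tensor_relations ::
  "('a::ring_1 \<Rightarrow> 'b \<Rightarrow> 'a) \<Rightarrow> ('b, 'u) module \<Rightarrow> ('a \<times> 'u \<Rightarrow>\<^sub>0 int) set" where
  "tensor_relations ract M =
     tensor_rel UNIV (+) (carrier M) (\<lambda>x y. x \<oplus>\<^bsub>M\<^esub> y) ract (\<lambda>b x. b \<odot>\<^bsub>M\<^esub> x)"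

definition frag_map :: "('u \<Rightarrow> 'v) \<Rightarrow> ('a \<times> 'u \<Rightarrow>\<^sub>0 int) \<Rightarrow> ('a \<times> 'v \<Rightarrow>\<^sub>0 int)" where
  "frag_map f = frag_extend (\<lambda>p. frag_of (fst p, f (snd p)))"

definition tensored_exact :: "('a::ring_1 \<Rightarrow> 'b \<Rightarrow> 'a)
    \<Rightarrow> ('b, 'u) module \<Rightarrow> ('b, 'u) module \<Rightarrow> ('b, 'u) module \<Rightarrow> ('u \<Rightarrow> 'u) \<Rightarrow> ('u \<Rightarrow> 'u) \<Rightarrow> bool" where
  "tensored_exact ract M N P f g \<longleftrightarrow>
     (\<forall>z. Poly_Mapping.keys z \<subseteq> UNIV \<times> carrier N \<longrightarrow>
       (frag_map g z \<in> tensor_relations ract P \<longleftrightarrow>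
        (\<exists>y. Poly_Mapping.keys y \<subseteq> UNIV \<times> carrier M \<and> z - frag_map f y \<in> tensor_relations ract N)))"

text \<open>\<open>A\<close> is faithfully flat as a right \<open>B\<close>-module iff tensoring with it preserves and reflects
  exactness of sequences of left \<open>B\<close>-modules.  A definition in HOL has to bound the universe of
  test modules; carriers range over sets of elements of type \<open>'b set\<close>, which contains copies of
  \<open>B\<close>, of its left ideals and (as cosets) of all cyclic modules \<open>B/I\<close>.  By the ideal criterion
  for flatness, these suffice to test faithful flatness against modules of arbitrary size.\<close>

definition faithfully_flat :: "('a::ring_1 \<Rightarrow> 'b::ring_1 \<Rightarrow> 'a) \<Rightarrow> bool" where
  "faithfully_flat ract \<longleftrightarrow>
     (\<forall>(M :: ('b, 'b set) module) N P f g.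
       left_module M \<and> left_module N \<and> left_module P
       \<and> left_module_map M N f \<and> left_module_map N P g \<longrightarrow>
       (module_exact M N P f g \<longleftrightarrow> tensored_exact ract M N P f g))"


section \<open>Homogeneous spaces and relative Hopf modules\<close>

text \<open>The subalgebra \<open>B \<subseteq> A\<close> is a type \<open>'b\<close> with its inclusion \<open>incl\<close>; \<open>bcoact\<close> is the
  corestriction \<open>B \<rightarrow> A \<otimes> B\<close> of the coproduct, and \<open>qproj\<close> presents \<open>\<pi>\<^sub>B(A) = A/B\<^sup>+A\<close>.\<close>

record (overloaded) ('a::complex_algebra_1, 'q::complex_algebra_1, 'b::complex_algebra_1) hom_space =
  total :: "'a cqg_data"
  quot :: "'q cqg_data"
  qproj :: "'a \<Rightarrow> 'q"
  incl :: "'b \<Rightarrow> 'a"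
  bstar :: "'b \<Rightarrow> 'b"
  bcoact :: "'b \<Rightarrow> ('a, 'b) ctensor"

definition bplus ::
  "('a::complex_algebra_1, 'q::complex_algebra_1, 'b::complex_algebra_1) hom_space \<Rightarrow> 'b set" where
  "bplus X = {b. counit (total X) (incl X b) = 0}"

locale cqga_homogeneous_space =
  A: cqga "total X" + Q: cqga "quot X"
  for X :: "('a::complex_algebra_1, 'q::complex_algebra_1, 'b::complex_algebra_1) hom_space" +
  assumes incl_alg_hom: "alg_hom (incl X)"
    and incl_inj: "inj (incl X)"
    and left_coideal: "ctmap id (incl X) (bcoact X b) = comult (total X) (incl X b)"
    and incl_star: "incl X (bstar X b) = hstar (total X) (incl X b)"
    and flat: "faithfully_flat (\<lambda>a b. a * incl X b)"
    and bplus_commute: "add_span {incl X b * a | a b. b \<in> bplus X}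
                      = add_span {a * incl X b | a b. b \<in> bplus X}"
    and qproj_alg_hom: "alg_hom (qproj X)"
    and qproj_surj: "surj (qproj X)"
    and qproj_kernel: "{a. qproj X a = 0} = add_span {incl X b * a | a b. b \<in> bplus X}"
    and qproj_comult: "comult (quot X) (qproj X a) = ctmap (qproj X) (qproj X) (comult (total X) a)"
    and qproj_counit: "counit (quot X) (qproj X a) = counit (total X) a"
    and qproj_star: "qproj X (hstar (total X) a) = hstar (quot X) (qproj X a)"

definition bpos :: "('b::complex_algebra_1 \<Rightarrow> 'b) \<Rightarrow> 'b set" where
  "bpos s = {b. b \<noteq> 0 \<and> (\<exists>cs. b = (\<Sum>c\<leftarrow>cs. s c * c))}"

definition bimodule :: "('b::complex_algebra_1 \<Rightarrow> 'f::complex_vector \<Rightarrow> 'f) \<Rightarrow> ('f \<Rightarrow> 'b \<Rightarrow> 'f) \<Rightarrow> bool" where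
  "bimodule lact ract \<longleftrightarrow> biadditive lact \<and> biadditive ract
     \<and> (\<forall>b c f. lact (b * c) f = lact b (lact c f))
     \<and> (\<forall>b c f. ract f (b * c) = ract (ract f b) c)
     \<and> (\<forall>b c f. lact b (ract f c) = ract (lact b f) c)
     \<and> (\<forall>k f. lact (scaleC k 1) f = scaleC k f \<and> ract f (scaleC k 1) = scaleC k f)"

text \<open>Objects of \<open>\<^sup>A\<^sub>Bmod\<^sub>0\<close>.  The right action is the one for which
  \<open>F \<rightarrow> A \<otimes> F/B\<^sup>+F\<close>, \<open>f \<mapsto> f\<^sub>(\<^sub>-\<^sub>1\<^sub>) \<otimes> [f\<^sub>(\<^sub>0\<^sub>)]\<close>, is right \<open>B\<close>-linear; an equation in
  \<open>A \<otimes> F/B\<^sup>+F\<close> is an equation in \<open>A \<otimes> F\<close> modulo \<open>A \<otimes> B\<^sup>+F\<close>.\<close>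

locale mod0_object = cqga_homogeneous_space X
  for X :: "('a::complex_algebra_1, 'q::complex_algebra_1, 'b::complex_algebra_1) hom_space" +
  fixes lact :: "'b \<Rightarrow> 'f::complex_vector \<Rightarrow> 'f" and ract :: "'f \<Rightarrow> 'b \<Rightarrow> 'f"
    and coact :: "'f \<Rightarrow> ('a, 'f) ctensor"
  assumes bimodule: "bimodule lact ract"
    and coact_linear: "clinear coact"
    and coact_coassoc: "ctassoc (ctmap (comult (total X)) id (coact f)) = ctmap id coact (coact f)"
    and coact_counit: "tlift ctens (\<lambda>a f. scaleC (counit (total X) a) f) (coact f) = f"
    and coact_lact: "coact (lact b f) = ctzip (*) lact (bcoact X b) (coact f)"
    and finitely_generated: "\<exists>G. finite G \<and> (\<forall>f. \<exists>c. f = (\<Sum>e\<in>G. lact (c e) e))"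
    and ract_coact:
      "coact (ract f b) - ctmap (\<lambda>a. a * incl X b) id (coact f)
         \<in> ctsub UNIV (add_span {lact c e | c e. c \<in> bplus X})"


section \<open>CQH-Hermitian spaces\<close>

text \<open>The type \<open>'w\<close> is the total algebra \<open>\<Omega>\<^sup>\<bullet>\<close> with product \<open>\<and>\<close>, and \<open>emb\<close> identifies \<open>B\<close> with
  \<open>\<Omega>\<^sup>0\<close>.\<close>

record (overloaded) ('a::complex_algebra_1, 'b::complex_algebra_1, 'w::complex_algebra_1) calculus =
  grade :: "nat \<Rightarrow> 'w set"
  emb :: "'b \<Rightarrow> 'w"
  dform :: "'w \<Rightarrow> 'w"
  wstar :: "'w \<Rightarrow> 'w"
  wcoact :: "'w \<Rightarrow> ('a, 'w) ctensor"
  bigrade :: "nat \<times> nat \<Rightarrow> 'w set"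
  del :: "'w \<Rightarrow> 'w"
  delbar :: "'w \<Rightarrow> 'w"
  kform :: 'w
  cdim :: nat
  hodge :: "'w \<Rightarrow> 'w"

locale star_calculus =
  fixes bst :: "'b::complex_algebra_1 \<Rightarrow> 'b"
    and C :: "('a::complex_algebra_1, 'b, 'w::complex_algebra_1) calculus"
  assumes grading: "direct_sum (grade C) UNIV"
    and grade_mult: "x \<in> grade C k \<Longrightarrow> y \<in> grade C l \<Longrightarrow> x * y \<in> grade C (k + l)"
    and emb_alg_hom: "alg_hom (emb C)"
    and emb_inj: "inj (emb C)"
    and emb_range: "range (emb C) = grade C 0"
    and d_linear: "clinear (dform C)"
    and d_grade: "x \<in> grade C k \<Longrightarrow> dform C x \<in> grade C (Suc k)"
    and d_square: "dform C (dform C x) = 0"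
    and d_leibniz: "x \<in> grade C k \<Longrightarrow> dform C (x * y) = dform C x * y + (- 1) ^ k * (x * dform C y)"
    and generated: "subalgebra hull (range (emb C) \<union> range (\<lambda>b. dform C (emb C b))) = UNIV"
    and wstar_conj_linear: "conj_linear (wstar C)"
    and wstar_involution: "wstar C (wstar C x) = x"
    and wstar_emb: "wstar C (emb C b) = emb C (bst b)"
    and wstar_d: "dform C (wstar C x) = wstar C (dform C x)"
    and wstar_mult: "x \<in> grade C k \<Longrightarrow> y \<in> grade C l \<Longrightarrow>
                       wstar C (x * y) = (- 1) ^ (k * l) * (wstar C y * wstar C x)"

locale complex_structure = star_calculus +
  assumes bigrading:
      "direct_sum (\<lambda>(a, b). if a + b = k then bigrade C (a, b) else {0}) (grade C k)"
    and bigrade_mult: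
      "x \<in> bigrade C (a, b) \<Longrightarrow> y \<in> bigrade C (a', b') \<Longrightarrow> x * y \<in> bigrade C (a + a', b + b')"
    and bigrade_star: "wstar C ` bigrade C (a, b) = bigrade C (b, a)"
    and del_linear: "clinear (del C)"
    and delbar_linear: "clinear (delbar C)"
    and d_split: "dform C x = del C x + delbar C x"
    and del_degree: "x \<in> bigrade C (a, b) \<Longrightarrow> del C x \<in> bigrade C (Suc a, b)"
    and delbar_degree: "x \<in> bigrade C (a, b) \<Longrightarrow> delbar C x \<in> bigrade C (a, Suc b)"

definition primitive ::
  "('a::complex_algebra_1, 'b::complex_algebra_1, 'w::complex_algebra_1) calculus \<Rightarrow> nat \<Rightarrow> 'w set" where
  "primitive C k = (if k \<le> cdim C then {\<alpha> \<in> grade C k. kform C ^ (cdim C - k + 1) * \<alpha> = 0} else {0})"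

locale hermitian_structure = complex_structure +
  assumes total_degree: "grade C (2 * cdim C) \<noteq> {0}" "k > 2 * cdim C \<Longrightarrow> grade C k = {0}"
    and kform_degree: "kform C \<in> bigrade C (1, 1)"
    and kform_central: "kform C * x = x * kform C"
    and kform_real: "wstar C (kform C) = kform C"
    and lefschetz: "k < cdim C \<Longrightarrow>
      bij_betw (\<lambda>x. kform C ^ (cdim C - k) * x) (grade C k) (grade C (2 * cdim C - k))"
    and hodge_linear: "clinear (hodge C)"
    and hodge_formula:
      "\<alpha> \<in> primitive C (a + b) \<Longrightarrow> \<alpha> \<in> bigrade C (a, b) \<Longrightarrow> a + b + j \<le> cdim C \<Longrightarrow>
       hodge C (kform C ^ j * \<alpha>) =
         scaleC ((- 1) ^ ((a + b) * (a + b + 1) div 2) * \<i> powi (int a - int b)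
                 * (fact j / fact (cdim C - j - (a + b))))
           (kform C ^ (cdim C - j - (a + b)) * \<alpha>)"

definition metric ::
  "('a::complex_algebra_1, 'b::complex_algebra_1, 'w::complex_algebra_1) calculus \<Rightarrow> 'w \<Rightarrow> 'w \<Rightarrow> 'b" where
  "metric C \<omega> \<nu> = the_inv (emb C)
     (\<Sum>k\<le>2 * cdim C. hodge C (hodge C (wstar C (component (grade C) \<omega> k)) * component (grade C) \<nu> k))"

definition integral_form ::
  "('a::complex_algebra_1, 'q::complex_algebra_1, 'b::complex_algebra_1) hom_space
    \<Rightarrow> ('a, 'b, 'w::complex_algebra_1) calculus \<Rightarrow> 'w \<Rightarrow> complex" where
  "integral_form X C \<omega> = haar (total X) (incl X (the_inv (emb C) (hodge C \<omega>)))"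

locale cqh_hermitian_space =
  cqga_homogeneous_space X + hermitian_structure "bstar X" C
    + Om: mod0_object X "\<lambda>b \<omega>. emb C b * \<omega>" "\<lambda>\<omega> b. \<omega> * emb C b" "wcoact C"
  for X :: "('a::complex_algebra_1, 'q::complex_algebra_1, 'b::complex_algebra_1) hom_space"
    and C :: "('a, 'b, 'w::complex_algebra_1) calculus" +
  assumes wcoact_emb: "wcoact C (emb C b) = ctmap id (emb C) (bcoact X b)"
    and d_comodule_map: "wcoact C (dform C \<omega>) = ctmap id (dform C) (wcoact C \<omega>)"
    and bigrade_covariant: "\<omega> \<in> bigrade C p \<Longrightarrow> wcoact C \<omega> \<in> ctsub UNIV (bigrade C p)"
    and kform_coinvariant: "wcoact C (kform C) = ctens 1 (kform C)"
    and positive_definite: "\<omega> \<noteq> 0 \<Longrightarrow> metric C \<omega> \<omega> \<in> bpos (bstar X)"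
    and integral_closed: "Suc k = 2 * cdim C \<Longrightarrow> \<omega> \<in> grade C k \<Longrightarrow> integral_form X C (dform C \<omega>) = 0"


section \<open>Hermitian modules\<close>

text \<open>\<open>\<F>\<^sup>\<or>\<close> consists of right module maps, with \<open>(b\<phi>)(k) = b\<phi>(k)\<close> and \<open>(\<phi>b)(k) = \<phi>(bk)\<close>.  The
  conjugate bimodule is carried by \<open>'f\<close> itself, an element \<open>f\<close> standing for its conjugate, so
  that a map on it is written \<open>h f k\<close> for \<open>h'(f, k)\<close>.\<close>

definition right_dual :: "('f::complex_vector \<Rightarrow> 'b \<Rightarrow> 'f) \<Rightarrow> ('f \<Rightarrow> 'b::complex_algebra_1) set" where
  "right_dual ract = {\<phi>. (\<forall>x y. \<phi> (x + y) = \<phi> x + \<phi> y) \<and> (\<forall>x b. \<phi> (ract x b) = \<phi> x * b)}"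

definition conj_lact :: "('b \<Rightarrow> 'b) \<Rightarrow> ('f \<Rightarrow> 'b \<Rightarrow> 'f) \<Rightarrow> 'b \<Rightarrow> 'f \<Rightarrow> 'f" where
  "conj_lact s ract b f = ract f (s b)"

definition conj_ract :: "('b \<Rightarrow> 'b) \<Rightarrow> ('b \<Rightarrow> 'f \<Rightarrow> 'f) \<Rightarrow> 'f \<Rightarrow> 'b \<Rightarrow> 'f" where
  "conj_ract s lact f b = lact (s b) f"

definition weak_hermitian :: "('b::complex_algebra_1 \<Rightarrow> 'b) \<Rightarrow> ('b \<Rightarrow> 'f::complex_vector \<Rightarrow> 'f)
    \<Rightarrow> ('f \<Rightarrow> 'b \<Rightarrow> 'f) \<Rightarrow> ('f \<Rightarrow> 'f \<Rightarrow> 'b) \<Rightarrow> bool" where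
  "weak_hermitian s lact ract h \<longleftrightarrow>
     bij_betw h UNIV (right_dual ract)
     \<and> (\<forall>f g k. h (f + g) k = h f k + h g k)
     \<and> (\<forall>b f k. h (conj_lact s ract b f) k = b * h f k)
     \<and> (\<forall>b f k. h (conj_ract s lact f b) k = h f (lact b k))
     \<and> (\<forall>f k. h f k = s (h k f))
     \<and> (\<forall>f. f \<noteq> 0 \<longrightarrow> h f f \<in> bpos s)"

text \<open>A direct summand of the free left module \<open>B\<^sup>m\<close>: the maps \<open>c \<mapsto> \<Sum>\<^sub>i c\<^sub>i e\<^sub>i\<close> and
  \<open>f \<mapsto> (\<phi>\<^sub>i f)\<^sub>i\<close> exhibit the retraction and its section.\<close>

definition fg_projective :: "('b::complex_algebra_1 \<Rightarrow> 'f::complex_vector \<Rightarrow> 'f) \<Rightarrow> bool" where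
  "fg_projective lact \<longleftrightarrow>
     (\<exists>m e \<phi>. (\<forall>i<m. (\<forall>x y. \<phi> i (x + y) = \<phi> i x + \<phi> i y) \<and> (\<forall>b x. \<phi> i (lact b x) = b * \<phi> i x))
       \<and> (\<forall>f. f = (\<Sum>i<(m::nat). lact (\<phi> i f) (e i))))"

text \<open>The type \<open>'t\<close> with \<open>tens\<close> is \<open>\<Omega>\<^sup>\<bullet> \<otimes>\<^sub>B \<F>\<close>; \<open>herm f k\<close> is \<open>h'\<^sub>\<F>(f, k)\<close> and \<open>dbarF\<close> the
  holomorphic structure on \<open>\<F>\<close>.\<close>

record (overloaded) ('a::complex_algebra_1, 'b::complex_algebra_1, 'w::complex_algebra_1,
        'f::complex_vector, 't::complex_vector) hmod =
  lact :: "'b \<Rightarrow> 'f \<Rightarrow> 'f"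
  ract :: "'f \<Rightarrow> 'b \<Rightarrow> 'f"
  fcoact :: "'f \<Rightarrow> ('a, 'f) ctensor"
  herm :: "'f \<Rightarrow> 'f \<Rightarrow> 'b"
  tens :: "'w \<Rightarrow> 'f \<Rightarrow> 't"
  dbarF :: "'f \<Rightarrow> 't"

definition wedge :: "('a::complex_algebra_1, 'b::complex_algebra_1, 'w::complex_algebra_1,
    'f::complex_vector, 't::complex_vector) hmod \<Rightarrow> 'w \<Rightarrow> 't \<Rightarrow> 't" where
  "wedge M \<omega> = tlift (tens M) (\<lambda>\<nu> f. tens M (\<omega> * \<nu>) f)"

definition lmul :: "('a::complex_algebra_1, 'b::complex_algebra_1, 'w::complex_algebra_1) calculus
    \<Rightarrow> ('a, 'b, 'w, 'f::complex_vector, 't::complex_vector) hmod \<Rightarrow> 'b \<Rightarrow> 't \<Rightarrow> 't" where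
  "lmul C M b = wedge M (emb C b)"

definition rmul :: "('a::complex_algebra_1, 'b::complex_algebra_1, 'w::complex_algebra_1,
    'f::complex_vector, 't::complex_vector) hmod \<Rightarrow> 't \<Rightarrow> 'b \<Rightarrow> 't" where
  "rmul M x b = tlift (tens M) (\<lambda>\<nu> f. tens M \<nu> (ract M f b)) x"

definition metricF :: "('a::complex_algebra_1, 'b::complex_algebra_1, 'w::complex_algebra_1) calculus
    \<Rightarrow> ('a, 'b, 'w, 'f::complex_vector, 't::complex_vector) hmod \<Rightarrow> 't \<Rightarrow> 't \<Rightarrow> 'b" where
  "metricF C M x y = tlift (tens M)
     (\<lambda>\<omega> f. tlift (tens M) (\<lambda>\<nu> k. herm M f (lact M (metric C \<omega> \<nu>) k)) y) x"

definition tcoact :: "('a::complex_algebra_1, 'b::complex_algebra_1, 'w::complex_algebra_1) calculus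
    \<Rightarrow> ('a, 'b, 'w, 'f::complex_vector, 't::complex_vector) hmod \<Rightarrow> 't \<Rightarrow> ('a, 't) ctensor" where
  "tcoact C M = tlift (tens M) (\<lambda>\<omega> f. ctzip (*) (tens M) (wcoact C \<omega>) (fcoact M f))"

definition form_tens :: "('a::complex_algebra_1, 'b::complex_algebra_1, 'w::complex_algebra_1,
    'f::complex_vector, 't::complex_vector) hmod \<Rightarrow> 'w set \<Rightarrow> 't set" where
  "form_tens M U = add_span {tens M \<omega> f | \<omega> f. \<omega> \<in> U}"

definition degree_sign ::
  "('a::complex_algebra_1, 'b::complex_algebra_1, 'w::complex_algebra_1) calculus \<Rightarrow> 'w \<Rightarrow> 'w" where
  "degree_sign C \<omega> = (\<Sum>k\<le>2 * cdim C. (- 1) ^ k * component (grade C) \<omega> k)"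

text \<open>A connection \<open>nab\<close> for the differential \<open>D\<close> (one of \<open>d\<close>, \<open>\<partial>\<close>, \<open>\<partial>-bar\<close>) with values in
  \<open>U \<otimes>\<^sub>B \<F>\<close>, and its extension \<open>\<omega> \<otimes> f \<mapsto> D\<omega> \<otimes> f + (-1)\<^sup>|\<^sup>\<omega>\<^sup>| \<omega> \<and> nab f\<close>.\<close>

definition connection :: "('a::complex_algebra_1, 'b::complex_algebra_1, 'w::complex_algebra_1) calculus
    \<Rightarrow> ('a, 'b, 'w, 'f::complex_vector, 't::complex_vector) hmod
    \<Rightarrow> ('w \<Rightarrow> 'w) \<Rightarrow> 'w set \<Rightarrow> ('f \<Rightarrow> 't) \<Rightarrow> bool" where
  "connection C M D U nab \<longleftrightarrow> clinear nab \<and> range nab \<subseteq> form_tens M U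
     \<and> (\<forall>b f. nab (lact M b f) = tens M (D (emb C b)) f + lmul C M b (nab f))"

definition conn_ext :: "('a::complex_algebra_1, 'b::complex_algebra_1, 'w::complex_algebra_1) calculus
    \<Rightarrow> ('a, 'b, 'w, 'f::complex_vector, 't::complex_vector) hmod
    \<Rightarrow> ('w \<Rightarrow> 'w) \<Rightarrow> ('f \<Rightarrow> 't) \<Rightarrow> 't \<Rightarrow> 't" where
  "conn_ext C M D nab = tlift (tens M) (\<lambda>\<omega> f. tens M (D \<omega>) f + wedge M (degree_sign C \<omega>) (nab f))"

text \<open>\<open>\<F>\<^sup>\<or>\<close> carries the coaction for which evaluation \<open>\<F>\<^sup>\<or> \<otimes>\<^sub>B \<F> \<rightarrow> B\<close> is a comodule map, and the
  conjugate of \<open>\<F>\<close> the coaction sending the conjugate of \<open>f\<close> to \<open>f\<^sub>(\<^sub>-\<^sub>1\<^sub>)\<^sup>*\<close> tensor the conjugate of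
  \<open>f\<^sub>(\<^sub>0\<^sub>)\<close>.  Thus \<open>herm_covariant\<close> below says that \<open>h\<^sub>\<F>\<close> is a comodule map.\<close>

locale covariant_hermitian_holomorphic_module =
  cqh_hermitian_space X C + F: mod0_object X "lact M" "ract M" "fcoact M"
  for X :: "('a::complex_algebra_1, 'q::complex_algebra_1, 'b::complex_algebra_1) hom_space"
    and C :: "('a, 'b, 'w::complex_algebra_1) calculus"
    and M :: "('a, 'b, 'w, 'f::complex_vector, 't::complex_vector) hmod" +
  assumes tens: "is_tensor_product (\<lambda>\<omega> b. \<omega> * emb C b) (lact M) (tens M)"
    and weak_hermitian: "weak_hermitian (bstar X) (lact M) (ract M) (herm M)"
    and hermitian: "weak_hermitian (bstar X) (lmul C M) (rmul M) (metricF C M)"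
    and herm_covariant: "bcoact X (herm M f k) =
          ctzip (\<lambda>a c. hstar (total X) a * c) (herm M) (fcoact M f) (fcoact M k)"
    and fg_projective: "fg_projective (lact M)"
    and dbarF_connection: "connection C M (delbar C) (bigrade C (0, 1)) (dbarF M)"
    and dbarF_flat: "conn_ext C M (delbar C) (dbarF M) (dbarF M f) = 0"
    and dbarF_covariant: "tcoact C M (dbarF M f) = ctmap id (dbarF M) (fcoact M f)"

definition module_inner ::
  "('a::complex_algebra_1, 'q::complex_algebra_1, 'b::complex_algebra_1) hom_space
    \<Rightarrow> ('a, 'b, 'w::complex_algebra_1) calculus
    \<Rightarrow> ('a, 'b, 'w, 'f::complex_vector, 't::complex_vector) hmod \<Rightarrow> 't \<Rightarrow> 't \<Rightarrow> complex" where
  "module_inner X C M x y = haar (total X) (incl X (metricF C M x y))"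


section \<open>Chern connections\<close>

text \<open>Beggs and Majid's compatibility condition needs a metric with \<open>\<langle>bf, ck\<rangle> = b\<langle>f, k\<rangle>c\<^sup>*\<close>, whereas
  \<open>h'\<^sub>\<F>\<close> satisfies \<open>h'(fb, kc) = b\<^sup>*h'(f, k)c\<close> and \<open>h'(bf, k) = h'(f, b\<^sup>*k)\<close>; over a noncommutative \<open>B\<close>
  neither form is obtained from the other by swapping arguments.  Chern connections are therefore
  taken relative to any covariant Hermitian form of the former kind that identifies the conjugate
  of \<open>\<F>\<close> with the left module maps \<open>\<F> \<rightarrow> B\<close>.\<close>

definition left_metric ::
  "('a::complex_algebra_1, 'q::complex_algebra_1, 'b::complex_algebra_1) hom_space
    \<Rightarrow> ('a, 'b, 'w::complex_algebra_1, 'f::complex_vector, 't::complex_vector) hmod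
    \<Rightarrow> ('f \<Rightarrow> 'f \<Rightarrow> 'b) \<Rightarrow> bool" where
  "left_metric X M ang \<longleftrightarrow> biadditive ang
     \<and> (\<forall>b c f k. ang (lact M b f) (lact M c k) = b * ang f k * bstar X c)
     \<and> (\<forall>f k. ang f k = bstar X (ang k f))
     \<and> bij_betw (\<lambda>k f. ang f k) UNIV
         {\<phi>. (\<forall>x y. \<phi> (x + y) = \<phi> x + \<phi> y) \<and> (\<forall>b x. \<phi> (lact M b x) = b * \<phi> x)}
     \<and> (\<forall>f k. bcoact X (ang f k) =
          ctzip (\<lambda>a c. a * hstar (total X) c) ang (fcoact M f) (fcoact M k))"

text \<open>\<open>form_part C M p\<close> is the projection of \<open>\<Omega>\<^sup>\<bullet> \<otimes>\<^sub>B \<F>\<close> onto \<open>\<Omega>\<^sup>p \<otimes>\<^sub>B \<F>\<close> for a bidegree \<open>p\<close>.\<close>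

definition form_part :: "('a::complex_algebra_1, 'b::complex_algebra_1, 'w::complex_algebra_1) calculus
    \<Rightarrow> ('a, 'b, 'w, 'f::complex_vector, 't::complex_vector) hmod \<Rightarrow> nat \<times> nat \<Rightarrow> 't \<Rightarrow> 't" where
  "form_part C M p = tlift (tens M) (\<lambda>\<omega> f. tens M (component (bigrade C) \<omega> p) f)"

definition chern_connection ::
  "('a::complex_algebra_1, 'q::complex_algebra_1, 'b::complex_algebra_1) hom_space
    \<Rightarrow> ('a, 'b, 'w::complex_algebra_1) calculus
    \<Rightarrow> ('a, 'b, 'w, 'f::complex_vector, 't::complex_vector) hmod
    \<Rightarrow> ('f \<Rightarrow> 'f \<Rightarrow> 'b) \<Rightarrow> ('f \<Rightarrow> 't) \<Rightarrow> bool" where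
  "chern_connection X C M ang nab \<longleftrightarrow>
     connection C M (dform C) (grade C 1) nab
     \<and> (\<forall>f. form_part C M (0, 1) (nab f) = dbarF M f)
     \<and> (\<forall>f k. dform C (emb C (ang f k)) =
          tlift (tens M) (\<lambda>\<omega> e. \<omega> * emb C (ang e k)) (nab f)
          + tlift (tens M) (\<lambda>\<omega> e. emb C (ang f e) * wstar C \<omega>) (nab k))"

definition nabla_op :: "('a::complex_algebra_1, 'b::complex_algebra_1, 'w::complex_algebra_1) calculus
    \<Rightarrow> ('a, 'b, 'w, 'f::complex_vector, 't::complex_vector) hmod \<Rightarrow> ('f \<Rightarrow> 't) \<Rightarrow> 't \<Rightarrow> 't" where
  "nabla_op C M nab = conn_ext C M (dform C) nab"

definition delF_op :: "('a::complex_algebra_1, 'b::complex_algebra_1, 'w::complex_algebra_1) calculus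
    \<Rightarrow> ('a, 'b, 'w, 'f::complex_vector, 't::complex_vector) hmod \<Rightarrow> ('f \<Rightarrow> 't) \<Rightarrow> 't \<Rightarrow> 't" where
  "delF_op C M nab = conn_ext C M (del C) (\<lambda>f. form_part C M (1, 0) (nab f))"

definition delbarF_op :: "('a::complex_algebra_1, 'b::complex_algebra_1, 'w::complex_algebra_1) calculus
    \<Rightarrow> ('a, 'b, 'w, 'f::complex_vector, 't::complex_vector) hmod \<Rightarrow> 't \<Rightarrow> 't" where
  "delbarF_op C M = conn_ext C M (delbar C) (dbarF M)"


section \<open>Operators on pre-Hilbert spaces\<close>

definition is_adjoint :: "('t \<Rightarrow> 't \<Rightarrow> complex) \<Rightarrow> ('t \<Rightarrow> 't) \<Rightarrow> ('t \<Rightarrow> 't) \<Rightarrow> bool" where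
  "is_adjoint ip T S \<longleftrightarrow> (\<forall>x y. ip (S x) y = ip x (T y))"

definition commutator :: "('t \<Rightarrow> 't) \<Rightarrow> ('t \<Rightarrow> 't) \<Rightarrow> 't \<Rightarrow> 't::ab_group_add" where
  "commutator S T x = S (T x) - T (S x)"

definition bounded_wrt :: "('t \<Rightarrow> 't \<Rightarrow> complex) \<Rightarrow> ('t \<Rightarrow> 't) \<Rightarrow> bool" where
  "bounded_wrt ip T \<longleftrightarrow> (\<exists>K. \<forall>x. sqrt (Re (ip (T x) (T x))) \<le> K * sqrt (Re (ip x x)))"

definition is_completion ::
  "('t::complex_vector \<Rightarrow> 't \<Rightarrow> complex) \<Rightarrow> ('t \<Rightarrow> 'l::chilbert_space) \<Rightarrow> bool" where
  "is_completion ip j \<longleftrightarrow> clinear j \<and> (\<forall>x y. cinner (j x) (j y) = ip x y) \<and> closure (range j) = UNIV"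

definition bounded_clinear :: "('l::chilbert_space \<Rightarrow> 'l) \<Rightarrow> bool" where
  "bounded_clinear T \<longleftrightarrow> clinear T \<and> bounded_linear T"

definition bounded_and_extends ::
  "('t::complex_vector \<Rightarrow> 't \<Rightarrow> complex) \<Rightarrow> ('t \<Rightarrow> 'l::chilbert_space) \<Rightarrow> ('t \<Rightarrow> 't) \<Rightarrow> bool" where
  "bounded_and_extends ip j T \<longleftrightarrow>
     bounded_wrt ip T \<and> (\<exists>!T'. bounded_clinear T' \<and> (\<forall>x. T' (j x) = j (T x)))"

end

theory Submission
  imports Defs
begin

text \<open>A commutator with \<open>b\<close> removes all differentiation: by the Leibniz rule \<open>[\<nabla>, \<lambda>(b)]\<close> is exterior
  multiplication by the form \<open>db\<close>, and \<open>[\<partial>\<^sub>\<F>, \<lambda>(b)]\<close> and its conjugate are multiplication by the two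
  bidegree components of \<open>db\<close> (\<open>conn_ext_commutator\<close>).  Since \<open>\<lambda>(b\<^sup>*)\<close> is adjoint to \<open>\<lambda>(b)\<close>, the commutators
  of the adjoint operators are, up to sign, adjoint to commutators of the first kind, and an everywhere defined
  adjoint of a bounded operator is bounded (\<open>commutator_adjoint_bounded\<close>).  So the content is that
  \<open>\<theta> \<and> -\<close> is bounded on \<open>\<Omega>\<^sup>\<bullet> \<otimes>\<^sub>B \<F>\<close> for every form \<open>\<theta>\<close> (\<open>module_inner_wedge_bounded\<close>).

  The idea is to find coordinates with values in \<open>A\<close> in which all metrics are standard and forms act by
  matrices over \<open>A\<close>.  Let \<open>\<beta> = \<epsilon> \<circ> g\<close> be the scalar form on \<open>\<Omega>\<^sup>\<bullet>\<close> obtained from the metric and the counit.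
  Covariance of \<open>g\<close> (\<open>metric_covariant\<close>) says that \<open>g(\<omega>, \<nu>) = \<omega>\<^sub>(\<^sub>-\<^sub>1\<^sub>)\<^sup>* \<nu>\<^sub>(\<^sub>-\<^sub>1\<^sub>) \<beta>(\<omega>\<^sub>(\<^sub>0\<^sub>), \<nu>\<^sub>(\<^sub>0\<^sub>))\<close>.  The
  form \<open>\<beta>\<close> lives on the finite-dimensional fibre \<open>\<Omega>\<^sup>\<bullet>/B\<^sup>+\<Omega>\<^sup>\<bullet>\<close>; with a \<open>\<beta>\<close>-orthonormal basis \<open>e\<^sub>i\<close> of it and
  \<open>J\<^sub>i(\<omega>) = \<omega>\<^sub>(\<^sub>-\<^sub>1\<^sub>) \<beta>(e\<^sub>i, \<omega>\<^sub>(\<^sub>0\<^sub>)) \<in> A\<close> the metric becomes \<open>\<Sum>\<^sub>i J\<^sub>i(\<omega>)\<^sup>* J\<^sub>i(\<nu>)\<close>.  The same works for the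
  Hermitian form of \<open>\<F>\<close>, products of the two kinds of coordinates are coordinates on the tensor product
  (\<open>metricF_coords\<close>), and \<open>\<theta> \<and> -\<close> becomes multiplication by the matrix
  \<open>\<theta>\<^sub>(\<^sub>-\<^sub>1\<^sub>) \<beta>(e\<^sub>i, \<theta>\<^sub>(\<^sub>0\<^sub>) \<and> e\<^sub>l)\<close> (\<open>wcoord_mult\<close>).  Left multiplication by an element of \<open>A\<close> is bounded for the Haar
  state because \<open>A\<close> is spanned by coefficients of unitary matrices (\<open>left_mult_bounded\<close>).

  Two points need work.  The first is the covariance of the metric.  The coaction is multiplicative and
  compatible with \<open>*\<close> because \<open>\<Omega>\<^sup>\<bullet>\<close> is generated by \<open>b\<close> and \<open>db\<close>; the Hodge map is covariant by the Lefschetz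
  decomposition, because \<open>\<sigma>\<close> is coinvariant.  The second is that \<open>\<epsilon> \<circ> h\<^sub>\<F>\<close>, which by right linearity
  vanishes on \<open>\<F>B\<^sup>+\<close>, also vanishes on \<open>B\<^sup>+\<F>\<close>; without this there is no finite-dimensional fibre, since only
  the left module \<open>\<F>\<close> is known to be finitely generated.  One has
  \<open>c f = f\<^sub>(\<^sub>0\<^sub>) \<cdot> S\<^sup>-\<^sup>1(f\<^sub>(\<^sub>-\<^sub>1\<^sub>)) c f\<^sub>(\<^sub>-\<^sub>2\<^sub>)\<close>, where the scalars lie in \<open>B\<close> (\<open>adjoint_action_coideal\<close>,
  \<open>left_bplus_in_right_bplus\<close>).  Membership in \<open>B\<close> is detected by the Haar-orthogonal projection \<open>A \<rightarrow> B\<close>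
  (\<open>haar_decomposition\<close>, \<open>projection_counit\<close>), and the identity is tested in \<open>A \<otimes> \<F>/B\<^sup>+\<F>\<close>, into which \<open>\<F>\<close>
  embeds because the left metric is nondegenerate.\<close>

section \<open>Complex vector spaces and positive semidefinite forms\<close>

lemma clinear_iff:
  "clinear f \<longleftrightarrow> (\<forall>x y. f (x + y) = f x + f y) \<and> (\<forall>c x. f (scaleC c x) = scaleC c (f x))"
  unfolding Vector_Spaces.linear_iff by (auto intro: complex_vector.vector_space_axioms)

lemma clinear_add: "clinear f \<Longrightarrow> f (x + y) = f x + f y"
  and clinear_scaleC: "clinear f \<Longrightarrow> f (scaleC c x) = scaleC c (f x)"
  by (auto simp: clinear_iff)

lemma clinear_0: "clinear f \<Longrightarrow> f 0 = 0"
  using clinear_add[of f 0 0] by simp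

lemma clinear_diff: "clinear f \<Longrightarrow> f (x - y) = f x - f y"
  using clinear_add[of f "x - y" y] by (simp add: algebra_simps)

lemma clinear_minus: "clinear f \<Longrightarrow> f (- x) = - f x"
  using clinear_diff[of f 0 x] by (simp add: clinear_0)

lemma clinear_sum: "clinear f \<Longrightarrow> f (\<Sum>i\<in>I. g i) = (\<Sum>i\<in>I. f (g i))"
  by (induction I rule: infinite_finite_induct) (auto simp: clinear_0 clinear_add)

lemmas clinear_simps = clinear_0 clinear_add clinear_scaleC clinear_diff clinear_minus clinear_sum

lemma scaleC_minus_one: "scaleC (- 1) x = - x"
  by (simp add: scaleC_one)

lemma scaleC_sum_right: "scaleC c (\<Sum>i\<in>I. g i) = (\<Sum>i\<in>I. scaleC c (g i))"
  by (simp add: complex_vector.scale_sum_right)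

lemma scaleC_sum_left: "scaleC (\<Sum>i\<in>I. g i) x = (\<Sum>i\<in>I. scaleC (g i) x)"
  by (simp add: complex_vector.scale_sum_left)

lemma clinear_compose: "clinear f \<Longrightarrow> clinear g \<Longrightarrow> clinear (\<lambda>x. f (g x))"
  and clinear_zero: "clinear (\<lambda>x. 0)"
  and clinear_plus: "clinear p \<Longrightarrow> clinear q \<Longrightarrow> clinear (\<lambda>x. p x + q x)"
  by (auto simp: clinear_iff algebra_simps scaleC_add_right)

lemma clinear_sum_fun: "(\<And>i. i \<in> I \<Longrightarrow> clinear (f i)) \<Longrightarrow> clinear (\<lambda>x. \<Sum>i\<in>I. f i x)"
proof (induction I rule: infinite_finite_induct)
  case (insert i I)
  then show ?case using clinear_plus[of "f i" "\<lambda>x. \<Sum>i\<in>I. f i x"] by simp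
qed (simp_all add: clinear_zero)

lemma csubspace_iff:
  "csubspace S \<longleftrightarrow> 0 \<in> S \<and> (\<forall>x\<in>S. \<forall>y\<in>S. x + y \<in> S) \<and> (\<forall>c. \<forall>x\<in>S. scaleC c x \<in> S)"
  unfolding complex_vector.subspace_def by auto

lemma csubspace_sum: "csubspace S \<Longrightarrow> (\<And>i. i \<in> I \<Longrightarrow> g i \<in> S) \<Longrightarrow> (\<Sum>i\<in>I. g i) \<in> S"
  by (rule complex_vector.subspace_sum)

lemma csubspace_diff: "csubspace S \<Longrightarrow> x \<in> S \<Longrightarrow> y \<in> S \<Longrightarrow> x - y \<in> S"
  by (rule complex_vector.subspace_diff)

lemma add_span_subset: "add_subgroup S \<Longrightarrow> G \<subseteq> S \<Longrightarrow> add_span G \<subseteq> S"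
  by (rule hull_minimal)

lemma add_subgroup_sum: "add_subgroup S \<Longrightarrow> (\<And>i. i \<in> I \<Longrightarrow> g i \<in> S) \<Longrightarrow> (\<Sum>i\<in>I. g i) \<in> S"
  by (induction I rule: infinite_finite_induct) (auto simp: add_subgroup_add add_subgroup_def)

lemma add_span_0: "0 \<in> add_span S"
  and add_span_diff: "x \<in> add_span S \<Longrightarrow> y \<in> add_span S \<Longrightarrow> x - y \<in> add_span S"
  using add_subgroup_add_span[of S] by (simp_all only: add_subgroup_def)

lemma add_span_base: "x \<in> S \<Longrightarrow> x \<in> add_span S"
  by (rule hull_inc)

lemma add_span_induct [consumes 1, case_names base zero diff]:
  assumes "x \<in> add_span S" "\<And>x. x \<in> S \<Longrightarrow> P x" "P 0" "\<And>x y. P x \<Longrightarrow> P y \<Longrightarrow> P (x - y)"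
  shows "P x"
  using add_span_subset[of "{x. P x}" S] assms by (auto simp: add_subgroup_def)

lemma conj_linear_0: "conj_linear f \<Longrightarrow> f 0 = 0"
  unfolding conj_linear_def by (metis add_cancel_left_left)

lemma conj_linear_sum: "conj_linear f \<Longrightarrow> f (\<Sum>i\<in>I. g i) = (\<Sum>i\<in>I. f (g i))"
  by (induction I rule: infinite_finite_induct) (simp_all add: conj_linear_0, simp add: conj_linear_def)

text \<open>Every finite independent family has biorthogonal functionals on the whole space: these are
  coordinates with respect to a basis that extends the family.\<close>

lemma dual_functionals:
  fixes S :: "'a::complex_vector set"
  assumes "complex_vector.independent S"
  obtains \<phi> :: "'a \<Rightarrow> 'a \<Rightarrow> complex"
  where "\<And>v. v \<in> S \<Longrightarrow> clinear (\<phi> v)"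
    "\<And>v w. v \<in> S \<Longrightarrow> w \<in> S \<Longrightarrow> \<phi> v w = of_bool (v = w)"
proof
  define T where "T = complex_vector.extend_basis S"
  have T: "complex_vector.independent T" "S \<subseteq> T" "complex_vector.span T = UNIV"
    using complex_vector.independent_extend_basis[OF assms] complex_vector.extend_basis_superset[OF assms]
      complex_vector.span_extend_basis[OF assms]
    unfolding T_def by auto
  show "clinear (\<lambda>x. complex_vector.representation T x v)" for v
    using complex_vector.representation_add[OF T(1)] complex_vector.representation_scale[OF T(1)] T(3)
    by (auto simp: clinear_iff scaleC_complex_def)
  show "complex_vector.representation T w v = of_bool (v = w)" if "v \<in> S" "w \<in> S" for v w
    using complex_vector.representation_basis[OF T(1), of w] that T(2) by auto
qed

definition psd_form :: "('v::complex_vector \<Rightarrow> 'v \<Rightarrow> complex) \<Rightarrow> bool" where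
  "psd_form \<beta> \<longleftrightarrow> (\<forall>x y z. \<beta> x (y + z) = \<beta> x y + \<beta> x z) \<and> (\<forall>c x y. \<beta> x (scaleC c y) = c * \<beta> x y)
     \<and> (\<forall>x y. \<beta> y x = cnj (\<beta> x y)) \<and> (\<forall>x. 0 \<le> Re (\<beta> x x))"

text \<open>Hermitian symmetry follows from positivity of the quadratic form, by polarisation.\<close>

lemma psd_formI:
  assumes add: "\<And>x y z. \<beta> x (y + z) = \<beta> x y + \<beta> x z" "\<And>x y z. \<beta> (x + y) z = \<beta> x z + \<beta> y z"
    and scale: "\<And>c x y. \<beta> x (scaleC c y) = c * \<beta> x y" "\<And>c x y. \<beta> (scaleC c x) y = cnj c * \<beta> x y"
    and pos: "\<And>x. \<beta> x x \<in> nonneg_Reals"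
  shows "psd_form \<beta>"
proof -
  have re: "Im (\<beta> x x) = 0" and nn: "0 \<le> Re (\<beta> x x)" for x
    using pos[of x] by (auto simp: complex_nonneg_Reals_iff)
  have "\<beta> y x = cnj (\<beta> x y)" for x y
  proof (rule complex_eqI)
    show "Im (\<beta> y x) = Im (cnj (\<beta> x y))"
      using re[of "x + y"] re[of x] re[of y] by (simp add: add)
    show "Re (\<beta> y x) = Re (cnj (\<beta> x y))"
      using re[of "x + scaleC \<i> y"] re[of x] re[of y] by (simp add: add scale)
  qed
  then show ?thesis
    unfolding psd_form_def using add scale nn by blast
qed

text \<open>Forms may be degenerate, as the counit of a positive element of \<open>B\<close> can vanish.\<close>

context
  fixes \<beta> :: "'v::complex_vector \<Rightarrow> 'v \<Rightarrow> complex"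
  assumes psd: "psd_form \<beta>"
begin

lemma psd_add_right: "\<beta> x (y + z) = \<beta> x y + \<beta> x z"
  and psd_scale_right: "\<beta> x (scaleC c y) = c * \<beta> x y"
  and psd_sym: "\<beta> y x = cnj (\<beta> x y)"
  and psd_nonneg: "0 \<le> Re (\<beta> x x)"
  using psd unfolding psd_form_def by blast+

lemma psd_clinear: "clinear (\<beta> x)"
  by (simp add: clinear_iff psd_add_right psd_scale_right scaleC_complex_def)

lemma psd_add_left: "\<beta> (x + y) z = \<beta> x z + \<beta> y z"
  unfolding psd_sym[of "x + y" z] psd_sym[of x z] psd_sym[of y z] by (simp add: psd_add_right)

lemma psd_scale_left: "\<beta> (scaleC c x) y = cnj c * \<beta> x y"
  unfolding psd_sym[of "scaleC c x" y] psd_sym[of x y] by (simp add: psd_scale_right)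

lemma psd_diff_left: "\<beta> (x - y) z = \<beta> x z - \<beta> y z"
  using psd_add_left[of "x - y" y z] by simp

lemma psd_real: "\<beta> x x = of_real (Re (\<beta> x x))"
  using psd_sym[of x x] by (metis Reals_cnj_iff of_real_Re)

lemma psd_Cauchy_Schwarz: "(cmod (\<beta> x y))\<^sup>2 \<le> Re (\<beta> x x) * Re (\<beta> y y)"
proof -
  define a z where "a = Re (\<beta> x x)" and "z = \<beta> x y"
  have quad: "0 \<le> Re (\<beta> y y) - 2 * t * (cmod z)\<^sup>2 + t\<^sup>2 * (cmod z)\<^sup>2 * a" for t :: real
  proof -
    define s where "s = of_real t * z"
    have "\<beta> (y - scaleC s x) (y - scaleC s x) = \<beta> y y - s * cnj z - cnj s * z + cnj s * s * \<beta> x x"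
      using psd_sym[of x y] unfolding z_def
      by (simp add: psd_diff_left psd_scale_left clinear_diff[OF psd_clinear] psd_scale_right
          algebra_simps)
    also have "\<dots> = \<beta> y y - 2 * of_real t * (z * cnj z) + (of_real t)\<^sup>2 * (z * cnj z) * \<beta> x x"
      unfolding s_def by (simp add: algebra_simps power2_eq_square)
    also have "\<dots> = of_real (Re (\<beta> y y) - 2 * t * (cmod z)\<^sup>2 + t\<^sup>2 * (cmod z)\<^sup>2 * a)"
      unfolding a_def by (subst psd_real[of y], subst psd_real[of x]) (simp flip: complex_norm_square)
    finally show ?thesis
      using psd_nonneg[of "y - scaleC s x"] by simp
  qed
  have a: "a \<ge> 0"
    unfolding a_def by (rule psd_nonneg)
  have "(cmod z)\<^sup>2 \<le> a * Re (\<beta> y y)"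
  proof (cases "a = 0")
    case True
    show ?thesis
    proof (cases "z = 0")
      case False
      with quad[of "(Re (\<beta> y y) + 1) / (2 * (cmod z)\<^sup>2)"] True show ?thesis by (simp add: field_simps)
    qed (use True in simp)
  next
    case False
    with a quad[of "1 / a"] show ?thesis by (simp add: field_simps power2_eq_square)
  qed
  then show ?thesis by (simp add: a_def z_def)
qed

lemma psd_null: "\<beta> x x = 0 \<Longrightarrow> \<beta> y x = 0"
  using psd_Cauchy_Schwarz[of y x] by auto

text \<open>Gram-Schmidt that discards null directions: the expansion of \<open>x\<close> in the \<open>e\<^sub>i\<close> is correct modulo
  the null space, which is all that the form can see.\<close>

lemma orthonormal_spanning:
  assumes "finite G"
  shows "\<exists>(n::nat) e. (\<forall>i<n. e i \<in> complex_vector.span G)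
    \<and> (\<forall>i<n. \<forall>j<n. \<beta> (e i) (e j) = of_bool (i = j))
    \<and> (\<forall>x\<in>complex_vector.span G. \<forall>y. \<beta> y x = (\<Sum>i<n. \<beta> (e i) x * \<beta> y (e i)))"
  using assms
proof (induction G)
  case empty
  show ?case
    by (rule exI[of _ 0]) (auto simp: clinear_0[OF psd_clinear])
next
  case (insert g G)
  then obtain n :: nat and e where e: "\<And>i. i < n \<Longrightarrow> e i \<in> complex_vector.span G"
      and on: "\<And>i j. i < n \<Longrightarrow> j < n \<Longrightarrow> \<beta> (e i) (e j) = of_bool (i = j)"
      and sp: "\<And>x y. x \<in> complex_vector.span G \<Longrightarrow> \<beta> y x = (\<Sum>i<n. \<beta> (e i) x * \<beta> y (e i))"
    by blast
  have e': "e i \<in> complex_vector.span (insert g G)" if "i < n" for i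
    using e[OF that] complex_vector.span_mono[of G "insert g G"] by auto
  define r where "r = g - (\<Sum>i<n. scaleC (\<beta> (e i) g) (e i))"
  have r_right: "\<beta> y r = \<beta> y g - (\<Sum>i<n. \<beta> (e i) g * \<beta> y (e i))" for y
    unfolding r_def by (simp add: clinear_simps[OF psd_clinear] scaleC_complex_def)
  have "\<beta> (e j) r = 0" if "j < n" for j
    using that by (simp add: r_right on of_bool_def if_distrib[of "\<lambda>x. _ * x"] cong: if_cong)
  then have r_e: "\<beta> r (e j) = 0" if "j < n" for j
    using that psd_sym[of r "e j"] psd_sym[of "e j" r] by simp
  have r_G: "\<beta> r x = 0" if "x \<in> complex_vector.span G" for x
    using sp[OF that, of r] r_e by simp
  have r_span: "r \<in> complex_vector.span (insert g G)"
    unfolding r_def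
    by (intro complex_vector.span_diff complex_vector.span_sum complex_vector.span_scale e')
      (auto intro: complex_vector.span_base)
  have extend: "\<forall>x\<in>complex_vector.span (insert g G). \<forall>y. \<beta> y x = (\<Sum>i<m. \<beta> (f i) x * \<beta> y (f i))"
    if "\<And>x y. x \<in> insert g G \<Longrightarrow> \<beta> y x = (\<Sum>i<m. \<beta> (f i) x * \<beta> y (f i))" for m :: nat and f
  proof -
    define D where "D y x = \<beta> y x - (\<Sum>i<m. \<beta> (f i) x * \<beta> y (f i))" for x y
    have "clinear (D y)" for y
      unfolding D_def
      by (auto simp: clinear_iff clinear_simps[OF psd_clinear] scaleC_complex_def algebra_simps
          sum.distrib sum_distrib_left)
    then have "csubspace {x. \<forall>y. D y x = 0}"
      by (simp add: csubspace_iff clinear_simps)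
    then have "csubspace {x. \<forall>y. \<beta> y x = (\<Sum>i<m. \<beta> (f i) x * \<beta> y (f i))}"
      unfolding D_def right_minus_eq .
    then have "complex_vector.span (insert g G) \<subseteq> {x. \<forall>y. \<beta> y x = (\<Sum>i<m. \<beta> (f i) x * \<beta> y (f i))}"
      by (intro complex_vector.span_minimal) (use that in auto)
    then show ?thesis by blast
  qed
  (* A null residue r adds no new direction; otherwise its normalisation is the next basis vector. *)
  show ?case
  proof (cases "\<beta> r r = 0")
    case True
    have "\<beta> y g = (\<Sum>i<n. \<beta> (e i) g * \<beta> y (e i))" for y
      using psd_null[OF True, of y] by (simp add: r_right)
    then have "\<forall>x\<in>complex_vector.span (insert g G). \<forall>y. \<beta> y x = (\<Sum>i<n. \<beta> (e i) x * \<beta> y (e i))"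
      by (intro extend) (auto intro: sp complex_vector.span_base)
    with e' on show ?thesis
      by (intro exI[of _ n] exI[of _ e]) blast
  next
    case False
    define k where "k = sqrt (Re (\<beta> r r))"
    have "Re (\<beta> r r) > 0"
      using False psd_nonneg[of r] psd_real[of r] by (metis less_eq_real_def of_real_0)
    then have k: "k > 0" "\<beta> r r = of_real (k * k)"
      using psd_real[of r] unfolding k_def by simp_all
    define f where "f i = (if i < n then e i else scaleC (of_real (1 / k)) r)" for i
    have f_n: "\<beta> (f n) x = of_real (1 / k) * \<beta> r x" for x
      unfolding f_def by (simp add: psd_scale_left)
    have f_n': "\<beta> x (f n) = of_real (1 / k) * \<beta> x r" for x
      unfolding f_def by (simp add: psd_scale_right)
    have f_e: "f l = e l" if "l < n" for l
      using that by (simp add: f_def)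
    have "\<beta> y x = (\<Sum>i<Suc n. \<beta> (f i) x * \<beta> y (f i))" if "x \<in> insert g G" for x y
    proof (cases "x = g")
      case True
      have "\<beta> r g = \<beta> r r"
        by (simp add: r_right r_e)
      then have "\<beta> (f n) g * \<beta> y (f n) = \<beta> y r"
        using k by (simp add: f_n f_n' field_simps)
      then show ?thesis
        by (simp add: True r_right f_e)
    next
      case False
      with that have "x \<in> complex_vector.span G" by (auto intro: complex_vector.span_base)
      then show ?thesis
        using sp[of x y] r_G[of x] by (simp add: f_n f_e)
    qed
    then have "\<forall>x\<in>complex_vector.span (insert g G). \<forall>y. \<beta> y x = (\<Sum>i<Suc n. \<beta> (f i) x * \<beta> y (f i))"
      by (intro extend)
    moreover have "\<forall>i<Suc n. \<forall>j<Suc n. \<beta> (f i) (f j) = of_bool (i = j)"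
    proof (intro allI impI)
      fix i j assume ij: "i < Suc n" "j < Suc n"
      have "\<beta> (f n) (f n) = 1"
        using k by (simp add: f_n f_n' field_simps)
      moreover have "\<beta> (f n) (e l) = 0" if "l < n" for l
        using that by (simp add: f_n r_e)
      moreover have "\<beta> (e l) (f n) = 0" if "l < n" for l
        using that r_e[of l] psd_sym[of "e l" r] by (simp add: f_n')
      ultimately show "\<beta> (f i) (f j) = of_bool (i = j)"
        using ij on[of i j] f_e by (cases "i = n"; cases "j = n") auto
    qed
    moreover have "\<forall>i<Suc n. f i \<in> complex_vector.span (insert g G)"
      using e' r_span by (auto simp: f_def complex_vector.span_scale)
    ultimately show ?thesis by blast
  qed
qed

end


section \<open>Evaluation on tensor products\<close>

lemma frag_induct_tensor:
  assumes t: "is_tensor_product rr ll t"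
    and base: "\<And>m n. P (t m n)" and diff: "\<And>x y. P x \<Longrightarrow> P y \<Longrightarrow> P (x - y)"
  shows "P x"
proof -
  obtain z where z: "x = frag_eval t z"
    using t unfolding is_tensor_product_def by (metis surjD)
  have "P 0" using diff[OF base[of undefined undefined] base[of undefined undefined]] by simp
  then have "P (frag_eval t z)"
    by (intro frag_induction[of z UNIV "\<lambda>z. P (frag_eval t z)"])
      (use base diff in \<open>auto simp: frag_eval_diff frag_eval_of split: prod.splits\<close>)
  with z show ?thesis by simp
qed

text \<open>The induced map is evaluated on an arbitrarily chosen representative, so its additivity rests on
  balanced biadditive maps vanishing on the tensor relations.\<close>

context
  fixes rr :: "'m::complex_vector \<Rightarrow> 'r \<Rightarrow> 'm" and ll :: "'r \<Rightarrow> 'n::complex_vector \<Rightarrow> 'n"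
    and t :: "'m \<Rightarrow> 'n \<Rightarrow> 't::complex_vector"
  assumes t: "is_tensor_product rr ll t"
begin

lemma tlift_diff:
  assumes f: "biadditive f" "\<And>m r n. f (rr m r) n = f m (ll r n)"
  shows "tlift t f (x - y) = tlift t f x - tlift t f y"
proof -
  have S: "surj (frag_eval t)"
    and K: "\<And>z. frag_eval t z = 0 \<Longrightarrow> z \<in> tensor_rel UNIV (+) UNIV (+) rr ll"
    using t unfolding is_tensor_product_def by auto
  define z where "z x = (SOME z. frag_eval t z = x)" for x
  have z: "frag_eval t (z x) = x" for x
    unfolding z_def by (rule someI_ex) (metis S surjD)
  have "frag_eval t (z (x - y) - (z x - z y)) = 0"
    by (simp add: frag_eval_diff z)
  from frag_eval_tensor_rel[OF f K[OF this]]
  show ?thesis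
    by (simp add: tlift_def z_def[symmetric] frag_eval_diff)
qed

context
  fixes f :: "'m \<Rightarrow> 'n \<Rightarrow> 'v::complex_vector"
  assumes f: "biadditive f" "\<And>m r n. f (rr m r) n = f m (ll r n)"
begin

lemma tlift_0: "tlift t f 0 = 0"
  using tlift_diff[OF f, of 0 0] by simp

lemma tlift_minus: "tlift t f (- x) = - tlift t f x"
  using tlift_diff[OF f, of 0 x] by (simp add: tlift_0)

lemma tlift_add: "tlift t f (x + y) = tlift t f x + tlift t f y"
  using tlift_diff[OF f, of x "- y"] by (simp add: tlift_minus)

lemma tlift_sum: "tlift t f (\<Sum>i\<in>I. g i) = (\<Sum>i\<in>I. tlift t f (g i))"
  by (induction I rule: infinite_finite_induct) (auto simp: tlift_0 tlift_add)

end

lemma tensor_biadditive: "biadditive t" and tensor_balanced: "t (rr m r) n = t m (ll r n)"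
proof -
  have K: "frag_eval t z = 0" if "z \<in> tensor_rel UNIV (+) UNIV (+) rr ll" for z
    using t that unfolding is_tensor_product_def by auto
  have "frag_of (x + y, n) - frag_of (x, n) - frag_of (y, n) \<in> tensor_rel UNIV (+) UNIV (+) rr ll"
    "frag_of (x, m + n) - frag_of (x, m) - frag_of (x, n) \<in> tensor_rel UNIV (+) UNIV (+) rr ll"
    "frag_of (rr x r, n) - frag_of (x, ll r n) \<in> tensor_rel UNIV (+) UNIV (+) rr ll" for x y m n r
    unfolding tensor_rel_def by (rule hull_inc, blast)+
  note this[THEN K]
  then show "biadditive t" "t (rr m r) n = t m (ll r n)"
    unfolding biadditive_def frag_eval_diff frag_eval_of by (auto simp: algebra_simps)
qed

lemma tensor_scaleC: "t (scaleC c m) n = scaleC c (t m n)"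
  using t unfolding is_tensor_product_def by blast

end

lemma biadditive_left: "biadditive f \<Longrightarrow> f (x + x') z = f x z + f x' z"
  and biadditive_right: "biadditive f \<Longrightarrow> f x (z + z') = f x z + f x z'"
  by (auto simp: biadditive_def)

lemma biadditive_zero: "biadditive f \<Longrightarrow> f 0 z = 0" "biadditive f \<Longrightarrow> f x 0 = 0"
  using biadditive_left[of f 0 0 z] biadditive_right[of f x 0 0] by simp_all

lemma biadditive_diff_left: "biadditive f \<Longrightarrow> f (x - x') z = f x z - f x' z"
  and biadditive_diff_right: "biadditive f \<Longrightarrow> f x (z - z') = f x z - f x z'"
  using biadditive_left[of f "x - x'" x' z] biadditive_right[of f x "z - z'" z']
  by (simp_all add: algebra_simps)

lemma biadditive_sum_left: "biadditive f \<Longrightarrow> f (\<Sum>i\<in>I. g i) y = (\<Sum>i\<in>I. f (g i) y)"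
  by (induction I rule: infinite_finite_induct) (auto simp: biadditive_zero biadditive_left)

lemma biadditive_sum_right: "biadditive f \<Longrightarrow> f x (\<Sum>i\<in>I. g i) = (\<Sum>i\<in>I. f x (g i))"
  by (induction I rule: infinite_finite_induct) (auto simp: biadditive_zero biadditive_right)

text \<open>\<open>cbalanced f\<close> is the condition under which \<open>f\<close> induces a map on \<open>\<otimes>\<close> over \<open>\<complex>\<close>.  It does not
  ask for homogeneity, so that maps such as \<open>(a, x) \<mapsto> \<beta>(x, y) a\<^sup>*\<close> with \<open>\<beta>\<close> sesquilinear qualify.\<close>

definition cbalanced :: "('a::complex_vector \<Rightarrow> 'b::complex_vector \<Rightarrow> 'c::complex_vector) \<Rightarrow> bool" where
  "cbalanced f \<longleftrightarrow> biadditive f \<and> (\<forall>c x y. f (scaleC c x) y = f x (scaleC c y))"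

text \<open>Evaluation of a tensor in Sweedler's notation: \<open>sw f (\<Delta> a)\<close> is \<open>f a\<^sub>(\<^sub>1\<^sub>) a\<^sub>(\<^sub>2\<^sub>)\<close>.\<close>

abbreviation sw :: "('a::complex_vector \<Rightarrow> 'b::complex_vector \<Rightarrow> 'c::complex_vector) \<Rightarrow> ('a, 'b) ctensor \<Rightarrow> 'c" where
  "sw \<equiv> tlift ctens"

lemma cbalancedI:
  assumes "\<And>x y z. f (x + y) z = f x z + f y z" "\<And>x y z. f x (y + z) = f x y + f x z"
    "\<And>c x y. f (scaleC c x) y = f x (scaleC c y)"
  shows "cbalanced f"
  using assms by (auto simp: cbalanced_def biadditive_def)

lemma cbalanced_biadditive: "cbalanced f \<Longrightarrow> biadditive f"
  and cbalanced_scaleC: "cbalanced f \<Longrightarrow> f (scaleC c x) y = f x (scaleC c y)"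
  by (auto simp: cbalanced_def)

lemma sw_ctens: "cbalanced f \<Longrightarrow> sw f (ctens x y) = f x y"
  and sw_0: "cbalanced f \<Longrightarrow> sw f 0 = 0"
  and sw_add: "cbalanced f \<Longrightarrow> sw f (t + u) = sw f t + sw f u"
  and sw_diff: "cbalanced f \<Longrightarrow> sw f (t - u) = sw f t - sw f u"
  and sw_sum: "cbalanced f \<Longrightarrow> sw f (\<Sum>i\<in>I. g i) = (\<Sum>i\<in>I. sw f (g i))"
  by (auto simp: cbalanced_def intro!: ctensor_lift tlift_0[OF is_tensor_product_ctens]
      tlift_add[OF is_tensor_product_ctens] tlift_diff[OF is_tensor_product_ctens]
      tlift_sum[OF is_tensor_product_ctens])

lemma sw_sum_ctens: "cbalanced f \<Longrightarrow> sw f (\<Sum>i\<in>I. ctens (a i) (x i)) = (\<Sum>i\<in>I. f (a i) (x i))"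
  by (simp add: sw_sum sw_ctens)

lemma sw_scaleC:
  assumes "cbalanced f" and "\<And>x y. f (scaleC c x) y = scaleC c (f x y)"
  shows "sw f (scaleC c t) = scaleC c (sw f t)"
proof (rule frag_induct_tensor[OF is_tensor_product_ctens, of "\<lambda>t. sw f (scaleC c t) = scaleC c (sw f t)"])
  show "sw f (scaleC c (ctens m n)) = scaleC c (sw f (ctens m n))" for m n
    using assms by (simp add: ctens_scaleC(1)[symmetric] sw_ctens)
  show "sw f (scaleC c (x - y)) = scaleC c (sw f (x - y))"
    if "sw f (scaleC c x) = scaleC c (sw f x)" "sw f (scaleC c y) = scaleC c (sw f y)" for x y
    using that assms(1) by (simp add: complex_vector.scale_right_diff_distrib sw_diff)
qed

lemma sw_plus_fun:
  assumes f: "cbalanced f" and g: "cbalanced g"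
  shows "sw (\<lambda>x y. f x y + g x y) t = sw f t + sw g t"
proof -
  have fg: "cbalanced (\<lambda>x y. f x y + g x y)"
    using f g by (auto simp: cbalanced_def biadditive_def)
  show ?thesis
    by (rule frag_induct_tensor[OF is_tensor_product_ctens,
          of "\<lambda>t. sw (\<lambda>x y. f x y + g x y) t = sw f t + sw g t"])
      (simp_all add: sw_ctens[OF f] sw_ctens[OF g] sw_ctens[OF fg] sw_diff[OF f] sw_diff[OF g] sw_diff[OF fg])
qed

lemma ctens_add: "ctens (x + x') z = ctens x z + ctens x' z" "ctens x (z + z') = ctens x z + ctens x z'"
  by (rule biadditive_left biadditive_right, rule ctens_biadditive)+

lemma cbalanced_ctens_map:
  assumes "\<And>x y. f (x + y) = f x + f y" "\<And>x y. g (x + y) = g x + g y"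
    and "\<And>c x. f (scaleC c x) = scaleC (s c) (f x)" "\<And>c x. g (scaleC c x) = scaleC (s c) (g x)"
  shows "cbalanced (\<lambda>x y. ctens (f x) (g y))"
  by (rule cbalancedI) (simp_all add: assms ctens_add ctens_scaleC)

lemma ctmap_sum:
  assumes "clinear f" "clinear g"
  shows "ctmap f g (\<Sum>i\<in>I. ctens (a i) (x i)) = (\<Sum>i\<in>I. ctens (f (a i)) (g (x i)))"
  unfolding ctmap_def
  by (rule sw_sum_ctens) (rule cbalanced_ctens_map[where s = "\<lambda>c. c"], use assms in \<open>auto simp: clinear_simps\<close>)

lemma ctmap_sum_conj:
  assumes "conj_linear f" "conj_linear g"
  shows "ctmap f g (\<Sum>i\<in>I. ctens (a i) (x i)) = (\<Sum>i\<in>I. ctens (f (a i)) (g (x i)))"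
  unfolding ctmap_def
  by (rule sw_sum_ctens) (rule cbalanced_ctens_map[where s = cnj], use assms in \<open>auto simp: conj_linear_def\<close>)

text \<open>The function \<open>s\<close> is the identity or conjugation; the latter occurs for sesquilinear \<open>p\<close> and \<open>q\<close>.\<close>

lemma ctzip_cbalanced:
  assumes p: "biadditive p" "\<And>c x u. p (scaleC c x) u = scaleC (s c) (p x u)"
      "\<And>c x u. p x (scaleC c u) = scaleC c (p x u)"
    and q: "biadditive q" "\<And>c y v. q (scaleC c y) v = scaleC (s c) (q y v)"
      "\<And>c y v. q y (scaleC c v) = scaleC c (q y v)"
  shows "cbalanced (\<lambda>x y. sw (\<lambda>u v. ctens (p x u) (q y v)) t)" (is ?A)
    and "cbalanced (\<lambda>u v. ctens (p x u) (q y v))" (is "?B x y")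
proof -
  show B: "?B x y" for x y
    by (rule cbalancedI) (simp_all add: biadditive_right[OF p(1)] biadditive_right[OF q(1)] p(3) q(3)
        ctens_add ctens_scaleC)
  show ?A
    by (rule cbalancedI)
      (simp_all add: biadditive_left[OF p(1)] biadditive_left[OF q(1)] p(2) q(2) ctens_add ctens_scaleC
        sw_plus_fun[OF B B])
qed

lemma ctzip_sum:
  assumes p: "biadditive p" "\<And>c x u. p (scaleC c x) u = scaleC (s c) (p x u)"
      "\<And>c x u. p x (scaleC c u) = scaleC c (p x u)"
    and q: "biadditive q" "\<And>c y v. q (scaleC c y) v = scaleC (s c) (q y v)"
      "\<And>c y v. q y (scaleC c v) = scaleC c (q y v)"
  shows "ctzip p q (\<Sum>i\<in>I. ctens (a i) (x i)) (\<Sum>j\<in>J. ctens (b j) (y j))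
    = (\<Sum>i\<in>I. \<Sum>j\<in>J. ctens (p (a i) (b j)) (q (x i) (y j)))"
  unfolding ctzip_def
  by (subst sw_sum_ctens[OF ctzip_cbalanced(1)[OF assms]]) (simp add: sw_sum_ctens[OF ctzip_cbalanced(2)[OF assms]])

lemma ctsub_induct [consumes 1, case_names base zero diff]:
  assumes "t \<in> ctsub U V" and "\<And>x y. x \<in> U \<Longrightarrow> y \<in> V \<Longrightarrow> P (ctens x y)"
    and "P 0" "\<And>x y. P x \<Longrightarrow> P y \<Longrightarrow> P (x - y)"
  shows "P t"
  using add_span_subset[of "{t. P t}" "{ctens x y | x y. x \<in> U \<and> y \<in> V}"] assms
  unfolding ctsub_def by (auto simp: add_subgroup_def)

text \<open>A tensor can be written with independent left legs; the right legs stay in any subspace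
  that they can be taken from.\<close>

lemma ctensor_independent_left:
  fixes t :: "('a::complex_vector, 'b::complex_vector) ctensor"
  assumes U: "csubspace U" and t: "t \<in> ctsub UNIV U"
  obtains S :: "'a set" and x \<phi> where "finite S" "\<And>a. a \<in> S \<Longrightarrow> x a \<in> U" "t = (\<Sum>a\<in>S. ctens a (x a))"
    "\<And>a. a \<in> S \<Longrightarrow> clinear (\<phi> a)" "\<And>a b. a \<in> S \<Longrightarrow> b \<in> S \<Longrightarrow> \<phi> a b = (of_bool (a = b) :: complex)"
proof -
  have "\<exists>S x. finite S \<and> (\<forall>a\<in>S. x a \<in> U) \<and> t = (\<Sum>a\<in>S. ctens a (x a))"
    using t
  proof (induction rule: ctsub_induct)
    case (base a y)
    then show ?case by (intro exI[of _ "{a}"] exI[of _ "\<lambda>_. y"]) auto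
  next
    case (diff t u)
    then obtain S x T y where S: "finite S" "\<forall>a\<in>S. x a \<in> U" "t = (\<Sum>a\<in>S. ctens a (x a))"
      and T: "finite T" "\<forall>a\<in>T. y a \<in> U" "u = (\<Sum>a\<in>T. ctens a (y a))" by blast
    define z where "z a = (if a \<in> S then x a else 0) - (if a \<in> T then y a else 0)" for a
    have ctens_diff: "ctens a (v - w) = ctens a v - ctens a w" for a :: 'a and v w :: 'b
      by (rule biadditive_diff_right[OF ctens_biadditive])
    have "t = (\<Sum>a\<in>S \<union> T. ctens a (if a \<in> S then x a else 0))"
      "u = (\<Sum>a\<in>S \<union> T. ctens a (if a \<in> T then y a else 0))"
      unfolding S T using S T by (auto intro!: sum.mono_neutral_cong_left
          simp: biadditive_zero[OF ctens_biadditive])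
    then have "t - u = (\<Sum>a\<in>S \<union> T. ctens a (z a))"
      by (simp add: z_def ctens_diff sum_subtractf)
    moreover have "\<forall>a\<in>S \<union> T. z a \<in> U"
      using S T complex_vector.subspace_0[OF U] unfolding z_def by (auto intro!: csubspace_diff[OF U] complex_vector.subspace_neg[OF U])
    ultimately show ?case using S T by blast
  qed (auto intro!: exI[of _ "{}"])
  then obtain T y where T: "finite T" "\<And>a. a \<in> T \<Longrightarrow> y a \<in> U" "t = (\<Sum>a\<in>T. ctens a (y a))" by blast
  (* Rewrite the left legs in a basis of their span and collect the right legs. *)
  obtain S where S: "S \<subseteq> T" "complex_vector.independent S" "T \<subseteq> complex_vector.span S"
    using complex_vector.maximal_independent_subset[of T] by blast
  have fin: "finite S" using S T finite_subset by blast
  define x where "x v = (\<Sum>a\<in>T. scaleC (complex_vector.representation S a v) (y a))" for v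
  have rep: "a = (\<Sum>v\<in>S. scaleC (complex_vector.representation S a v) v)" if "a \<in> T" for a
    using complex_vector.sum_representation_eq[OF S(2), of a S] that S(3) fin by auto
  have "t = (\<Sum>a\<in>T. ctens (\<Sum>v\<in>S. scaleC (complex_vector.representation S a v) v) (y a))"
    unfolding T(3) using rep by (intro sum.cong) auto
  also have "\<dots> = (\<Sum>v\<in>S. ctens v (x v))"
    unfolding x_def biadditive_sum_left[OF ctens_biadditive] biadditive_sum_right[OF ctens_biadditive]
      ctens_scaleC by (rule sum.swap)
  finally have t: "t = (\<Sum>v\<in>S. ctens v (x v))" .
  obtain \<phi> where "\<And>v. v \<in> S \<Longrightarrow> clinear (\<phi> v)" "\<And>v w. v \<in> S \<Longrightarrow> w \<in> S \<Longrightarrow> \<phi> v w = (of_bool (v = w) :: complex)"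
    using dual_functionals[OF S(2)] by blast
  moreover have "x v \<in> U" for v
    unfolding x_def using U T(2) by (intro csubspace_sum) (auto simp: csubspace_iff)
  ultimately show ?thesis
    using that[of S x \<phi>] fin t by blast
qed

lemma ctsub_UNIV: "ctsub UNIV UNIV = UNIV"
proof -
  have "t \<in> ctsub UNIV UNIV" for t :: "('a, 'b) ctensor"
  proof (rule frag_induct_tensor[OF is_tensor_product_ctens, of "\<lambda>t. t \<in> ctsub UNIV UNIV"])
    show "ctens m n \<in> ctsub UNIV UNIV" for m :: 'a and n :: 'b
      unfolding ctsub_def by (rule hull_inc) blast
    show "t - u \<in> ctsub UNIV UNIV" if "t \<in> ctsub UNIV UNIV" "u \<in> ctsub UNIV UNIV" for t u :: "('a, 'b) ctensor"
      using that add_subgroup_add_span unfolding ctsub_def add_subgroup_def by blast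
  qed
  then show ?thesis by auto
qed

lemma ctensor_independent_left_UNIV:
  fixes t :: "('a::complex_vector, 'b::complex_vector) ctensor"
  obtains S :: "'a set" and x \<phi> where "finite S" "t = (\<Sum>a\<in>S. ctens a (x a))"
    "\<And>a. a \<in> S \<Longrightarrow> clinear (\<phi> a)" "\<And>a b. a \<in> S \<Longrightarrow> b \<in> S \<Longrightarrow> \<phi> a b = (of_bool (a = b) :: complex)"
  using ctensor_independent_left[of UNIV t] by (auto simp: ctsub_UNIV csubspace_iff)

lemma ctensor_sum_rep:
  fixes t :: "('a::complex_vector, 'b::complex_vector) ctensor"
  obtains S :: "'a set" and x where "finite S" "t = (\<Sum>a\<in>S. ctens a (x a))"
  using ctensor_independent_left_UNIV[of t] by blast


section \<open>Comodules and their finite-dimensional subcomodules\<close>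

lemma cbalanced_compose_left: "cbalanced f \<Longrightarrow> clinear g \<Longrightarrow> cbalanced (\<lambda>x y. f (g x) y)"
  and cbalanced_compose_right: "cbalanced f \<Longrightarrow> clinear g' \<Longrightarrow> cbalanced (\<lambda>x y. f x (g' y))"
  by (auto simp: cbalanced_def biadditive_def clinear_simps)

text \<open>The maps that can be evaluated on a tensor with three legs, bracketed either way.\<close>

definition ctrilinear where
  "ctrilinear G \<longleftrightarrow> (\<forall>a. cbalanced (G a)) \<and> (\<forall>y. cbalanced (\<lambda>a b. G a b y))"

lemma ctrilinearI:
  assumes "\<And>a a' b y. G (a + a') b y = G a b y + G a' b y" "\<And>a b b' y. G a (b + b') y = G a b y + G a b' y"
    "\<And>a b y y'. G a b (y + y') = G a b y + G a b y'" "\<And>c a b y. G (scaleC c a) b y = G a (scaleC c b) y"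
    "\<And>c a b y. G a (scaleC c b) y = G a b (scaleC c y)"
  shows "ctrilinear G"
  unfolding ctrilinear_def by (intro conjI allI cbalancedI) (simp_all add: assms)

lemma ctrilinear_cbalanced:
  assumes G: "ctrilinear G"
  shows "cbalanced (\<lambda>a u. sw (G a) u)" and "cbalanced (\<lambda>s y. sw (\<lambda>a b. G a b y) s)"
proof -
  have 1: "cbalanced (G a)" and 2: "cbalanced (\<lambda>a b. G a b y)" for a y
    using G by (auto simp: ctrilinear_def)
  show "cbalanced (\<lambda>a u. sw (G a) u)"
  proof (rule cbalancedI)
    fix a a' u v c
    have "sw (G (a + a')) u = sw (\<lambda>b y. G a b y + G a' b y) u"
      using biadditive_left[OF cbalanced_biadditive[OF 2]] by (metis (no_types, lifting) ext)
    then show "sw (G (a + a')) u = sw (G a) u + sw (G a') u"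
      using sw_plus_fun[OF 1 1] by simp
    show "sw (G a) (u + v) = sw (G a) u + sw (G a) v"
      by (rule sw_add[OF 1])
    show "sw (G (scaleC c a)) u = sw (G a) (scaleC c u)"
      by (rule frag_induct_tensor[OF is_tensor_product_ctens, of "\<lambda>u. sw (G (scaleC c a)) u = sw (G a) (scaleC c u)"])
        (simp_all add: sw_ctens[OF 1] sw_diff[OF 1] complex_vector.scale_right_diff_distrib
          ctens_scaleC(1)[symmetric] cbalanced_scaleC[OF 2])
  qed
  show "cbalanced (\<lambda>s y. sw (\<lambda>a b. G a b y) s)"
  proof (rule cbalancedI)
    fix s s' y y' c
    have "sw (\<lambda>a b. G a b (y + y')) s = sw (\<lambda>a b. G a b y + G a b y') s"
      using biadditive_right[OF cbalanced_biadditive[OF 1]] by (metis (no_types, lifting) ext)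
    then show "sw (\<lambda>a b. G a b (y + y')) s = sw (\<lambda>a b. G a b y) s + sw (\<lambda>a b. G a b y') s"
      using sw_plus_fun[OF 2 2] by simp
    show "sw (\<lambda>a b. G a b y) (s + s') = sw (\<lambda>a b. G a b y) s + sw (\<lambda>a b. G a b y) s'"
      by (rule sw_add[OF 2])
    show "sw (\<lambda>a b. G a b y) (scaleC c s) = sw (\<lambda>a b. G a b (scaleC c y)) s"
      by (rule frag_induct_tensor[OF is_tensor_product_ctens,
            of "\<lambda>s. sw (\<lambda>a b. G a b y) (scaleC c s) = sw (\<lambda>a b. G a b (scaleC c y)) s"])
        (simp_all add: sw_ctens[OF 2] sw_diff[OF 2] complex_vector.scale_right_diff_distrib
          ctens_scaleC(2)[symmetric] cbalanced_scaleC[OF 1])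
  qed
qed

definition left_comodule ::
  "('a::complex_algebra_1) cqg_data \<Rightarrow> ('e::complex_vector \<Rightarrow> ('a, 'e) ctensor) \<Rightarrow> bool" where
  "left_comodule H \<delta> \<longleftrightarrow> clinear \<delta>
     \<and> (\<forall>x. ctassoc (ctmap (comult H) id (\<delta> x)) = ctmap id \<delta> (\<delta> x))
     \<and> (\<forall>x. sw (\<lambda>a x. scaleC (counit H a) x) (\<delta> x) = x)"

lemma clinear_ident: "clinear (id :: 'z::complex_vector \<Rightarrow> 'z)"
  by (auto simp: clinear_iff)

text \<open>Coassociativity \<open>x\<^sub>(\<^sub>1\<^sub>) \<otimes> x\<^sub>(\<^sub>2\<^sub>) \<otimes> x\<^sub>(\<^sub>3\<^sub>)\<close> in the form in which it is used: both ways of splitting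
  three legs agree under every trilinear map.\<close>

lemma coassoc_eval:
  fixes H :: "('a::complex_algebra_1) cqg_data" and \<delta> :: "'e::complex_vector \<Rightarrow> ('a, 'e) ctensor"
    and G :: "'a \<Rightarrow> 'a \<Rightarrow> 'e \<Rightarrow> 'v::complex_vector"
  assumes \<delta>: "left_comodule H \<delta>" and \<Delta>: "clinear (comult H)" and G: "ctrilinear G"
  shows "sw (\<lambda>a x. sw (G a) (\<delta> x)) (\<delta> z) = sw (\<lambda>c y. sw (\<lambda>a b. G a b y) (comult H c)) (\<delta> z)"
proof -
  have lin: "clinear \<delta>"
    using \<delta> by (simp add: left_comodule_def)
  note B = ctrilinear_cbalanced[OF G]
  have B1: "cbalanced (\<lambda>a x. sw (G a) (\<delta> x))"
    by (rule cbalanced_compose_right[OF B(1) lin])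
  have B2: "cbalanced (\<lambda>c y. sw (\<lambda>a b. G a b y) (comult H c))"
    by (rule cbalanced_compose_left[OF B(2) \<Delta>])
  have T: "ctrilinear (\<lambda>x y (z::'e). ctens x (ctens y z))"
    by (rule ctrilinearI) (simp_all add: ctens_add ctens_scaleC)
  have C: "cbalanced (\<lambda>a b. G a b y)" "cbalanced (G a)" for a y
    using G by (auto simp: ctrilinear_def)
  have C': "cbalanced (\<lambda>(x::'a) y. ctens x (ctens y z))" for z :: 'e
    using T by (auto simp: ctrilinear_def)
  have assoc: "sw (\<lambda>a u. sw (G a) u) (ctassoc (ctens s y)) = sw (\<lambda>a b. G a b y) s" for s y
    unfolding ctassoc_def sw_ctens[OF ctrilinear_cbalanced(2)[OF T]]
    by (rule frag_induct_tensor[OF is_tensor_product_ctens, of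
          "\<lambda>s. sw (\<lambda>a u. sw (G a) u) (sw (\<lambda>x z. ctens x (ctens z y)) s) = sw (\<lambda>a b. G a b y) s"])
      (simp_all add: sw_ctens[OF C'] sw_diff[OF C'] sw_ctens[OF C(1)] sw_diff[OF C(1)] sw_ctens[OF B(1)]
        sw_diff[OF B(1)] sw_ctens[OF C(2)])
  obtain S x where S: "\<delta> z = (\<Sum>a\<in>S. ctens a (x a))"
    by (rule ctensor_sum_rep)
  have "sw (\<lambda>a x. sw (G a) (\<delta> x)) (\<delta> z) = sw (\<lambda>a u. sw (G a) u) (ctmap id \<delta> (\<delta> z))"
    unfolding S ctmap_sum[OF clinear_ident lin] sw_sum_ctens[OF B1] sw_sum_ctens[OF B(1)] by simp
  also have "\<dots> = sw (\<lambda>a u. sw (G a) u) (ctassoc (ctmap (comult H) id (\<delta> z)))"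
    using \<delta> by (simp add: left_comodule_def)
  also have "\<dots> = (\<Sum>a\<in>S. sw (\<lambda>a u. sw (G a) u) (ctassoc (ctens (comult H a) (x a))))"
    unfolding S ctmap_sum[OF \<Delta> clinear_ident]
    by (simp add: ctassoc_def sw_sum[OF ctrilinear_cbalanced(2)[OF T]] sw_sum[OF B(1)])
  also have "\<dots> = sw (\<lambda>c y. sw (\<lambda>a b. G a b y) (comult H c)) (\<delta> z)"
    unfolding assoc S sw_sum_ctens[OF B2] ..
  finally show ?thesis .
qed

lemma sw_ctens_id: "sw (\<lambda>x y. scaleC c (ctens x y)) t = scaleC c t"
proof -
  have B: "cbalanced (\<lambda>(x::'a) (y::'b). scaleC c (ctens x y))"
    by (rule cbalancedI) (simp_all add: ctens_add scaleC_add_right ctens_scaleC)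
  show ?thesis
    by (rule frag_induct_tensor[OF is_tensor_product_ctens, of "\<lambda>t. sw (\<lambda>x y. scaleC c (ctens x y)) t = scaleC c t"])
      (simp_all add: sw_ctens[OF B] sw_diff[OF B] complex_vector.scale_right_diff_distrib)
qed

lemma cbalanced_scaled: "clinear \<phi> \<Longrightarrow> cbalanced (\<lambda>x y. scaleC (\<phi> x) y)"
  and cbalanced_scaled': "clinear \<phi> \<Longrightarrow> cbalanced (\<lambda>x y. scaleC (\<phi> y) x)"
  by (rule cbalancedI; simp add: clinear_simps scaleC_add_right scaleC_add_left scaleC_scaleC
      scaleC_complex_def mult.commute)+

lemma sw_ctens_left:
  assumes "clinear \<phi>"
  shows "sw (\<lambda>p q. scaleC (\<phi> p) (ctens q x)) t = ctens (sw (\<lambda>p q. scaleC (\<phi> p) q) t) x"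
proof -
  have B: "cbalanced (\<lambda>p q. scaleC (\<phi> p) (ctens q x))"
    by (rule cbalancedI) (simp_all add: clinear_simps[OF assms] scaleC_add_left scaleC_add_right
      ctens_add ctens_scaleC scaleC_scaleC scaleC_complex_def mult.commute)
  show ?thesis
    by (rule frag_induct_tensor[OF is_tensor_product_ctens, of
        "\<lambda>t. sw (\<lambda>p q. scaleC (\<phi> p) (ctens q x)) t = ctens (sw (\<lambda>p q. scaleC (\<phi> p) q) t) x"])
      (simp_all add: sw_ctens[OF B] sw_diff[OF B] sw_ctens[OF cbalanced_scaled[OF assms]]
        sw_diff[OF cbalanced_scaled[OF assms]] ctens_scaleC biadditive_diff_left[OF ctens_biadditive])
qed

text \<open>The right legs of \<open>\<delta> y\<close>, taken with independent left legs, span a finite-dimensional subcomodule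
  that contains \<open>y\<close>; \<open>u\<close> below is its coefficient matrix with respect to an orthonormal basis.\<close>

lemma orthonormal_subcomodule:
  fixes H :: "('a::complex_algebra_1) cqg_data" and \<delta> :: "'e::complex_vector \<Rightarrow> ('a, 'e) ctensor"
  assumes \<delta>: "left_comodule H \<delta>" and \<Delta>: "clinear (comult H)" and \<epsilon>: "clinear (counit H)"
    and \<kappa>: "psd_form \<kappa>" and definite: "\<And>x. \<kappa> x x = 0 \<Longrightarrow> x = 0"
  obtains n :: nat and e u where
    "\<And>i j. i < n \<Longrightarrow> j < n \<Longrightarrow> \<kappa> (e i) (e j) = of_bool (i = j)"
    "\<And>i. i < n \<Longrightarrow> \<delta> (e i) = (\<Sum>j<n. ctens (u i j) (e j))"
    "\<And>i j. i < n \<Longrightarrow> j < n \<Longrightarrow> comult H (u i j) = (\<Sum>k<n. ctens (u i k) (u k j))"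
    "\<And>i j. i < n \<Longrightarrow> j < n \<Longrightarrow> counit H (u i j) = of_bool (i = j)"
    "y = (\<Sum>i<n. scaleC (\<kappa> (e i) y) (e i))"
proof -
  have lin: "clinear \<delta>" and cou: "\<And>x. sw (\<lambda>a x. scaleC (counit H a) x) (\<delta> x) = x"
    using \<delta> by (auto simp: left_comodule_def)
  obtain S x \<phi> where S: "finite S" "\<delta> y = (\<Sum>a\<in>S. ctens a (x a))"
    and \<phi>: "\<And>a. a \<in> S \<Longrightarrow> clinear (\<phi> a)" "\<And>a b. a \<in> S \<Longrightarrow> b \<in> S \<Longrightarrow> \<phi> a b = (of_bool (a = b) :: complex)"
    by (rule ctensor_independent_left_UNIV[of "\<delta> y"]) (rule that)
  define W where "W = complex_vector.span (x ` S)"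
  have W: "csubspace W" unfolding W_def by (rule complex_vector.subspace_span)
  have xW: "x a \<in> W" if "a \<in> S" for a
    unfolding W_def using that by (intro complex_vector.span_base) auto
  (* Coassociativity with the functional dual to a applied to the first leg isolates the coaction on x a. *)
  have \<delta>x: "\<delta> (x a) = (\<Sum>b\<in>S. ctens (sw (\<lambda>p q. scaleC (\<phi> a p) q) (comult H b)) (x b))" if a: "a \<in> S" for a
  proof -
    note lin\<phi> = \<phi>(1)[OF a]
    define G where "G p q z = scaleC (\<phi> a p) (ctens q z)" for p q :: 'a and z :: 'e
    have G: "ctrilinear G"
      unfolding G_def
      by (rule ctrilinearI) (simp_all add: clinear_simps[OF lin\<phi>] scaleC_add_left scaleC_add_right
          ctens_add ctens_scaleC scaleC_scaleC scaleC_complex_def mult.commute)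
    have "sw (\<lambda>a x. sw (G a) (\<delta> x)) (\<delta> y) = (\<Sum>b\<in>S. sw (G b) (\<delta> (x b)))"
      unfolding S
      by (rule sw_sum_ctens[OF cbalanced_compose_right[OF ctrilinear_cbalanced(1)[OF G] lin]])
    also have "\<dots> = (\<Sum>b\<in>S. scaleC (\<phi> a b) (\<delta> (x b)))"
      unfolding G_def sw_ctens_id ..
    also have "\<dots> = \<delta> (x a)"
      using a S(1) by (simp add: \<phi>(2) of_bool_def if_distrib[of "\<lambda>c. scaleC c _"] scaleC_one cong: if_cong)
    finally have "\<delta> (x a) = sw (\<lambda>c y. sw (\<lambda>a b. G a b y) (comult H c)) (\<delta> y)"
      using coassoc_eval[OF \<delta> \<Delta> G] by simp
    also have "\<dots> = (\<Sum>b\<in>S. sw (\<lambda>p q. G p q (x b)) (comult H b))"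
      unfolding S by (rule sw_sum_ctens[OF cbalanced_compose_left[OF ctrilinear_cbalanced(2)[OF G] \<Delta>]])
    finally show ?thesis
      unfolding G_def sw_ctens_left[OF lin\<phi>] .
  qed
  obtain n :: nat and e where e: "\<And>i. i < n \<Longrightarrow> e i \<in> W"
    and on: "\<And>i j. i < n \<Longrightarrow> j < n \<Longrightarrow> \<kappa> (e i) (e j) = of_bool (i = j)"
    and sp: "\<And>w z. w \<in> W \<Longrightarrow> \<kappa> z w = (\<Sum>i<n. \<kappa> (e i) w * \<kappa> z (e i))"
    using orthonormal_spanning[OF \<kappa>, of "x ` S"] S(1) unfolding W_def by blast
  note lin\<kappa> = psd_clinear[OF \<kappa>]
  have expand: "w = (\<Sum>i<n. scaleC (\<kappa> (e i) w) (e i))" if "w \<in> W" for w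
  proof -
    let ?r = "w - (\<Sum>i<n. scaleC (\<kappa> (e i) w) (e i))"
    have "\<kappa> ?r ?r = 0"
      using sp[OF that, of ?r] by (simp add: clinear_simps[OF lin\<kappa>] scaleC_complex_def)
    from definite[OF this] show ?thesis by simp
  qed
  define u where "u i j = sw (\<lambda>p z. scaleC (\<kappa> (e j) z) p) (\<delta> (e i))" for i j
  note Bu = cbalanced_scaled'[OF lin\<kappa>]
  have \<delta>W: "\<delta> w = (\<Sum>j<n. ctens (sw (\<lambda>p z. scaleC (\<kappa> (e j) z) p) (\<delta> w)) (e j))" if "w \<in> W" for w
  proof -
    let ?Q = "{w. \<delta> w = (\<Sum>j<n. ctens (sw (\<lambda>p z. scaleC (\<kappa> (e j) z) p) (\<delta> w)) (e j))}"
    have sw: "sw (\<lambda>p z. scaleC (\<kappa> (e j) z) p) (scaleC c t) = scaleC c (sw (\<lambda>p z. scaleC (\<kappa> (e j) z) p) t)" for c t j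
      by (rule sw_scaleC[OF Bu]) (simp add: scaleC_scaleC mult.commute)
    have "scaleC c w \<in> ?Q" if "w \<in> ?Q" for c w
      using that by (simp add: clinear_scaleC[OF lin] sw ctens_scaleC flip: scaleC_sum_right)
    then have "csubspace ?Q"
      by (auto simp: csubspace_iff clinear_simps[OF lin] sw_0[OF Bu] sw_add[OF Bu] ctens_add sum.distrib
          biadditive_zero[OF ctens_biadditive])
    moreover have "x ` S \<subseteq> ?Q"
    proof safe
      fix a assume a: "a \<in> S"
      have "\<delta> (x a) = (\<Sum>b\<in>S. \<Sum>j<n. scaleC (\<kappa> (e j) (x b)) (ctens (sw (\<lambda>p q. scaleC (\<phi> a p) q) (comult H b)) (e j)))"
        unfolding \<delta>x[OF a]
        by (intro sum.cong refl, subst expand[OF xW])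
          (simp_all add: biadditive_sum_right[OF ctens_biadditive] ctens_scaleC)
      also have "\<dots> = (\<Sum>j<n. ctens (sw (\<lambda>p z. scaleC (\<kappa> (e j) z) p) (\<delta> (x a))) (e j))"
        unfolding \<delta>x[OF a] sw_sum_ctens[OF Bu] biadditive_sum_left[OF ctens_biadditive] ctens_scaleC
        by (rule sum.swap)
      finally show "\<delta> (x a) = (\<Sum>j<n. ctens (sw (\<lambda>p z. scaleC (\<kappa> (e j) z) p) (\<delta> (x a))) (e j))" .
    qed
    ultimately have "W \<subseteq> ?Q"
      unfolding W_def by (intro complex_vector.span_minimal)
    with that show ?thesis by blast
  qed
  have \<delta>e: "\<delta> (e i) = (\<Sum>j<n. ctens (u i j) (e j))" if "i < n" for i
    using \<delta>W[OF e[OF that]] unfolding u_def .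
  have \<Delta>u: "comult H (u i j) = (\<Sum>k<n. ctens (u i k) (u k j))" if ij: "i < n" "j < n" for i j
  proof -
    define G where "G p q z = scaleC (\<kappa> (e j) z) (ctens p q)" for p q :: 'a and z
    have G: "ctrilinear G"
      unfolding G_def
      by (rule ctrilinearI) (simp_all add: clinear_simps[OF lin\<kappa>] scaleC_add_left scaleC_add_right
          ctens_add ctens_scaleC scaleC_scaleC scaleC_complex_def mult.commute)
    have Gb: "cbalanced (G a)" for a
      using G by (simp add: ctrilinear_def)
    have "sw (\<lambda>a x. sw (G a) (\<delta> x)) (\<delta> (e i)) = (\<Sum>k<n. sw (G (u i k)) (\<delta> (e k)))"
      unfolding \<delta>e[OF ij(1)]
      by (rule sw_sum_ctens[OF cbalanced_compose_right[OF ctrilinear_cbalanced(1)[OF G] lin]])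
    also have "\<dots> = (\<Sum>k<n. ctens (u i k) (u k j))"
      using ij by (intro sum.cong refl) (simp add: \<delta>e sw_sum_ctens[OF Gb] G_def on of_bool_def
          if_distrib[of "\<lambda>c. scaleC c _"] scaleC_one cong: if_cong)
    finally have "(\<Sum>k<n. ctens (u i k) (u k j)) = sw (\<lambda>c y. sw (\<lambda>a b. G a b y) (comult H c)) (\<delta> (e i))"
      using coassoc_eval[OF \<delta> \<Delta> G] by simp
    also have "\<dots> = (\<Sum>l<n. sw (\<lambda>a b. G a b (e l)) (comult H (u i l)))"
      unfolding \<delta>e[OF ij(1)] by (rule sw_sum_ctens[OF cbalanced_compose_left[OF ctrilinear_cbalanced(2)[OF G] \<Delta>]])
    also have "\<dots> = (\<Sum>l<n. scaleC (\<kappa> (e j) (e l)) (comult H (u i l)))"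
      unfolding G_def sw_ctens_id ..
    also have "\<dots> = comult H (u i j)"
      using ij by (simp add: on of_bool_def if_distrib[of "\<lambda>c. scaleC c _"]
          scaleC_one cong: if_cong)
    finally show ?thesis ..
  qed
  have \<epsilon>u: "counit H (u i j) = of_bool (i = j)" if ij: "i < n" "j < n" for i j
  proof -
    have "e i = (\<Sum>l<n. scaleC (counit H (u i l)) (e l))"
      using cou[of "e i"] by (simp add: \<delta>e[OF ij(1)] sw_sum_ctens[OF cbalanced_scaled[OF \<epsilon>]])
    then have "\<kappa> (e j) (e i) = \<kappa> (e j) (\<Sum>l<n. scaleC (counit H (u i l)) (e l))"
      by simp
    also have "\<dots> = counit H (u i j)"
      using ij by (simp add: clinear_simps[OF lin\<kappa>] on scaleC_complex_def of_bool_def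
          if_distrib[of "\<lambda>c. _ * c"] cong: if_cong)
    finally show ?thesis using ij by (auto simp: on)
  qed
  have "y = (\<Sum>a\<in>S. scaleC (counit H a) (x a))"
    using cou[of y] by (simp add: S(2) sw_sum_ctens[OF cbalanced_scaled[OF \<epsilon>]])
  also have "\<dots> \<in> W"
    by (intro csubspace_sum[OF W] complex_vector.subspace_scale[OF W] xW)
  finally have "y \<in> W" .
  from that[of n e u, OF on \<delta>e \<Delta>u \<epsilon>u expand[OF this]] show ?thesis .
qed


section \<open>The Haar state\<close>

definition unitary_corep :: "('a::complex_algebra_1) cqg_data \<Rightarrow> nat \<Rightarrow> (nat \<Rightarrow> nat \<Rightarrow> 'a) \<Rightarrow> bool" where
  "unitary_corep H n u \<longleftrightarrow> (\<forall>i<n. \<forall>j<n. comult H (u i j) = (\<Sum>k<n. ctens (u i k) (u k j))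
     \<and> counit H (u i j) = of_bool (i = j)
     \<and> (\<Sum>k<n. u i k * hstar H (u j k)) = of_bool (i = j)
     \<and> (\<Sum>k<n. hstar H (u k i) * u k j) = of_bool (i = j))"

context hopf_star_algebra
begin

lemma star_add: "hstar H (x + y) = hstar H x + hstar H y"
  and star_scaleC: "hstar H (scaleC c x) = scaleC (cnj c) (hstar H x)"
  and star_star [simp]: "hstar H (hstar H x) = x"
  and star_mult: "hstar H (x * y) = hstar H y * hstar H x"
  using star by (auto simp: star_structure_def conj_linear_def)

lemma star_0 [simp]: "hstar H 0 = 0"
  using star_add[of 0 0] by simp

lemma star_one [simp]: "hstar H 1 = 1"
  using star_mult[of "hstar H 1" 1] by simp

lemma star_diff: "hstar H (x - y) = hstar H x - hstar H y"
  using star_add[of "x - y" y] by simp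

lemma star_conj_linear: "conj_linear (hstar H)"
  using star by (simp add: star_structure_def)

lemmas star_sum = conj_linear_sum[OF star_conj_linear]

lemma counit_linear: "clinear (counit H)" and counit_one: "counit H 1 = 1"
  and counit_mult: "counit H (x * y) = counit H x * counit H y"
  using counit_alg_hom by (auto simp: alg_hom_def)

lemma comult_comodule: "left_comodule H (comult H)"
  unfolding left_comodule_def using comult_linear coassoc counit_left by auto

lemma comult_mult_sum:
  assumes "comult H x = (\<Sum>i\<in>I. ctens (a i) (b i))" "comult H y = (\<Sum>j\<in>J. ctens (c j) (d j))"
  shows "comult H (x * y) = (\<Sum>i\<in>I. \<Sum>j\<in>J. ctens (a i * c j) (b i * d j))"
  unfolding comult_mult assms
  by (rule ctzip_sum[where s = "\<lambda>c. c"])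
    (auto simp: biadditive_def distrib_left distrib_right mult_scaleC_left mult_scaleC_right)

lemma comult_star_sum:
  assumes "comult H x = (\<Sum>i\<in>I. ctens (a i) (b i))"
  shows "comult H (hstar H x) = (\<Sum>i\<in>I. ctens (hstar H (a i)) (hstar H (b i)))"
  unfolding comult_star assms by (rule ctmap_sum_conj[OF star_conj_linear star_conj_linear])

lemma antipode_left_sum:
  assumes "comult H x = (\<Sum>i\<in>I. ctens (a i) (b i))"
  shows "(\<Sum>i\<in>I. antipode H (a i) * b i) = scaleC (counit H x) 1"
proof -
  have "cbalanced (\<lambda>x y. antipode H x * y)"
    by (rule cbalancedI) (simp_all add: clinear_simps[OF antipode_linear] algebra_simps
        mult_scaleC_left mult_scaleC_right)
  from sw_sum_ctens[OF this, of a b I] show ?thesis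
    using antipode_left[of x] by (simp add: assms)
qed

lemma counit_right_sum:
  assumes "comult H x = (\<Sum>i\<in>I. ctens (a i) (b i))"
  shows "x = (\<Sum>i\<in>I. scaleC (counit H (b i)) (a i))"
  using counit_right[of x] by (simp add: assms sw_sum_ctens[OF cbalanced_scaled'[OF counit_linear]])

lemma counit_left_sum:
  assumes "comult H x = (\<Sum>i\<in>I. ctens (a i) (b i))"
  shows "x = (\<Sum>i\<in>I. scaleC (counit H (a i)) (b i))"
  using counit_left[of x] by (simp add: assms sw_sum_ctens[OF cbalanced_scaled[OF counit_linear]])

end

context cqga
begin

lemma haar_right_sum:
  assumes "comult H x = (\<Sum>i\<in>I. ctens (a i) (b i))"
  shows "(\<Sum>i\<in>I. scaleC (haar H (b i)) (a i)) = scaleC (haar H x) 1"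
  using haar_right[of x] by (simp add: assms sw_sum_ctens[OF cbalanced_scaled'[OF haar_linear]])

lemma haar_left_sum:
  assumes "comult H x = (\<Sum>i\<in>I. ctens (a i) (b i))"
  shows "(\<Sum>i\<in>I. scaleC (haar H (a i)) (b i)) = scaleC (haar H x) 1"
  using haar_left[of x] by (simp add: assms sw_sum_ctens[OF cbalanced_scaled[OF haar_linear]])

text \<open>Strong left invariance \<open>a\<^sub>(\<^sub>1\<^sub>) h(c a\<^sub>(\<^sub>2\<^sub>)) = S(c\<^sub>(\<^sub>1\<^sub>)) h(c\<^sub>(\<^sub>2\<^sub>) a)\<close>: insert \<open>S(c\<^sub>(\<^sub>1\<^sub>)) c\<^sub>(\<^sub>2\<^sub>)\<close> in front of
  \<open>a\<^sub>(\<^sub>1\<^sub>)\<close> and use invariance on the product \<open>c\<^sub>(\<^sub>2\<^sub>) a\<close>.\<close>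

lemma haar_strong_invariance:
  assumes a: "comult H a = (\<Sum>t\<in>T. ctens (l t) (r t))"
  shows "(\<Sum>t\<in>T. scaleC (haar H (c * r t)) (l t)) = sw (\<lambda>p q. scaleC (haar H (q * a)) (antipode H p)) (comult H c)"
proof -
  define G where "G p q s = (\<Sum>t\<in>T. scaleC (haar H (s * r t)) (antipode H p * q * l t))" for p q s
  have G: "ctrilinear G"
    unfolding G_def
    by (rule ctrilinearI) (simp_all add: clinear_simps[OF antipode_linear] clinear_simps[OF haar_linear]
        distrib_right distrib_left scaleC_add_left scaleC_add_right sum.distrib mult_scaleC_left
        mult_scaleC_right scaleC_scaleC scaleC_complex_def mult.commute)
  note GB = G[unfolded ctrilinear_def, THEN conjunct1, rule_format] G[unfolded ctrilinear_def, THEN conjunct2, rule_format]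
  have left: "sw (G p) (comult H q) = scaleC (haar H (q * a)) (antipode H p)" for p q
  proof -
    obtain S x where S: "comult H q = (\<Sum>s\<in>S. ctens s (x s))" by (rule ctensor_sum_rep)
    have "sw (G p) (comult H q) = antipode H p * (\<Sum>s\<in>S. \<Sum>t\<in>T. scaleC (haar H (x s * r t)) (s * l t))"
      unfolding S sw_sum_ctens[OF GB(1)] G_def sum_distrib_left
      by (simp add: mult_scaleC_right mult.assoc)
    also have "\<dots> = antipode H p * scaleC (haar H (q * a)) 1"
      using haar_right_sum[of "q * a" "\<lambda>(s, t). s * l t" "\<lambda>(s, t). x s * r t" "S \<times> T"]
        comult_mult_sum[OF S a]
      by (simp add: sum.cartesian_product split_beta)
    finally show ?thesis by (simp add: mult_scaleC_right)
  qed
  have right: "sw (\<lambda>p q. G p q s) (comult H p) = scaleC (counit H p) (\<Sum>t\<in>T. scaleC (haar H (s * r t)) (l t))" for p s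
  proof -
    obtain S x where S: "comult H p = (\<Sum>s\<in>S. ctens s (x s))" by (rule ctensor_sum_rep)
    have "sw (\<lambda>p q. G p q s) (comult H p) = (\<Sum>t\<in>T. scaleC (haar H (s * r t)) ((\<Sum>a\<in>S. antipode H a * x a) * l t))"
      unfolding S sw_sum_ctens[OF GB(2)] unfolding G_def sum_distrib_right scaleC_sum_right by (rule sum.swap)
    then show ?thesis
      unfolding antipode_left_sum[OF S] by (simp add: scaleC_sum_right mult_scaleC_left scaleC_scaleC mult.commute)
  qed
  obtain S x where S: "comult H c = (\<Sum>s\<in>S. ctens s (x s))" by (rule ctensor_sum_rep)
  have "sw (\<lambda>p q. scaleC (haar H (q * a)) (antipode H p)) (comult H c)
      = sw (\<lambda>p s. scaleC (counit H p) (\<Sum>t\<in>T. scaleC (haar H (s * r t)) (l t))) (comult H c)"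
    using coassoc_eval[OF comult_comodule comult_linear G, of c] by (simp only: left right)
  also have "\<dots> = (\<Sum>p\<in>S. scaleC (counit H p) (\<Sum>t\<in>T. scaleC (haar H (x p * r t)) (l t)))"
    unfolding S
    by (rule sw_sum_ctens, rule cbalancedI)
      (simp_all add: clinear_simps[OF counit_linear] clinear_simps[OF haar_linear] scaleC_add_left
        scaleC_add_right sum.distrib distrib_right distrib_left scaleC_scaleC scaleC_sum_right
        mult_scaleC_left scaleC_complex_def mult_ac)
  also have "\<dots> = (\<Sum>t\<in>T. scaleC (haar H ((\<Sum>p\<in>S. scaleC (counit H p) (x p)) * r t)) (l t))"
    by (simp add: sum_distrib_right clinear_simps[OF haar_linear] mult_scaleC_left scaleC_complex_def
        scaleC_sum_left scaleC_sum_right scaleC_scaleC) (rule sum.swap)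
  finally show ?thesis
    using counit_left_sum[OF S] by simp
qed

lemma haar_psd: "psd_form (\<lambda>x y. haar H (hstar H x * y))"
  by (rule psd_formI) (auto simp: distrib_left distrib_right star_add star_scaleC mult_scaleC_left
      mult_scaleC_right clinear_simps[OF haar_linear] scaleC_complex_def haar_state)

text \<open>By strong invariance, what is annihilated by \<open>h(c \<cdot>)\<close> for all \<open>c\<close> in a left coideal \<open>K\<close> is itself a
  left coideal.\<close>

lemma haar_annihilator_coideal:
  assumes K: "\<And>c. c \<in> K \<Longrightarrow> \<exists>T z. comult H c = (\<Sum>t\<in>T. ctens t (z t)) \<and> (\<forall>t\<in>T. z t \<in> K)"
    and m: "\<And>c. c \<in> K \<Longrightarrow> haar H (c * m) = 0"
  obtains S x where "finite S" "comult H m = (\<Sum>s\<in>S. ctens s (x s))"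
    "\<And>s c. s \<in> S \<Longrightarrow> c \<in> K \<Longrightarrow> haar H (c * x s) = 0"
proof -
  obtain S x \<phi> where S: "finite S" "comult H m = (\<Sum>s\<in>S. ctens s (x s))"
    and \<phi>: "\<And>s. s \<in> S \<Longrightarrow> clinear (\<phi> s)" "\<And>s t. s \<in> S \<Longrightarrow> t \<in> S \<Longrightarrow> \<phi> s t = (of_bool (s = t) :: complex)"
    by (rule ctensor_independent_left_UNIV[of "comult H m"]) (rule that)
  have "haar H (c * x s) = 0" if s: "s \<in> S" and c: "c \<in> K" for c s
  proof -
    have Bal: "cbalanced (\<lambda>p q. scaleC (haar H (q * m)) (antipode H p))"
      by (rule cbalancedI) (simp_all add: distrib_right clinear_simps[OF haar_linear] clinear_simps[OF antipode_linear]
          scaleC_add_left scaleC_add_right mult_scaleC_left scaleC_complex_def scaleC_scaleC mult.commute)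
    obtain T z where T: "comult H c = (\<Sum>t\<in>T. ctens t (z t))" "\<forall>t\<in>T. z t \<in> K"
      using K[OF c] by blast
    have "(\<Sum>t\<in>S. scaleC (haar H (c * x t)) t) = 0"
      unfolding haar_strong_invariance[OF S(2)] T(1) sw_sum_ctens[OF Bal] using T(2) m by simp
    then have "\<phi> s (\<Sum>t\<in>S. scaleC (haar H (c * x t)) t) = 0"
      using clinear_0[OF \<phi>(1)[OF s]] by simp
    then show ?thesis
      using s S(1) by (simp add: clinear_simps[OF \<phi>(1)[OF s]] \<phi>(2) scaleC_complex_def of_bool_def
          if_distrib[of "\<lambda>c. _ * c"] cong: if_cong)
  qed
  with S that show ?thesis by blast
qed

text \<open>The null space of \<open>h\<close> is a left ideal and a left coideal.  On such a space
  \<open>\<epsilon>(a) 1 = S(a\<^sub>(\<^sub>1\<^sub>)) a\<^sub>(\<^sub>2\<^sub>)\<close> forces \<open>\<epsilon> = 0\<close>, hence \<open>a = a\<^sub>(\<^sub>1\<^sub>) \<epsilon>(a\<^sub>(\<^sub>2\<^sub>)) = 0\<close>.\<close>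

lemma haar_faithful:
  assumes "haar H (hstar H a * a) = 0"
  shows "a = 0"
proof -
  define R where "R = {a. \<forall>c. haar H (c * a) = 0}"
  have legs: "\<exists>S x. comult H a = (\<Sum>s\<in>S. ctens s (x s)) \<and> (\<forall>s\<in>S. x s \<in> R)" if a: "a \<in> R" for a
  proof (rule haar_annihilator_coideal[of UNIV a])
    show "\<exists>T z. comult H c = (\<Sum>t\<in>T. ctens t (z t)) \<and> (\<forall>t\<in>T. z t \<in> UNIV)" for c
      by (rule ctensor_sum_rep[of "comult H c"]) auto
    show "\<exists>S x. comult H a = (\<Sum>s\<in>S. ctens s (x s)) \<and> (\<forall>s\<in>S. x s \<in> R)"
      if "comult H a = (\<Sum>s\<in>S. ctens s (x s))" "\<And>s c. s \<in> S \<Longrightarrow> c \<in> UNIV \<Longrightarrow> haar H (c * x s) = 0" for S x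
      using that by (intro exI[of _ S] exI[of _ x]) (simp add: R_def)
  qed (use a in \<open>auto simp: R_def\<close>)
  have \<epsilon>: "counit H a = 0" if a: "a \<in> R" for a
  proof -
    from legs[OF a] obtain S x where S: "comult H a = (\<Sum>s\<in>S. ctens s (x s))" "\<And>s. s \<in> S \<Longrightarrow> x s \<in> R"
      by blast
    have "haar H (\<Sum>s\<in>S. antipode H s * x s) = 0"
      using S(2) by (simp add: clinear_sum[OF haar_linear] R_def)
    then show ?thesis
      by (simp add: antipode_left_sum[OF S(1)] clinear_simps[OF haar_linear] haar_one scaleC_complex_def)
  qed
  have "a \<in> R"
  proof -
    have "haar H (c * a) = 0" for c
      using psd_null[OF haar_psd assms, of "hstar H c"] by simp
    then show ?thesis by (simp add: R_def)
  qed
  from legs[OF this] obtain S x where S: "comult H a = (\<Sum>s\<in>S. ctens s (x s))" "\<And>s. s \<in> S \<Longrightarrow> x s \<in> R"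
    by blast
  show ?thesis
    using counit_right_sum[OF S(1)] S(2) by (simp add: \<epsilon>)
qed

text \<open>For left subcomodules of \<open>A\<close> this form, and not \<open>h(x\<^sup>* y)\<close>, leads to matrices with \<open>u u\<^sup>* = 1\<close>.\<close>

lemma haar_psd_right: "psd_form (\<lambda>x y. haar H (y * hstar H x))"
proof (rule psd_formI)
  show "haar H (x * hstar H x) \<in> nonneg_Reals" for x
    using haar_state[of "hstar H x"] by simp
qed (auto simp: distrib_left distrib_right star_add star_scaleC mult_scaleC_left
      mult_scaleC_right clinear_simps[OF haar_linear] scaleC_complex_def)

text \<open>Invariance of \<open>h\<close> makes the coefficient matrix of an orthonormal basis for \<open>h(y x\<^sup>*)\<close> satisfy
  \<open>u u\<^sup>* = 1\<close>; the antipode provides a left inverse, which is then \<open>u\<^sup>*\<close>.\<close>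

lemma unitary_coreps_span:
  obtains n u c where "unitary_corep H n u" "a = (\<Sum>i<n. \<Sum>j<n. scaleC (c i j) (u i j))"
proof -
  let ?\<kappa> = "\<lambda>x y. haar H (y * hstar H x)"
  have definite: "x = 0" if "?\<kappa> x x = 0" for x
    using haar_faithful[of "hstar H x"] that by (metis star_star star_0)
  obtain n :: nat and e u where on: "\<And>i j. i < n \<Longrightarrow> j < n \<Longrightarrow> ?\<kappa> (e i) (e j) = of_bool (i = j)"
    and \<Delta>e: "\<And>i. i < n \<Longrightarrow> comult H (e i) = (\<Sum>j<n. ctens (u i j) (e j))"
    and \<Delta>u: "\<And>i j. i < n \<Longrightarrow> j < n \<Longrightarrow> comult H (u i j) = (\<Sum>k<n. ctens (u i k) (u k j))"
    and \<epsilon>u: "\<And>i j. i < n \<Longrightarrow> j < n \<Longrightarrow> counit H (u i j) = of_bool (i = j)"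
    and a: "a = (\<Sum>i<n. scaleC (?\<kappa> (e i) a) (e i))"
    by (rule orthonormal_subcomodule[OF comult_comodule comult_linear counit_linear haar_psd_right, of a],
      erule definite, rule that)
  have U: "(\<Sum>k<n. u i k * hstar H (u j k)) = of_bool (i = j)" if ij: "i < n" "j < n" for i j
  proof -
    have \<Delta>: "comult H (e i * hstar H (e j))
        = (\<Sum>k<n. \<Sum>l<n. ctens (u i k * hstar H (u j l)) (e k * hstar H (e l)))"
      by (rule comult_mult_sum[OF \<Delta>e[OF ij(1)] comult_star_sum[OF \<Delta>e[OF ij(2)]]])
    have "(\<Sum>k<n. \<Sum>l<n. scaleC (haar H (e k * hstar H (e l))) (u i k * hstar H (u j l))) = scaleC (haar H (e i * hstar H (e j))) 1"
      using haar_right_sum[of "e i * hstar H (e j)" "\<lambda>(k, l). u i k * hstar H (u j l)"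
          "\<lambda>(k, l). e k * hstar H (e l)" "{..<n} \<times> {..<n}"] \<Delta>
      by (simp add: sum.cartesian_product split_beta)
    then show ?thesis
      using ij by (auto simp: on of_bool_def if_distrib[of "\<lambda>c. scaleC c _"] scaleC_one cong: if_cong)
  qed
  have S: "(\<Sum>k<n. antipode H (u i k) * u k j) = of_bool (i = j)" if "i < n" "j < n" for i j
    using antipode_left_sum[OF \<Delta>u[OF that]] \<epsilon>u[OF that] by (simp add: scaleC_one)
  have Sstar: "antipode H (u i j) = hstar H (u j i)" if ij: "i < n" "j < n" for i j
  proof -
    have "antipode H (u i j) = (\<Sum>l<n. antipode H (u i l) * (\<Sum>k<n. u l k * hstar H (u j k)))"
      using ij by (simp add: U of_bool_def if_distrib[of "\<lambda>c. _ * c"] cong: if_cong)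
    also have "\<dots> = (\<Sum>k<n. (\<Sum>l<n. antipode H (u i l) * u l k) * hstar H (u j k))"
      by (simp add: sum_distrib_left sum_distrib_right mult.assoc) (rule sum.swap)
    also have "\<dots> = hstar H (u j i)"
      using ij by (simp add: S of_bool_def if_distrib[of "\<lambda>c. c * _"] cong: if_cong)
    finally show ?thesis .
  qed
  have "unitary_corep H n u"
    unfolding unitary_corep_def using \<Delta>u \<epsilon>u U S by (auto simp: Sstar)
  moreover have "a = (\<Sum>i<n. \<Sum>j<n. scaleC (?\<kappa> (e i) a * counit H (e j)) (u i j))"
  proof -
    have "a = (\<Sum>i<n. scaleC (?\<kappa> (e i) a) (\<Sum>j<n. scaleC (counit H (e j)) (u i j)))"
      using a counit_right_sum[OF \<Delta>e] by (metis (no_types, lifting) lessThan_iff sum.cong)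
    then show ?thesis by (simp add: scaleC_sum_right scaleC_scaleC)
  qed
  ultimately show ?thesis by (rule that)
qed

abbreviation (input) hnorm2 :: "'a \<Rightarrow> real" where
  "hnorm2 x \<equiv> Re (haar H (hstar H x * x))"

lemma hnorm2_add: "hnorm2 (x + y) \<le> 2 * hnorm2 x + 2 * hnorm2 y"
proof -
  have "hnorm2 (x + y) + hnorm2 (x - y) = 2 * hnorm2 x + 2 * hnorm2 y"
    using star_add[of "x - y" y]
    by (simp add: star_add algebra_simps clinear_simps[OF haar_linear])
  then show ?thesis
    using psd_nonneg[OF haar_psd, of "x - y"] by simp
qed

text \<open>The constant depends on the number of summands only.\<close>

lemma hnorm2_sum:
  assumes "finite I"
  obtains K where "K \<ge> 0" "\<And>f. hnorm2 (\<Sum>i\<in>I. f i) \<le> K * (\<Sum>i\<in>I. hnorm2 (f i))"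
proof -
  have "\<exists>K\<ge>0. \<forall>f. hnorm2 (\<Sum>i\<in>I. f i) \<le> K * (\<Sum>i\<in>I. hnorm2 (f i))"
    using assms
  proof (induction I)
    case empty
    show ?case by (rule exI[of _ 0]) (auto simp: clinear_0[OF haar_linear])
  next
    case (insert i I)
    then obtain K where K: "K \<ge> 0" "\<And>f. hnorm2 (\<Sum>i\<in>I. f i) \<le> K * (\<Sum>i\<in>I. hnorm2 (f i))" by blast
    have "hnorm2 (\<Sum>i\<in>insert i I. f i) \<le> 2 * (K + 1) * (\<Sum>i\<in>insert i I. hnorm2 (f i))" for f
    proof -
      have nn: "0 \<le> hnorm2 (f i)" "0 \<le> (\<Sum>i\<in>I. hnorm2 (f i))"
        using psd_nonneg[OF haar_psd] by (auto intro: sum_nonneg)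
      have "hnorm2 (\<Sum>i\<in>insert i I. f i) \<le> 2 * hnorm2 (f i) + 2 * (K * (\<Sum>i\<in>I. hnorm2 (f i)))"
        using hnorm2_add[of "f i" "\<Sum>i\<in>I. f i"] K(2)[of f] insert by simp
      also have "\<dots> \<le> 2 * (K + 1) * (hnorm2 (f i) + (\<Sum>i\<in>I. hnorm2 (f i)))"
        using nn K(1) by (simp add: algebra_simps)
      finally show ?thesis using insert by simp
    qed
    then show ?case using K(1) by (intro exI[of _ "2 * (K + 1)"]) auto
  qed
  then show ?thesis using that by blast
qed

text \<open>Left multiplication by a coefficient of a unitary matrix is contractive because
  \<open>\<Sum>\<^sub>k u\<^sub>k\<^sub>i\<^sup>* u\<^sub>k\<^sub>i = 1\<close> is a sum of positive terms.\<close>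

lemma left_mult_bounded:
  obtains K where "K \<ge> 0" "\<And>x. hnorm2 (m * x) \<le> K * hnorm2 x"
proof -
  obtain n u c where u: "unitary_corep H n u" and m: "m = (\<Sum>i<n. \<Sum>j<n. scaleC (c i j) (u i j))"
    by (rule unitary_coreps_span)
  have contr: "hnorm2 (u i j * x) \<le> hnorm2 x" if ij: "i < n" "j < n" for i j x
  proof -
    have "(\<Sum>k<n. hstar H (u k j) * u k j) = 1"
      using u ij unfolding unitary_corep_def by (metis (full_types) of_bool_eq(2))
    then have "hstar H x * (\<Sum>k<n. hstar H (u k j) * u k j) * x = hstar H x * x" by simp
    then have "(\<Sum>k<n. hnorm2 (u k j * x)) = hnorm2 x"
      by (simp add: star_mult mult.assoc sum_distrib_left sum_distrib_right flip: clinear_sum[OF haar_linear] Re_sum)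
    moreover have "hnorm2 (u i j * x) \<le> (\<Sum>k<n. hnorm2 (u k j * x))"
      using psd_nonneg[OF haar_psd] ij by (intro member_le_sum) auto
    ultimately show ?thesis by simp
  qed
  obtain K where K: "K \<ge> 0" "\<And>f. hnorm2 (\<Sum>i\<in>{..<n} \<times> {..<n}. f i) \<le> K * (\<Sum>i\<in>{..<n} \<times> {..<n}. hnorm2 (f i))"
    using hnorm2_sum[of "{..<n} \<times> {..<n}"] by blast
  have "hnorm2 (m * x) \<le> (K * (\<Sum>(i, j)\<in>{..<n} \<times> {..<n}. (cmod (c i j))\<^sup>2)) * hnorm2 x" for x
  proof -
    have "m * x = (\<Sum>(i, j)\<in>{..<n} \<times> {..<n}. scaleC (c i j) (u i j * x))"
      unfolding m by (simp add: sum.cartesian_product[symmetric] sum_distrib_right mult_scaleC_left)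
    then have "hnorm2 (m * x) \<le> K * (\<Sum>(i, j)\<in>{..<n} \<times> {..<n}. hnorm2 (scaleC (c i j) (u i j * x)))"
      using K(2)[of "\<lambda>(i, j). scaleC (c i j) (u i j * x)"] by (simp add: split_beta)
    also have "\<dots> \<le> K * (\<Sum>(i, j)\<in>{..<n} \<times> {..<n}. (cmod (c i j))\<^sup>2 * hnorm2 x)"
    proof (intro mult_left_mono sum_mono K(1))
      fix p assume p: "p \<in> {..<n} \<times> {..<n}"
      obtain i j where [simp]: "p = (i, j)" by fastforce
      have "hnorm2 (scaleC (c i j) (u i j * x)) = (cmod (c i j))\<^sup>2 * hnorm2 (u i j * x)"
        by (simp add: star_scaleC mult_scaleC_left mult_scaleC_right clinear_simps[OF haar_linear]
            scaleC_complex_def scaleC_scaleC complex_norm_square[symmetric] mult.assoc[symmetric])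
      also have "\<dots> \<le> (cmod (c i j))\<^sup>2 * hnorm2 x"
        using p by (intro mult_left_mono contr) auto
      finally show "(case p of (i, j) \<Rightarrow> hnorm2 (scaleC (c i j) (u i j * x))) \<le> (case p of (i, j) \<Rightarrow> (cmod (c i j))\<^sup>2 * hnorm2 x)"
        by simp
    qed
    finally show ?thesis
      by (simp add: sum_distrib_right split_beta mult.assoc)
  qed
  moreover have "K * (\<Sum>(i, j)\<in>{..<n} \<times> {..<n}. (cmod (c i j))\<^sup>2) \<ge> 0"
    using K(1) by (intro mult_nonneg_nonneg sum_nonneg) auto
  ultimately show ?thesis using that by blast
qed

end


section \<open>The coideal subalgebra and its orthogonal complement\<close>

context cqga_homogeneous_space
begin

lemma incl_linear: "clinear (incl X)" and incl_one [simp]: "incl X 1 = 1"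
  and incl_mult: "incl X (x * y) = incl X x * incl X y"
  using incl_alg_hom by (auto simp: alg_hom_def)

lemmas incl_simps = clinear_simps[OF incl_linear] incl_mult

lemma incl_eq [simp]: "incl X x = incl X y \<longleftrightarrow> x = y"
  using incl_inj by (auto dest: injD)

lemma bstar_add: "bstar X (x + y) = bstar X x + bstar X y"
  and bstar_scaleC: "bstar X (scaleC c x) = scaleC (cnj c) (bstar X x)"
  and bstar_bstar [simp]: "bstar X (bstar X x) = x"
  and bstar_mult: "bstar X (x * y) = bstar X y * bstar X x"
  by (simp_all add: incl_eq[symmetric] incl_star incl_simps A.star_add A.star_scaleC A.star_mult del: incl_eq)

lemma bstar_0 [simp]: "bstar X 0 = 0"
  using bstar_add[of 0 0] by simp

lemma bstar_conj_linear: "conj_linear (bstar X)"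
  by (simp add: conj_linear_def bstar_add bstar_scaleC)

definition epsB :: "'b \<Rightarrow> complex" where
  "epsB b = counit (total X) (incl X b)"

lemma epsB_linear: "clinear epsB"
  unfolding epsB_def by (rule clinear_compose[OF A.counit_linear incl_linear])

lemma epsB_one [simp]: "epsB 1 = 1" and epsB_mult: "epsB (b * c) = epsB b * epsB c"
  and epsB_star: "epsB (bstar X b) = cnj (epsB b)"
  by (simp_all add: epsB_def A.counit_one A.counit_mult incl_mult incl_star A.counit_star)

lemma epsB_bplus: "b \<in> bplus X \<longleftrightarrow> epsB b = 0"
  by (simp add: bplus_def epsB_def)

lemma epsB_bpos: "b \<in> bpos (bstar X) \<Longrightarrow> epsB b \<in> nonneg_Reals"
proof -
  have "epsB (\<Sum>c\<leftarrow>cs. bstar X c * c) \<in> nonneg_Reals" for cs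
  proof (induction cs)
    case (Cons c cs)
    have "epsB (bstar X c * c) \<in> nonneg_Reals"
      by (simp add: epsB_mult epsB_star mult.commute[of "cnj _"] complex_norm_square[symmetric])
    with Cons show ?case by (simp add: clinear_simps[OF epsB_linear] nonneg_Reals_add_I)
  qed (simp add: clinear_0[OF epsB_linear])
  then show "b \<in> bpos (bstar X) \<Longrightarrow> epsB b \<in> nonneg_Reals"
    by (auto simp: bpos_def)
qed

lemma comult_incl:
  assumes "bcoact X b = (\<Sum>i\<in>I. ctens (a i) (c i))"
  shows "comult (total X) (incl X b) = (\<Sum>i\<in>I. ctens (a i) (incl X (c i)))"
  unfolding left_coideal[symmetric] assms ctmap_sum[OF clinear_ident incl_linear] by simp

lemma incl_counit:
  assumes "bcoact X b = (\<Sum>i\<in>I. ctens (a i) (c i))"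
  shows "incl X b = (\<Sum>i\<in>I. scaleC (epsB (c i)) (a i))"
  using A.counit_right_sum[OF comult_incl[OF assms]] by (simp add: epsB_def)

definition Bperp :: "'a set" where
  "Bperp = {m. \<forall>b. haar (total X) (hstar (total X) (incl X b) * m) = 0}"

lemma Bperp_subspace: "csubspace Bperp"
  by (auto simp: csubspace_iff Bperp_def distrib_left mult_scaleC_right clinear_simps[OF A.haar_linear])

text \<open>\<open>B\<close> meets its orthogonal complement in \<open>0\<close> because the Haar state is faithful.\<close>

lemma Bperp_incl: "incl X b \<in> Bperp \<Longrightarrow> b = 0"
  using A.haar_faithful[of "incl X b"] by (auto simp: Bperp_def clinear_0[OF incl_linear] incl_eq[symmetric] simp del: incl_eq)

lemma Bperp_incl_mult: "m \<in> Bperp \<Longrightarrow> incl X b * m \<in> Bperp"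
proof -
  assume "m \<in> Bperp"
  then have "haar (total X) (hstar (total X) (incl X (bstar X b * c)) * m) = 0" for c
    by (simp only: Bperp_def mem_Collect_eq)
  then show ?thesis
    by (simp add: Bperp_def incl_mult incl_star A.star_mult mult.assoc)
qed

text \<open>Orthogonal projection onto the span \<open>D\<close> of the coefficients of a unitary matrix is convolution
  with the element \<open>t\<close> of \<open>D\<close> that represents the counit: it is the map \<open>b \<mapsto> h(t\<^sup>* b\<^sub>(\<^sub>1\<^sub>)) b\<^sub>(\<^sub>2\<^sub>)\<close>,
  which preserves every left coideal, and \<open>B\<close> in particular.  Therefore orthogonality of an element
  of \<open>D\<close> to \<open>B\<close> is a condition on the finite-dimensional space \<open>B \<inter> D\<close> only.\<close>

lemma haar_decomposition:
  obtains b where "a - incl X b \<in> Bperp"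
proof -
  let ?h = "haar (total X)" and ?s = "hstar (total X)" and ?\<Delta> = "comult (total X)"
  let ?ip = "\<lambda>x y. ?h (?s x * y)"
  note psd = A.haar_psd
  obtain n v c where v: "unitary_corep (total X) n v" and a: "a = (\<Sum>i<n. \<Sum>j<n. scaleC (c i j) (v i j))"
    by (rule A.unitary_coreps_span)
  have \<Delta>v: "?\<Delta> (v i j) = (\<Sum>k<n. ctens (v i k) (v k j))"
    and \<epsilon>v: "counit (total X) (v i j) = of_bool (i = j)"
    and vv: "(\<Sum>k<n. v i k * ?s (v j k)) = of_bool (i = j)" if "i < n" "j < n" for i j
    using v that by (auto simp: unitary_corep_def)
  define V where "V = (\<lambda>(i, j). v i j) ` ({..<n} \<times> {..<n})"
  define D where "D = complex_vector.span V"
  have D: "csubspace D" and vD: "\<And>i j. i < n \<Longrightarrow> j < n \<Longrightarrow> v i j \<in> D"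
    unfolding D_def V_def by (auto intro!: complex_vector.span_base)
  have aD: "a \<in> D"
    unfolding a by (intro csubspace_sum[OF D] complex_vector.subspace_scale[OF D] vD) auto
  have expand: "w = (\<Sum>i<m. scaleC (?ip (e i) w) (e i))"
    if sp: "\<And>w z. w \<in> W \<Longrightarrow> ?ip z w = (\<Sum>i<m. ?ip (e i) w * ?ip z (e i))" and "w \<in> W" for w W e and m :: nat
  proof -
    let ?r = "w - (\<Sum>i<m. scaleC (?ip (e i) w) (e i))"
    have "?ip ?r ?r = 0"
      using sp[OF that(2), of ?r] by (simp add: clinear_simps[OF psd_clinear[OF psd]] scaleC_complex_def)
    from A.haar_faithful[OF this] show ?thesis by simp
  qed
  obtain m :: nat and d where dD: "\<And>i. i < m \<Longrightarrow> d i \<in> D"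
    and don: "\<And>i j. i < m \<Longrightarrow> j < m \<Longrightarrow> ?ip (d i) (d j) = of_bool (i = j)"
    and dsp: "\<And>w z. w \<in> D \<Longrightarrow> ?ip z w = (\<Sum>i<m. ?ip (d i) w * ?ip z (d i))"
    using orthonormal_spanning[OF psd, of V] unfolding D_def V_def by blast
  (* t represents the counit on D. *)
  define t where "t = (\<Sum>i<m. scaleC (cnj (counit (total X) (d i))) (d i))"
  have tD: "t \<in> D"
    unfolding t_def by (intro csubspace_sum[OF D] complex_vector.subspace_scale[OF D] dD) auto
  have t: "?ip t w = counit (total X) w" if "w \<in> D" for w
  proof -
    have "?ip t w = (\<Sum>i<m. counit (total X) (d i) * ?ip (d i) w)"
      unfolding t_def
      by (simp add: A.star_sum A.star_scaleC sum_distrib_right mult_scaleC_left clinear_simps[OF A.haar_linear] scaleC_complex_def)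
    also have "\<dots> = counit (total X) (\<Sum>i<m. scaleC (?ip (d i) w) (d i))"
      by (simp add: clinear_simps[OF A.counit_linear] scaleC_complex_def mult.commute)
    finally show ?thesis using expand[OF dsp that] by simp
  qed
  define conv where "conv s b = sw (\<lambda>x y. scaleC (?ip s x) y) (?\<Delta> b)" for s b
  note Bc = cbalanced_scaled[OF psd_clinear[OF psd]]
  have conv_lin: "clinear (conv s)" for s
    unfolding conv_def clinear_iff clinear_simps[OF A.comult_linear]
    by (simp add: sw_add[OF Bc] sw_scaleC[OF Bc] scaleC_scaleC psd_scale_right[OF psd] mult.commute)
  have conv_sum: "conv s b = (\<Sum>i\<in>I. scaleC (?ip s (x i)) (y i))" if "?\<Delta> b = (\<Sum>i\<in>I. ctens (x i) (y i))" for s b I x y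
    unfolding conv_def that by (rule sw_sum_ctens[OF Bc])
  have conv_D: "conv t w = w" if "w \<in> D" for w
  proof -
    have "conv t (v i j) = v i j" if "i < n" "j < n" for i j
      using that vD by (simp add: conv_sum[OF \<Delta>v[OF that]] t \<epsilon>v of_bool_def if_distrib[of "\<lambda>c. scaleC c _"]
          scaleC_one cong: if_cong)
    moreover have "csubspace {w. conv t w = w}"
      by (auto simp: csubspace_iff clinear_simps[OF conv_lin])
    ultimately have "D \<subseteq> {w. conv t w = w}"
      unfolding D_def V_def by (intro complex_vector.span_minimal) auto
    with that show ?thesis by auto
  qed
  (* Convolution with a coefficient v i l only involves the inner products of w with the coefficients v i j,
     by invariance of the Haar functional on v^* w and unitarity. *)
  have conv_perp: "conv s w = 0" if s: "s \<in> D" and w: "\<And>z. z \<in> D \<Longrightarrow> ?ip z w = 0" for s w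
  proof -
    have "conv (v i l) w = 0" if il: "i < n" "l < n" for i l
    proof -
      obtain S x where S: "?\<Delta> w = (\<Sum>s\<in>S. ctens s (x s))" by (rule ctensor_sum_rep)
      have inv: "(\<Sum>k<n. \<Sum>s\<in>S. scaleC (?ip (v i k) s) (?s (v k j) * x s)) = 0" if j: "j < n" for j
        using A.haar_left_sum[of "?s (v i j) * w" "\<lambda>(k, s). ?s (v i k) * s" "\<lambda>(k, s). ?s (v k j) * x s" "{..<n} \<times> S"]
          A.comult_mult_sum[OF A.comult_star_sum[OF \<Delta>v[OF il(1) j]] S] w[OF vD[OF il(1) j]]
        by (simp add: sum.cartesian_product split_beta)
      have "conv (v i l) w = (\<Sum>k<n. of_bool (l = k) * conv (v i k) w)"
        using il by (simp add: of_bool_def if_distrib[of "\<lambda>c. c * _"] cong: if_cong)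
      also have "\<dots> = (\<Sum>k<n. (\<Sum>j<n. v l j * ?s (v k j)) * conv (v i k) w)"
        using il by (intro sum.cong refl) (simp add: vv)
      also have "\<dots> = (\<Sum>k<n. \<Sum>j<n. v l j * (\<Sum>s\<in>S. scaleC (?ip (v i k) s) (?s (v k j) * x s)))"
        by (simp add: conv_sum[OF S] sum_distrib_left sum_distrib_right mult_scaleC_right mult.assoc scaleC_sum_right) (rule sum.cong[OF refl], rule sum.swap)
      also have "\<dots> = (\<Sum>j<n. v l j * (\<Sum>k<n. \<Sum>s\<in>S. scaleC (?ip (v i k) s) (?s (v k j) * x s)))"
        by (subst sum.swap) (simp only: sum_distrib_left)
      also have "\<dots> = 0" by (simp add: inv)
      finally show ?thesis .
    qed
    moreover have "csubspace {s. conv s w = 0}"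
    proof -
      obtain S x where S: "?\<Delta> w = (\<Sum>s\<in>S. ctens s (x s))" by (rule ctensor_sum_rep)
      have "conv (s + s') w = conv s w + conv s' w" "conv (scaleC c s) w = scaleC (cnj c) (conv s w)" for s s' c
        by (simp_all add: conv_sum[OF S] A.star_add A.star_scaleC distrib_right mult_scaleC_left
          clinear_simps[OF A.haar_linear] scaleC_add_left sum.distrib scaleC_complex_def scaleC_sum_right
          scaleC_scaleC)
      moreover have "conv 0 w = 0"
        by (simp add: conv_sum[OF S] clinear_0[OF A.haar_linear])
      ultimately show ?thesis
        by (simp add: csubspace_iff)
    qed
    ultimately have "D \<subseteq> {s. conv s w = 0}"
      unfolding D_def V_def by (intro complex_vector.span_minimal) auto
    with s show ?thesis by auto
  qed
  define P where "P b = (\<Sum>i<m. scaleC (?ip (d i) b) (d i))" for b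
  have PD: "P b \<in> D" for b
    unfolding P_def by (intro csubspace_sum[OF D] complex_vector.subspace_scale[OF D] dD) auto
  have P_perp: "?ip z (b - P b) = 0" if "z \<in> D" for z b
  proof -
    have di: "?ip (d i) (b - P b) = 0" if "i < m" for i
      using that by (simp add: P_def clinear_simps[OF psd_clinear[OF psd]] don scaleC_complex_def of_bool_def
          if_distrib[of "\<lambda>c. _ * c"] cong: if_cong)
    have "?ip (b - P b) z = 0"
      using dsp[OF that, of "b - P b"] di psd_sym[OF psd, of "b - P b" "d _"] by simp
    then show ?thesis using psd_sym[OF psd, of z "b - P b"] by simp
  qed
  (* Convolution with t fixes D and kills its complement, so it computes P; it preserves B. *)
  have PB: "P (incl X b) \<in> range (incl X)" for b
  proof -
    have "conv t (incl X b - P (incl X b)) = 0"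
      by (rule conv_perp[OF tD P_perp])
    then have "P (incl X b) = conv t (incl X b)"
      using conv_D[OF PD] by (simp add: clinear_diff[OF conv_lin])
    moreover obtain S x where S: "bcoact X b = (\<Sum>s\<in>S. ctens s (x s))" by (rule ctensor_sum_rep)
    ultimately have "P (incl X b) = incl X (\<Sum>s\<in>S. scaleC (?ip t s) (x s))"
      using conv_sum[OF comult_incl[OF S]] by (simp add: clinear_simps[OF incl_linear])
    then show ?thesis by simp
  qed
  define Y where "Y = D \<inter> range (incl X)"
  have Y: "csubspace Y"
    using D by (auto simp: Y_def csubspace_iff clinear_simps[OF incl_linear, symmetric])
  obtain Z where Z: "Z \<subseteq> Y" "complex_vector.independent Z" "Y \<subseteq> complex_vector.span Z"
    using complex_vector.maximal_independent_subset[of Y] by blast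
  have "finite Z"
    using complex_vector.independent_span_bound[of V Z] Z unfolding Y_def D_def V_def by auto
  have spZ: "complex_vector.span Z = Y"
    using Z Y complex_vector.span_minimal[of Z Y] by auto
  obtain l :: nat and y where yY: "\<And>i. i < l \<Longrightarrow> y i \<in> Y"
    and yon: "\<And>i j. i < l \<Longrightarrow> j < l \<Longrightarrow> ?ip (y i) (y j) = of_bool (i = j)"
    and ysp: "\<And>w z. w \<in> Y \<Longrightarrow> ?ip z w = (\<Sum>i<l. ?ip (y i) w * ?ip z (y i))"
    using orthonormal_spanning[OF psd \<open>finite Z\<close>] unfolding spZ by blast
  (* q is the projection of a onto Y; that a - q is orthogonal to all of B follows by splitting b
     into its component in D, which lies in Y, and a component orthogonal to D. *)
  define q where "q = (\<Sum>i<l. scaleC (?ip (y i) a) (y i))"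
  have qY: "q \<in> Y"
    unfolding q_def by (intro csubspace_sum[OF Y] complex_vector.subspace_scale[OF Y] yY) auto
  have q_perp: "?ip z (a - q) = 0" if "z \<in> Y" for z
  proof -
    have yi: "?ip (y i) (a - q) = 0" if "i < l" for i
      using that by (simp add: q_def clinear_simps[OF psd_clinear[OF psd]] yon scaleC_complex_def of_bool_def
          if_distrib[of "\<lambda>c. _ * c"] cong: if_cong)
    have "?ip (a - q) z = 0"
      using ysp[OF that, of "a - q"] yi psd_sym[OF psd, of "a - q" "y _"] by simp
    then show ?thesis using psd_sym[OF psd, of z "a - q"] by simp
  qed
  have "a - q \<in> D"
    using aD qY D by (auto simp: Y_def csubspace_diff)
  have "?ip (incl X b) (a - q) = 0" for b
  proof -
    have "?ip (a - q) (incl X b - P (incl X b)) = 0"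
      by (rule P_perp[OF \<open>a - q \<in> D\<close>])
    then have "?ip (incl X b - P (incl X b)) (a - q) = 0"
      using psd_sym[OF psd, of "incl X b - P (incl X b)" "a - q"] by simp
    moreover have "?ip (P (incl X b)) (a - q) = 0"
      using PD PB by (intro q_perp) (auto simp: Y_def)
    ultimately show ?thesis
      using psd_diff_left[OF psd, of "incl X b" "P (incl X b)" "a - q"] by simp
  qed
  moreover obtain b where "q = incl X b" using qY by (auto simp: Y_def)
  ultimately show ?thesis using that[of b] by (auto simp: Bperp_def)
qed

lemma Bperp_coideal:
  assumes m: "m \<in> Bperp"
  obtains S x where "finite S" "comult (total X) m = (\<Sum>s\<in>S. ctens s (x s))" "\<And>s. s \<in> S \<Longrightarrow> x s \<in> Bperp"
proof -
  have K: "\<exists>T z. comult (total X) c = (\<Sum>t\<in>T. ctens t (z t)) \<and> (\<forall>t\<in>T. z t \<in> range (incl X))"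
    if c: "c \<in> range (incl X)" for c
  proof -
    obtain b where b: "c = incl X b" using c by blast
    obtain T y where T: "bcoact X b = (\<Sum>t\<in>T. ctens t (y t))" by (rule ctensor_sum_rep)
    show ?thesis
      unfolding b using comult_incl[OF T] by (intro exI[of _ T] exI[of _ "\<lambda>t. incl X (y t)"]) simp
  qed
  have "haar (total X) (c * m) = 0" if c: "c \<in> range (incl X)" for c
  proof -
    obtain b where "c = hstar (total X) (incl X (bstar X b))" using c by (auto simp: incl_star)
    then show ?thesis using m by (simp add: Bperp_def)
  qed
  from A.haar_annihilator_coideal[OF K this] obtain S x where S: "finite S"
      "comult (total X) m = (\<Sum>s\<in>S. ctens s (x s))"
      "\<And>s c. s \<in> S \<Longrightarrow> c \<in> range (incl X) \<Longrightarrow> haar (total X) (c * x s) = 0" by metis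
  have "x s \<in> Bperp" if "s \<in> S" for s
    using S(3)[OF that] by (simp add: Bperp_def flip: incl_star)
  with S(1,2) show ?thesis by (rule that)
qed

text \<open>The functional \<open>\<phi>\<close> is the counit composed with the orthogonal projection onto \<open>B\<close>.  That
  \<open>z\<^sub>(\<^sub>1\<^sub>) \<phi>(z\<^sub>(\<^sub>2\<^sub>))\<close> is this projection of \<open>z\<close> gives a criterion for membership in \<open>B\<close>.\<close>

lemma projection_counit:
  obtains \<phi> where "clinear \<phi>" "\<phi> 1 = (1 :: complex)"
    "\<And>a b c. \<phi> (a * incl X b * c) = epsB b * \<phi> (a * c)"
    "\<And>z. sw (\<lambda>x y. scaleC (\<phi> y) x) (comult (total X) z) \<in> range (incl X)"
proof -
  define E where "E a = (SOME b. a - incl X b \<in> Bperp)" for a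
  have E: "a - incl X (E a) \<in> Bperp" for a
    unfolding E_def by (rule someI_ex) (meson haar_decomposition)
  have E_unique: "E a = b" if "a - incl X b \<in> Bperp" for a b
  proof -
    have "incl X (E a - b) \<in> Bperp"
      using csubspace_diff[OF Bperp_subspace that E[of a]] by (simp add: clinear_diff[OF incl_linear])
    then show ?thesis using Bperp_incl by fastforce
  qed
  note sub = Bperp_subspace[unfolded csubspace_iff]
  have Elin: "clinear E"
  proof (unfold clinear_iff, intro conjI allI)
    show "E (x + y) = E x + E y" for x y
      using E[of x] E[of y] sub by (intro E_unique) (simp add: incl_simps add_diff_add)
    show "E (scaleC c x) = scaleC c (E x)" for c x
      using E[of x] sub by (intro E_unique) (simp add: incl_simps complex_vector.scale_right_diff_distrib[symmetric])
  qed
  define \<phi> where "\<phi> a = epsB (E a)" for a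
  have \<phi>lin: "clinear \<phi>"
    unfolding \<phi>_def by (rule clinear_compose[OF epsB_linear Elin])
  have E_incl: "E (incl X b) = b" for b
    using sub by (intro E_unique) simp
  have \<phi>_left: "\<phi> (incl X b * a) = epsB b * \<phi> a" for a b
  proof -
    have "E (incl X b * a) = b * E a"
      using Bperp_incl_mult[OF E[of a], of b] by (intro E_unique) (simp add: right_diff_distrib incl_mult)
    then show ?thesis by (simp add: \<phi>_def epsB_mult)
  qed
  (* A B^+ A = B^+ A, and E is left B-linear. *)
  have \<phi>_zero: "\<phi> (a * incl X b * c) = 0" if b: "b \<in> bplus X" for a b c
  proof -
    have "a * incl X b \<in> add_span {incl X b * a | a b. b \<in> bplus X}"
      unfolding bplus_commute by (rule hull_inc) (use b in blast)
    also have "\<dots> \<subseteq> {z. \<forall>c. \<phi> (z * c) = 0}"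
    proof (rule add_span_subset)
      show "add_subgroup {z. \<forall>c. \<phi> (z * c) = 0}"
        by (simp add: add_subgroup_def left_diff_distrib clinear_simps[OF \<phi>lin])
    qed (auto simp: mult.assoc \<phi>_left epsB_bplus)
    finally show ?thesis by blast
  qed
  have mid: "\<phi> (a * incl X b * c) = epsB b * \<phi> (a * c)" for a b c
  proof -
    have "b - scaleC (epsB b) 1 \<in> bplus X"
      by (simp add: epsB_bplus clinear_simps[OF epsB_linear] scaleC_complex_def)
    from \<phi>_zero[OF this, of a c] show ?thesis
      by (simp add: incl_simps right_diff_distrib left_diff_distrib mult_scaleC_left mult_scaleC_right
          clinear_simps[OF \<phi>lin] scaleC_complex_def)
  qed
  have range: "sw (\<lambda>x y. scaleC (\<phi> y) x) (comult (total X) z) \<in> range (incl X)" for z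
  proof -
    note Bal = cbalanced_scaled'[OF \<phi>lin]
    obtain S x where S: "comult (total X) (z - incl X (E z)) = (\<Sum>s\<in>S. ctens s (x s))"
        "\<And>s. s \<in> S \<Longrightarrow> x s \<in> Bperp"
      using Bperp_coideal[OF E] by metis
    have "\<phi> m = 0" if "m \<in> Bperp" for m
      using E_unique[of m 0] that by (simp add: \<phi>_def clinear_0[OF incl_linear] clinear_0[OF epsB_linear])
    then have "sw (\<lambda>x y. scaleC (\<phi> y) x) (comult (total X) (z - incl X (E z))) = 0"
      unfolding S(1) sw_sum_ctens[OF Bal] using S(2) by simp
    moreover obtain T y where T: "bcoact X (E z) = (\<Sum>t\<in>T. ctens t (y t))" by (rule ctensor_sum_rep)
    have "sw (\<lambda>x y. scaleC (\<phi> y) x) (comult (total X) (incl X (E z))) = incl X (E z)"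
      unfolding comult_incl[OF T] sw_sum_ctens[OF Bal] using incl_counit[OF T]
      by (simp add: \<phi>_def E_incl)
    ultimately show ?thesis
      by (simp add: clinear_diff[OF A.comult_linear] sw_diff[OF Bal])
  qed
  show ?thesis
    using E_incl[of 1] by (intro that[of \<phi>, OF \<phi>lin _ mid range]) (simp add: \<phi>_def)
qed

text \<open>\<open>B\<close> is stable under the adjoint action of \<open>A\<close>: modulo \<open>A B\<^sup>+ A = B\<^sup>+ A\<close> the coproduct of the
  element below is the element tensor \<open>1\<close>.\<close>

lemma adjoint_action_coideal:
  assumes \<Delta>u: "\<And>i j. i < n \<Longrightarrow> j < n \<Longrightarrow> comult (total X) (u i j) = (\<Sum>k<n. ctens (u i k) (u k j))"
    and inv: "\<And>i k. i < n \<Longrightarrow> k < n \<Longrightarrow> (\<Sum>j<n. hstar (total X) (u i j) * u k j) = of_bool (i = k)"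
    and ik: "i < n" "k < n"
  shows "(\<Sum>j<(n::nat). hstar (total X) (u k j) * incl X c * u i j) \<in> range (incl X)" (is "?z \<in> _")
proof -
  let ?s = "hstar (total X)"
  obtain \<phi> where \<phi>: "clinear \<phi>" "\<phi> 1 = (1 :: complex)" and mid: "\<And>a b c. \<phi> (a * incl X b * c) = epsB b * \<phi> (a * c)"
    and range: "\<And>z. sw (\<lambda>x y. scaleC (\<phi> y) x) (comult (total X) z) \<in> range (incl X)"
    by (rule projection_counit) (rule that)
  note Bal = cbalanced_scaled'[OF \<phi>(1)]
  obtain T y where T: "bcoact X c = (\<Sum>t\<in>T. ctens t (y t))" by (rule ctensor_sum_rep)
  have \<Delta>: "comult (total X) (?s (u k j) * incl X c * u i j)
      = (\<Sum>(l, t)\<in>{..<n} \<times> T. \<Sum>m<n. ctens (?s (u k l) * t * u i m) (?s (u l j) * incl X (y t) * u m j))" if j: "j < n" for j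
  proof -
    have "comult (total X) (?s (u k j) * incl X c)
      = (\<Sum>p\<in>{..<n} \<times> T. ctens (?s (u k (fst p)) * snd p) (?s (u (fst p) j) * incl X (y (snd p))))"
      using A.comult_mult_sum[OF A.comult_star_sum[OF \<Delta>u[OF ik(2) j]] comult_incl[OF T]]
      by (simp add: sum.cartesian_product split_beta)
    from A.comult_mult_sum[OF this \<Delta>u[OF ik(1) j]] show ?thesis
      by (simp add: split_beta)
  qed
  have "sw (\<lambda>x y. scaleC (\<phi> y) x) (comult (total X) ?z)
      = (\<Sum>j<n. \<Sum>(l, t)\<in>{..<n} \<times> T. \<Sum>m<n. scaleC (\<phi> (?s (u l j) * incl X (y t) * u m j)) (?s (u k l) * t * u i m))"
    by (simp add: clinear_sum[OF A.comult_linear] \<Delta> sw_sum[OF Bal] sw_ctens[OF Bal] split_beta)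
  also have "\<dots> = (\<Sum>(l, t)\<in>{..<n} \<times> T. \<Sum>m<n. \<Sum>j<n. scaleC (\<phi> (?s (u l j) * incl X (y t) * u m j)) (?s (u k l) * t * u i m))"
    unfolding split_beta by (subst sum.swap, rule sum.cong[OF refl], rule sum.swap)
  also have "\<dots> = (\<Sum>(l, t)\<in>{..<n} \<times> T. \<Sum>m<n. scaleC (epsB (y t) * \<phi> (\<Sum>j<n. ?s (u l j) * u m j)) (?s (u k l) * t * u i m))"
    by (simp add: mid clinear_sum[OF \<phi>(1)] sum_distrib_left scaleC_sum_left)
  also have "\<dots> = (\<Sum>(l, t)\<in>{..<n} \<times> T. scaleC (epsB (y t)) (?s (u k l) * t * u i l))"
  proof (intro sum.cong refl, clarsimp)
    fix l t assume l: "l < n"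
    have "(\<Sum>m<n. scaleC (epsB (y t) * \<phi> (\<Sum>j<n. ?s (u l j) * u m j)) (?s (u k l) * t * u i m))
        = (\<Sum>m<n. if l = m then scaleC (epsB (y t)) (?s (u k l) * t * u i m) else 0)"
      using l by (intro sum.cong refl) (simp add: inv \<phi> clinear_0[OF \<phi>(1)])
    then show "(\<Sum>m<n. scaleC (epsB (y t) * \<phi> (\<Sum>j<n. ?s (u l j) * u m j)) (?s (u k l) * t * u i m))
        = scaleC (epsB (y t)) (?s (u k l) * t * u i l)"
      using l by simp
  qed
  also have "\<dots> = ?z"
    unfolding incl_counit[OF T] sum.cartesian_product[symmetric]
    by (simp add: sum_distrib_left sum_distrib_right mult_scaleC_left mult_scaleC_right)
  finally have "sw (\<lambda>x y. scaleC (\<phi> y) x) (comult (total X) ?z) = ?z" .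
  with range[of ?z] show ?thesis by (simp only:)
qed

end


section \<open>Relative Hopf modules\<close>

context mod0_object
begin

lemma lact_biadditive: "biadditive lact" and ract_biadditive: "biadditive ract"
  and lact_mult: "lact (b * c) f = lact b (lact c f)" and ract_mult: "ract f (b * c) = ract (ract f b) c"
  and lact_ract: "lact b (ract f c) = ract (lact b f) c"
  and lact_scalar: "lact (scaleC k 1) f = scaleC k f" and ract_scalar: "ract f (scaleC k 1) = scaleC k f"
  using bimodule by (auto simp: bimodule_def)

lemma lact_one: "lact 1 f = f"
  using lact_scalar[of 1 f] by (simp add: scaleC_one)

lemma lact_scaleC_left: "lact (scaleC k b) f = scaleC k (lact b f)"
  using lact_mult[of "scaleC k 1" b f] by (simp add: lact_scalar mult_scaleC_left)

lemma lact_scaleC_right: "lact b (scaleC k f) = scaleC k (lact b f)"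
  using lact_mult[of b "scaleC k 1" f] by (simp add: lact_one mult_scaleC_right lact_scaleC_left)

lemma ract_scaleC: "ract (scaleC k f) b = scaleC k (ract f b)"
  using ract_mult[of f "scaleC k 1" b] ract_mult[of f b "scaleC k 1"]
  by (simp add: ract_scalar mult_scaleC_left mult_scaleC_right)

lemma coact_comodule: "left_comodule (total X) coact"
  unfolding left_comodule_def using coact_linear coact_coassoc coact_counit by auto

lemma coact_counit_sum:
  assumes "coact f = (\<Sum>i\<in>I. ctens (a i) (x i))"
  shows "f = (\<Sum>i\<in>I. scaleC (counit (total X) (a i)) (x i))"
  using coact_counit[of f] by (simp add: assms sw_sum_ctens[OF cbalanced_scaled[OF A.counit_linear]])

lemma coact_lact_sum:
  assumes "bcoact X b = (\<Sum>i\<in>I. ctens (a i) (c i))" "coact f = (\<Sum>j\<in>J. ctens (d j) (x j))"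
  shows "coact (lact b f) = (\<Sum>i\<in>I. \<Sum>j\<in>J. ctens (a i * d j) (lact (c i) (x j)))"
  unfolding coact_lact assms
  by (rule ctzip_sum[where s = "\<lambda>c. c"])
    (auto simp: biadditive_def distrib_left distrib_right mult_scaleC_left mult_scaleC_right
      lact_scaleC_left lact_scaleC_right biadditive_left[OF lact_biadditive] biadditive_right[OF lact_biadditive])

abbreviation BplusF where
  "BplusF \<equiv> add_span {lact c e | c e. c \<in> bplus X}"

text \<open>Apply the counit to the formula that characterises the right action.\<close>

lemma ract_minus_counit: "ract f b - scaleC (epsB b) f \<in> BplusF"
proof -
  let ?e = "\<lambda>a x. scaleC (counit (total X) a) x"
  note Bal = cbalanced_scaled[OF A.counit_linear]
  have scale: "scaleC k x \<in> BplusF" if "x \<in> BplusF" for k x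
    using that
  proof (induction rule: add_span_induct)
    case (base x)
    then obtain c e where "c \<in> bplus X" "x = lact c e" by blast
    then show ?case
      by (intro add_span_base) (metis (mono_tags, lifting) lact_scaleC_right mem_Collect_eq)
  qed (simp_all add: add_span_0 add_span_diff complex_vector.scale_right_diff_distrib)
  obtain S x where S: "coact f = (\<Sum>s\<in>S. ctens s (x s))" by (rule ctensor_sum_rep)
  have lin: "clinear (\<lambda>a. a * incl X b)"
    by (simp add: clinear_iff distrib_right mult_scaleC_left)
  have "sw ?e t \<in> BplusF" if "t \<in> ctsub UNIV BplusF" for t
    using that
    by (induction rule: ctsub_induct) (simp_all only: sw_ctens[OF Bal] sw_0[OF Bal] sw_diff[OF Bal] scale add_span_0 add_span_diff)
  from this[OF ract_coact[of f b]]
  have "ract f b - (\<Sum>s\<in>S. scaleC (counit (total X) (s * incl X b)) (x s)) \<in> BplusF"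
    unfolding sw_diff[OF Bal] coact_counit S ctmap_sum[OF lin clinear_ident] sw_sum_ctens[OF Bal] by simp
  moreover have "(\<Sum>s\<in>S. scaleC (counit (total X) (s * incl X b)) (x s)) = scaleC (epsB b) f"
    by (subst coact_counit_sum[OF S])
      (simp add: A.counit_mult epsB_def scaleC_sum_right scaleC_scaleC mult.commute)
  ultimately show ?thesis by simp
qed

text \<open>\<open>coord \<phi>\<close> is the composite of the coaction with a functional on the module.  When \<open>\<phi>\<close> factors through
  \<open>F/B\<^sup>+F\<close>, these are the components of \<open>F \<rightarrow> A \<otimes> F/B\<^sup>+F\<close>.\<close>

definition coord :: "('f \<Rightarrow> complex) \<Rightarrow> 'f \<Rightarrow> 'a" where
  "coord \<phi> f = sw (\<lambda>a x. scaleC (\<phi> x) a) (coact f)"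

context
  fixes \<phi> :: "'f \<Rightarrow> complex"
  assumes \<phi>: "clinear \<phi>"
begin

lemma coord_sum: "coact f = (\<Sum>i\<in>I. ctens (a i) (x i)) \<Longrightarrow> coord \<phi> f = (\<Sum>i\<in>I. scaleC (\<phi> (x i)) (a i))"
  by (simp add: coord_def sw_sum_ctens[OF cbalanced_scaled'[OF \<phi>]])

lemma coord_linear: "clinear (coord \<phi>)"
proof -
  note Bal = cbalanced_scaled'[OF \<phi>]
  have "sw (\<lambda>a x. scaleC (\<phi> x) a) (scaleC c t) = scaleC c (sw (\<lambda>a x. scaleC (\<phi> x) a) t)"
    for c and t :: "('a, 'f) ctensor"
    by (rule sw_scaleC[OF Bal]) (simp add: scaleC_scaleC mult.commute)
  then show ?thesis
    by (simp add: clinear_iff coord_def clinear_simps[OF coact_linear] sw_add[OF Bal])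
qed

lemma coord_lact:
  assumes "\<And>b x. \<phi> (lact b x) = epsB b * \<phi> x"
  shows "coord \<phi> (lact b f) = incl X b * coord \<phi> f"
proof -
  obtain S x where S: "coact f = (\<Sum>s\<in>S. ctens s (x s))" by (rule ctensor_sum_rep)
  obtain T y where T: "bcoact X b = (\<Sum>t\<in>T. ctens t (y t))" by (rule ctensor_sum_rep)
  note Bal = cbalanced_scaled'[OF \<phi>]
  show ?thesis
    unfolding coord_def coact_lact_sum[OF T S] incl_counit[OF T]
    by (simp add: S sw_sum[OF Bal] sw_ctens[OF Bal] assms sum_distrib_left sum_distrib_right
        mult_scaleC_left mult_scaleC_right scaleC_scaleC scaleC_sum_right mult.commute[of _ "epsB _"])
      (rule sum.swap)
qed

end

text \<open>A nondegenerate covariant form with values in \<open>B\<close> that is \<open>B\<close>-linear on the left provides an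
  injective map \<open>F \<rightarrow> A \<otimes> F/B\<^sup>+F\<close>, on which the right action is right multiplication.  Together with a
  definite invariant inner product, which makes coefficient matrices invertible, this rewrites
  \<open>b y\<close> for \<open>b \<in> B\<^sup>+\<close> as a sum of terms \<open>y\<^sub>k z\<^sub>k\<close> with \<open>z\<^sub>k \<in> B\<^sup>+\<close>.\<close>

lemma left_bplus_in_right_bplus:
  assumes ang: "biadditive ang" "\<And>b c f k. ang (lact b f) (lact c k) = b * ang f k * bstar X c"
    and cov: "\<And>f k. bcoact X (ang f k) = ctzip (\<lambda>a c. a * hstar (total X) c) ang (coact f) (coact k)"
    and nondeg: "\<And>f. (\<And>k. ang f k = 0) \<Longrightarrow> f = 0"
    and ip: "psd_form ip" "\<And>x. ip x x = 0 \<Longrightarrow> x = 0"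
    and inv: "\<And>f k I J a x d y. coact f = (\<Sum>i\<in>(I::nat set). ctens (a i) (x i)) \<Longrightarrow>
      coact k = (\<Sum>j\<in>(J::nat set). ctens (d j) (y j)) \<Longrightarrow>
      (\<Sum>i\<in>I. \<Sum>j\<in>J. scaleC (ip (x i) (y j)) (hstar (total X) (a i) * d j)) = scaleC (ip f k) 1"
    and c: "c \<in> bplus X"
  shows "lact c f \<in> add_span {ract f c | f c. c \<in> bplus X}"
proof -
  let ?s = "hstar (total X)"
  obtain n :: nat and e u where on: "\<And>i j. i < n \<Longrightarrow> j < n \<Longrightarrow> ip (e i) (e j) = of_bool (i = j)"
    and \<delta>e: "\<And>i. i < n \<Longrightarrow> coact (e i) = (\<Sum>j<n. ctens (u i j) (e j))"
    and \<Delta>u: "\<And>i j. i < n \<Longrightarrow> j < n \<Longrightarrow> comult (total X) (u i j) = (\<Sum>k<n. ctens (u i k) (u k j))"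
    and \<epsilon>u: "\<And>i j. i < n \<Longrightarrow> j < n \<Longrightarrow> counit (total X) (u i j) = of_bool (i = j)"
    and f: "f = (\<Sum>i<n. scaleC (ip (e i) f) (e i))"
    by (rule orthonormal_subcomodule[OF coact_comodule A.comult_linear A.counit_linear ip(1), of f],
      erule ip(2), rule that)
  (* The conjugate matrix is a one-sided inverse of the transpose of u by invariance, and the antipode
     makes it two-sided. *)
  have uu: "(\<Sum>j<n. ?s (u i j) * u k j) = of_bool (i = k)" if "i < n" "k < n" for i k
    using inv[OF \<delta>e[OF that(1)] \<delta>e[OF that(2)]] that
    by (auto simp: on of_bool_def if_distrib[of "\<lambda>c. scaleC c _"] scaleC_one cong: if_cong)
  have S: "(\<Sum>k<n. antipode (total X) (?s (u i k)) * ?s (u k j)) = of_bool (i = j)" if "i < n" "j < n" for i j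
    using A.antipode_left_sum[OF A.comult_star_sum[OF \<Delta>u[OF that]]] that
    by (simp add: A.counit_star \<epsilon>u scaleC_one)
  have Su: "antipode (total X) (?s (u j k)) = u k j" if jk: "j < n" "k < n" for j k
  proof -
    have "antipode (total X) (?s (u j k)) = (\<Sum>i<n. antipode (total X) (?s (u j i)) * (\<Sum>l<n. ?s (u i l) * u k l))"
      using jk by (simp add: uu of_bool_def if_distrib[of "\<lambda>c. _ * c"] cong: if_cong)
    also have "\<dots> = (\<Sum>l<n. (\<Sum>i<n. antipode (total X) (?s (u j i)) * ?s (u i l)) * u k l)"
      by (simp add: sum_distrib_left sum_distrib_right mult.assoc) (rule sum.swap)
    also have "\<dots> = u k j"
      using jk by (simp add: S of_bool_def if_distrib[of "\<lambda>c. c * _"] cong: if_cong)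
    finally show ?thesis .
  qed
  have uu': "(\<Sum>k<n. u k l * ?s (u k j)) = of_bool (l = j)" if "l < n" "j < n" for l j
    using S[OF that] that by (simp add: Su)
  (* For y = e i these are the components of S^-1(y_(-1)) c y_(-2) with respect to the e k. *)
  define z where "z i k = (\<Sum>j<n. ?s (u k j) * incl X c * u i j)" for i k
  have "\<exists>w. \<forall>i<n. \<forall>k<n. incl X (w i k) = z i k"
  proof -
    have "\<exists>b. incl X b = z i k" if "i < n" "k < n" for i k
      using adjoint_action_coideal[of n u i k c, OF \<Delta>u uu that] unfolding z_def by (metis rangeE)
    then show ?thesis by metis
  qed
  then obtain w where w: "\<And>i k. i < n \<Longrightarrow> k < n \<Longrightarrow> incl X (w i k) = z i k" by blast
  have w_bplus: "w i k \<in> bplus X" if "i < n" "k < n" for i k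
    using w[OF that] c
    by (simp add: epsB_bplus epsB_def z_def clinear_simps[OF A.counit_linear] A.counit_mult)
  define \<gamma> where "\<gamma> k f = epsB (ang f k)" for k f
  have ang_scale: "ang (scaleC r f) k = scaleC r (ang f k)" for r f k
    using ang(2)[of "scaleC r 1" f 1 k] by (simp add: lact_scalar lact_one mult_scaleC_left)
      (metis bstar_scaleC bstar_bstar bstar_mult mult_1_left mult_1_right)
  have \<gamma>lin: "clinear (\<gamma> k)" for k
    by (simp add: clinear_iff \<gamma>_def ang_scale biadditive_left[OF ang(1)] clinear_simps[OF epsB_linear])
  have bstar_1: "bstar X 1 = 1"
    by (metis bstar_bstar bstar_mult mult_1_left mult_1_right)
  have \<gamma>_lact: "\<gamma> k (lact b f) = epsB b * \<gamma> k f" for k b f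
    using ang(2)[of b f 1 k] by (simp add: \<gamma>_def lact_one bstar_1 epsB_mult)
  define p where "p k = coord (\<gamma> k)" for k
  note Bal = cbalanced_scaled'[OF \<gamma>lin]
  note p_lin = clinear_simps[OF coord_linear[OF \<gamma>lin], folded p_def]
  note p_sum = coord_sum[OF \<gamma>lin, folded p_def]
  have p_lact: "p k (lact b f) = incl X b * p k f" for k b f
    unfolding p_def by (rule coord_lact[OF \<gamma>lin \<gamma>_lact])
  have p_ract: "p k (ract f b) = p k f * incl X b" for k f b
  proof -
    obtain S x where S: "coact f = (\<Sum>s\<in>S. ctens s (x s))" by (rule ctensor_sum_rep)
    have lin: "clinear (\<lambda>a. a * incl X b)"
      by (simp add: clinear_iff distrib_right mult_scaleC_left)
    have \<gamma>0: "\<gamma> k x = 0" if "x \<in> BplusF" for x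
      using that
      by (induction rule: add_span_induct) (auto simp: \<gamma>_lact epsB_bplus clinear_simps[OF \<gamma>lin])
    have "sw (\<lambda>a x. scaleC (\<gamma> k x) a) t = 0" if "t \<in> ctsub UNIV BplusF" for t
      using that by (induction rule: ctsub_induct) (auto simp: sw_ctens[OF Bal] sw_0[OF Bal] sw_diff[OF Bal] \<gamma>0)
    from this[OF ract_coact[of f b]] show ?thesis
      unfolding p_def coord_def sw_diff[OF Bal] S ctmap_sum[OF lin clinear_ident] sw_sum_ctens[OF Bal]
      by (simp add: sum_distrib_right mult_scaleC_left)
  qed
  (* By covariance ang f k is a combination of the p l f. *)
  have p_inj: "f = 0" if "\<And>k. p k f = 0" for f
  proof (rule nondeg)
    fix k
    obtain S x where S: "coact f = (\<Sum>s\<in>S. ctens s (x s))" by (rule ctensor_sum_rep)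
    obtain T y where T: "coact k = (\<Sum>t\<in>T. ctens t (y t))" by (rule ctensor_sum_rep)
    have ang_scale': "ang f (scaleC r k) = scaleC (cnj r) (ang f k)" for r f k
      using ang(2)[of 1 f "scaleC r 1" k] by (simp add: lact_scalar lact_one bstar_scaleC bstar_1 mult_scaleC_right)
    have B1: "cbalanced (\<lambda>u v. ctens (x' * ?s u) (ang y' v))" for x' y'
      by (rule cbalanced_ctens_map[where s = cnj])
        (simp_all add: A.star_add distrib_left A.star_scaleC mult_scaleC_right ang_scale' biadditive_right[OF ang(1)])
    have B2: "cbalanced (\<lambda>x y. sw (\<lambda>u v. ctens (x * ?s u) (ang y v)) t)" for t
    proof -
      obtain R q where R: "t = (\<Sum>r\<in>R. ctens r (q r))" by (rule ctensor_sum_rep)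
      show ?thesis
        unfolding R sw_sum_ctens[OF B1]
        by (rule cbalancedI) (simp_all add: distrib_right ang_scale biadditive_left[OF ang(1)] ctens_add
          ctens_scaleC mult_scaleC_left sum.distrib)
    qed
    have "bcoact X (ang f k) = (\<Sum>s\<in>S. \<Sum>t\<in>T. ctens (s * ?s t) (ang (x s) (y t)))"
      unfolding cov ctzip_def S T by (subst sw_sum_ctens[OF B2]) (simp only: sw_sum_ctens[OF B1])
    then have "bcoact X (ang f k) = (\<Sum>p\<in>S \<times> T. ctens (fst p * ?s (snd p)) (ang (x (fst p)) (y (snd p))))"
      by (simp add: sum.cartesian_product split_beta)
    from incl_counit[OF this] have "incl X (ang f k) = (\<Sum>t\<in>T. \<Sum>s\<in>S. scaleC (\<gamma> (y t) (x s)) (s * ?s t))"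
      by (simp add: sum.cartesian_product' \<gamma>_def) (rule sum.swap)
    also have "\<dots> = (\<Sum>t\<in>T. p (y t) f * ?s t)"
      by (simp add: p_sum[OF S] sum_distrib_right mult_scaleC_left)
    finally show "ang f k = 0"
      using that by (simp add: incl_eq[symmetric] clinear_0[OF incl_linear] del: incl_eq)
  qed
  have main: "lact c (e i) = (\<Sum>k<n. ract (e k) (w i k))" if i: "i < n" for i
  proof -
    have pe: "p k (e l) = (\<Sum>m<n. scaleC (\<gamma> k (e m)) (u l m))" if "l < n" for k l
      by (rule p_sum[OF \<delta>e[OF that]])
    have "p k (\<Sum>l<n. ract (e l) (w i l)) = p k (lact c (e i))" for k
    proof -
      have "p k (\<Sum>l<n. ract (e l) (w i l)) = (\<Sum>l<n. (\<Sum>m<n. scaleC (\<gamma> k (e m)) (u l m)) * z i l)"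
        using i by (simp add: p_lin p_ract pe w)
      also have "\<dots> = (\<Sum>l<n. \<Sum>m<n. \<Sum>j<n. scaleC (\<gamma> k (e m)) (u l m * ?s (u l j)) * (incl X c * u i j))"
        by (simp add: z_def sum_distrib_left sum_distrib_right mult_scaleC_left mult.assoc)
          (rule sum.cong[OF refl], rule sum.swap)
      also have "\<dots> = (\<Sum>m<n. \<Sum>j<n. scaleC (\<gamma> k (e m)) (\<Sum>l<n. u l m * ?s (u l j)) * (incl X c * u i j))"
        by (simp add: scaleC_sum_right sum_distrib_right)
          (subst sum.swap, rule sum.cong[OF refl], rule sum.swap)
      also have "\<dots> = incl X c * (\<Sum>m<n. scaleC (\<gamma> k (e m)) (u i m))"
        by (simp add: uu' mult_scaleC_left mult_scaleC_right sum_distrib_left flip: scaleC_sum_right)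
      also have "\<dots> = p k (lact c (e i))"
        using i by (simp add: p_lact pe)
      finally show ?thesis .
    qed
    then have "p k (lact c (e i) - (\<Sum>l<n. ract (e l) (w i l))) = 0" for k
      by (simp add: p_lin)
    from p_inj[OF this] show ?thesis by simp
  qed
  have "lact c f = (\<Sum>i<n. \<Sum>k<n. ract (scaleC (ip (e i) f) (e k)) (w i k))"
    by (subst f) (simp add: biadditive_sum_right[OF lact_biadditive] lact_scaleC_right main scaleC_sum_right ract_scaleC)
  also have "\<dots> \<in> add_span {ract f c | f c. c \<in> bplus X}"
    by (intro add_subgroup_sum[OF add_subgroup_add_span] hull_inc) (use w_bplus in auto)
  finally show ?thesis .
qed

text \<open>A form that only sees the fibre \<open>F/B\<^sup>+F\<close> has a finite orthonormal basis, because the fibre is spanned by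
  the images of finitely many module generators.\<close>

lemma coinvariant_basis:
  assumes psd: "psd_form \<beta>" and left: "\<And>x b f. \<beta> x (lact b f) = epsB b * \<beta> x f"
  obtains m :: nat and e where "\<And>i j. i < m \<Longrightarrow> j < m \<Longrightarrow> \<beta> (e i) (e j) = of_bool (i = j)"
    "\<And>x f. \<beta> x f = (\<Sum>i<m. \<beta> (e i) f * \<beta> x (e i))"
proof -
  obtain G where G: "finite G" "\<And>f. \<exists>c. f = (\<Sum>g\<in>G. lact (c g) g)"
    using finitely_generated by auto
  obtain m :: nat and e where on: "\<And>i j. i < m \<Longrightarrow> j < m \<Longrightarrow> \<beta> (e i) (e j) = of_bool (i = j)"
    and sp: "\<And>w x. w \<in> complex_vector.span G \<Longrightarrow> \<beta> x w = (\<Sum>i<m. \<beta> (e i) w * \<beta> x (e i))"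
    using orthonormal_spanning[OF psd G(1)] by blast
  have "\<beta> x f = (\<Sum>i<m. \<beta> (e i) f * \<beta> x (e i))" for x f
  proof -
    obtain c where c: "f = (\<Sum>g\<in>G. lact (c g) g)" using G(2) by blast
    define w where "w = (\<Sum>g\<in>G. scaleC (epsB (c g)) g)"
    have eq: "\<beta> y f = \<beta> y w" for y
      by (simp add: c w_def clinear_simps[OF psd_clinear[OF psd]] left scaleC_complex_def)
    have "w \<in> complex_vector.span G"
      unfolding w_def by (intro complex_vector.span_sum complex_vector.span_scale complex_vector.span_base)
    from sp[OF this, of x] show ?thesis unfolding eq .
  qed
  with on that show ?thesis by blast
qed

text \<open>In coordinates with respect to such a basis a covariant form is the standard one; \<open>b\<close> stands for its value
  on the pair \<open>(f, k)\<close>.\<close>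

lemma form_coords:
  assumes psd: "psd_form \<beta>" and basis: "\<And>x f. \<beta> x f = (\<Sum>i<(m::nat). \<beta> (e i) f * \<beta> x (e i))"
    and cov: "\<And>S T x y. coact f = (\<Sum>s\<in>S. ctens s (x s)) \<Longrightarrow> coact k = (\<Sum>t\<in>T. ctens t (y t)) \<Longrightarrow>
      incl X b = (\<Sum>s\<in>S. \<Sum>t\<in>T. scaleC (\<beta> (x s) (y t)) (hstar (total X) s * t))"
  shows "incl X b = (\<Sum>i<m. hstar (total X) (coord (\<beta> (e i)) f) * coord (\<beta> (e i)) k)"
proof -
  obtain S x where S: "coact f = (\<Sum>s\<in>S. ctens s (x s))" by (rule ctensor_sum_rep)
  obtain T y where T: "coact k = (\<Sum>t\<in>T. ctens t (y t))" by (rule ctensor_sum_rep)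
  have "incl X b = (\<Sum>s\<in>S. \<Sum>t\<in>T. \<Sum>i<m. scaleC (\<beta> (e i) (y t) * cnj (\<beta> (e i) (x s))) (hstar (total X) s * t))"
    unfolding cov[OF S T]
    by (subst basis, subst psd_sym[OF psd]) (simp add: scaleC_sum_left)
  also have "\<dots> = (\<Sum>i<m. \<Sum>s\<in>S. \<Sum>t\<in>T. scaleC (\<beta> (e i) (y t) * cnj (\<beta> (e i) (x s))) (hstar (total X) s * t))"
    by (rule trans[OF _ sum.swap], rule sum.cong[OF refl], rule sum.swap)
  also have "\<dots> = (\<Sum>i<m. hstar (total X) (coord (\<beta> (e i)) f) * coord (\<beta> (e i)) k)"
    unfolding coord_sum[OF psd_clinear[OF psd] S] coord_sum[OF psd_clinear[OF psd] T]
    by (simp add: A.star_sum A.star_scaleC sum_distrib_left sum_distrib_right mult_scaleC_left mult_scaleC_right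
        scaleC_scaleC scaleC_sum_right mult.commute) (rule sum.cong[OF refl], rule sum.swap)
  finally show ?thesis .
qed

end


section \<open>Gradings\<close>

lemma is_decompositionI:
  assumes "\<And>i. c i \<in> V i" "finite I" "\<And>i. i \<notin> I \<Longrightarrow> c i = 0" "x = (\<Sum>i\<in>I. c i)"
  shows "is_decomposition V x c"
proof -
  have "{i. c i \<noteq> 0} \<subseteq> I" using assms(3) by blast
  then have "finite {i. c i \<noteq> 0}" "(\<Sum>i | c i \<noteq> 0. c i) = (\<Sum>i\<in>I. c i)"
    using assms(2) by (auto intro: finite_subset sum.mono_neutral_left)
  then show ?thesis
    using assms(1,4) by (simp add: is_decomposition_def)
qed

lemma is_decomposition_sum:
  assumes "is_decomposition V x c" "finite I" "\<And>i. c i \<noteq> 0 \<Longrightarrow> i \<in> I"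
  shows "x = (\<Sum>i\<in>I. c i)"
proof -
  have "(\<Sum>i | c i \<noteq> 0. c i) = (\<Sum>i\<in>I. c i)"
    using assms(2,3) by (intro sum.mono_neutral_left) auto
  then show ?thesis
    using assms(1) by (simp add: is_decomposition_def)
qed

context
  fixes V :: "'i \<Rightarrow> 'v::complex_vector set" and Y
  assumes V: "direct_sum V Y"
begin

lemma direct_sum_csubspace: "csubspace (V i)" and direct_sum_subset: "V i \<subseteq> Y" and direct_sum_total: "csubspace Y"
  using V by (auto simp: direct_sum_def)

lemma component_decomposition: "x \<in> Y \<Longrightarrow> is_decomposition V x (component V x)"
  using V unfolding direct_sum_def component_def by (metis (mono_tags, lifting) theI')

lemma component_eqI: "x \<in> Y \<Longrightarrow> is_decomposition V x c \<Longrightarrow> component V x = c"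
  using V component_decomposition unfolding direct_sum_def by blast

lemma component_in: "x \<in> Y \<Longrightarrow> component V x i \<in> V i"
  and component_finite: "x \<in> Y \<Longrightarrow> finite {i. component V x i \<noteq> 0}"
  and component_expand: "x \<in> Y \<Longrightarrow> x = (\<Sum>i | component V x i \<noteq> 0. component V x i)"
  using component_decomposition unfolding is_decomposition_def by blast+

lemma component_expand': "x \<in> Y \<Longrightarrow> finite I \<Longrightarrow> (\<And>i. component V x i \<noteq> 0 \<Longrightarrow> i \<in> I) \<Longrightarrow> x = (\<Sum>i\<in>I. component V x i)"
  by (rule is_decomposition_sum[OF component_decomposition])

lemma component_of: "x \<in> V i \<Longrightarrow> component V x j = (if j = i then x else 0)"
proof -
  assume x: "x \<in> V i"
  have "component V x = (\<lambda>j. if j = i then x else 0)"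
    using x direct_sum_csubspace direct_sum_subset
    by (intro component_eqI is_decompositionI[where I = "{i}"]) (auto simp: complex_vector.subspace_0)
  then show ?thesis by simp
qed

lemma component_add: "x \<in> Y \<Longrightarrow> y \<in> Y \<Longrightarrow> component V (x + y) i = component V x i + component V y i"
proof -
  assume x: "x \<in> Y" and y: "y \<in> Y"
  have "component V (x + y) = (\<lambda>i. component V x i + component V y i)"
  proof (intro component_eqI is_decompositionI[where I = "{i. component V x i \<noteq> 0} \<union> {i. component V y i \<noteq> 0}"])
    show "x + y \<in> Y" using x y direct_sum_total by (simp add: csubspace_iff)
    show "component V x i + component V y i \<in> V i" for i
      using component_in[OF x, of i] component_in[OF y, of i] direct_sum_csubspace[of i] by (simp add: csubspace_iff)
    let ?I = "{i. component V x i \<noteq> 0} \<union> {i. component V y i \<noteq> 0}"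
    have "x = (\<Sum>i\<in>?I. component V x i)" "y = (\<Sum>i\<in>?I. component V y i)"
      using x y by (auto intro!: component_expand' component_finite)
    then show "x + y = (\<Sum>i\<in>?I. component V x i + component V y i)"
      by (simp add: sum.distrib)
  qed (use x y in \<open>auto intro: component_finite\<close>)
  then show ?thesis by simp
qed

lemma component_scaleC: "x \<in> Y \<Longrightarrow> component V (scaleC c x) i = scaleC c (component V x i)"
proof -
  assume x: "x \<in> Y"
  have "component V (scaleC c x) = (\<lambda>i. scaleC c (component V x i))"
  proof (intro component_eqI is_decompositionI[where I = "{i. component V x i \<noteq> 0}"])
    show "scaleC c x \<in> Y" using x direct_sum_total by (simp add: csubspace_iff)
    show "scaleC c (component V x i) \<in> V i" for i
      using component_in[OF x, of i] direct_sum_csubspace[of i] by (simp add: csubspace_iff)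
    show "scaleC c x = (\<Sum>i | component V x i \<noteq> 0. scaleC c (component V x i))"
      using component_expand[OF x] by (metis scaleC_sum_right)
  qed (use x in \<open>auto intro: component_finite\<close>)
  then show ?thesis by simp
qed

end

lemma component_linear: "direct_sum V UNIV \<Longrightarrow> clinear (\<lambda>x. component V x i)"
  by (simp add: clinear_iff component_add component_scaleC)

text \<open>The bigrading is given degree by degree; this assembles it into a decomposition of all of \<open>\<Omega>\<^sup>\<bullet>\<close>.\<close>

lemma direct_sum_refine:
  fixes f :: "'p \<Rightarrow> 'k"
  assumes V: "direct_sum V UNIV" and W: "\<And>k. direct_sum (\<lambda>p. if f p = k then W p else {0}) (V k)"
  shows "direct_sum W UNIV"
proof -
  define U where "U k = (\<lambda>p. if f p = k then W p else {0})" for k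
  have U: "direct_sum (U k) (V k)" for k
    unfolding U_def by (rule W)
  have W_sub: "csubspace (W p)" and W_V: "W p \<subseteq> V (f p)" for p
    using direct_sum_csubspace[OF U, of "f p" p] direct_sum_subset[OF U, of "f p" p] by (auto simp: U_def)
  show ?thesis
    unfolding direct_sum_def
  proof (intro conjI allI ballI)
    fix x
    define c where "c p = component (U (f p)) (component V x (f p)) p" for p
    have xV: "component V x k \<in> V k" for k
      by (rule component_in[OF V]) simp
    have c_k: "component (U k) (component V x k) p = (if f p = k then c p else 0)" for k p
      using component_in[OF U xV, of k p] by (auto simp: c_def U_def)
    show "\<exists>!c. is_decomposition W x c"
    proof
      define K where "K = {k. component V x k \<noteq> 0}"
      define P where "P k = {p. component (U k) (component V x k) p \<noteq> 0}" for k
      have fin: "finite K" "\<And>k. finite (P k)"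
        unfolding K_def P_def using component_finite[OF V, of x] component_finite[OF U xV] by auto
      show "is_decomposition W x c"
      proof (rule is_decompositionI[where I = "\<Union>k\<in>K. P k"])
        show "c p \<in> W p" for p
          using component_in[OF U xV, of "f p" p] by (simp add: c_def U_def)
        show "finite (\<Union>k\<in>K. P k)" using fin by simp
        show "c p = 0" if "p \<notin> (\<Union>k\<in>K. P k)" for p
        proof (cases "f p \<in> K")
          case True
          with that show ?thesis by (auto simp: P_def c_def)
        next
          case False
          then have "component V x (f p) = 0" by (simp add: K_def)
          then show ?thesis
            using component_scaleC[OF U, of 0 "f p" 0 p] direct_sum_csubspace[OF V, of "f p"]
            by (simp add: c_def complex_vector.subspace_0)
        qed
        have "x = (\<Sum>k\<in>K. component V x k)"
          unfolding K_def by (rule component_expand[OF V]) simp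
        also have "\<dots> = (\<Sum>k\<in>K. \<Sum>p\<in>P k. c p)"
        proof (rule sum.cong[OF refl])
          fix k
          have "component V x k = (\<Sum>p\<in>P k. component (U k) (component V x k) p)"
            unfolding P_def by (rule component_expand[OF U xV])
          also have "\<dots> = (\<Sum>p\<in>P k. c p)"
            by (rule sum.cong) (auto simp: P_def c_k split: if_splits)
          finally show "component V x k = (\<Sum>p\<in>P k. c p)" .
        qed
        also have "\<dots> = (\<Sum>p\<in>(\<Union>k\<in>K. P k). c p)"
          by (rule sum.UNION_disjoint[symmetric]) (use fin in \<open>auto simp: P_def c_k split: if_splits\<close>)
        finally show "x = (\<Sum>p\<in>(\<Union>k\<in>K. P k). c p)" .
      qed
    next
      fix e assume e: "is_decomposition W x e"
      define Q where "Q = {p. e p \<noteq> 0}"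
      have Q: "finite Q" "x = (\<Sum>p\<in>Q. e p)" and eW: "\<And>p. e p \<in> W p"
        using e by (auto simp: is_decomposition_def Q_def)
      define y where "y k = (\<Sum>p | p \<in> Q \<and> f p = k. e p)" for k
      have yV: "y k \<in> V k" for k
        unfolding y_def using eW W_V by (intro csubspace_sum[OF direct_sum_csubspace[OF V]]) blast
      have "component V x = y"
      proof (intro component_eqI[OF V] is_decompositionI[where I = "f ` Q"] yV)
        show "y k = 0" if "k \<notin> f ` Q" for k
          unfolding y_def using that by (intro sum.neutral) auto
        show "x = (\<Sum>k\<in>f ` Q. y k)"
          unfolding y_def Q(2) using Q(1) by (rule sum.image_gen)
      qed (use Q in auto)
      moreover have "component (U k) (y k) = (\<lambda>p. if f p = k then e p else 0)" for k
      proof (intro component_eqI[OF U yV] is_decompositionI[where I = "{p. p \<in> Q \<and> f p = k}"])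
        show "(if f p = k then e p else 0) \<in> U k p" for p
          using eW by (simp add: U_def)
      qed (use Q in \<open>auto simp: Q_def y_def\<close>)
      ultimately show "e = c"
        by (auto simp: c_def)
    qed
  qed (use W_sub in \<open>auto simp: csubspace_iff[of UNIV]\<close>)
qed


section \<open>The Lefschetz decomposition and the Hodge map\<close>

lemma power_minus_one_mult: "(- 1) ^ k * x = scaleC ((- 1) ^ k) x" for x :: "'z::complex_algebra_1"
  by (induction k) (auto simp: scaleC_one mult.assoc scaleC_scaleC[symmetric])

context star_calculus
begin

lemma emb_linear: "clinear (emb C)" and emb_one [simp]: "emb C 1 = 1"
  and emb_mult: "emb C (x * y) = emb C x * emb C y"
  using emb_alg_hom by (auto simp: alg_hom_def)

lemma emb_eq [simp]: "emb C x = emb C y \<longleftrightarrow> x = y"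
  using emb_inj by (auto dest: injD)

lemma emb_grade: "emb C b \<in> grade C 0"
  using emb_range by blast

lemma the_inv_emb [simp]: "the_inv (emb C) (emb C b) = b"
  by (rule the_inv_f_f[OF emb_inj])

lemma grade_csubspace: "csubspace (grade C k)"
  by (rule direct_sum_csubspace[OF grading])

lemmas grade_component = component_in[OF grading, OF UNIV_I]
lemmas grade_component_of = component_of[OF grading]
lemmas grade_component_linear = component_linear[OF grading]

end

context complex_structure
begin

lemma bigrade_direct_sum: "direct_sum (bigrade C) UNIV"
proof (rule direct_sum_refine[OF grading, where f = "\<lambda>(a, b). a + b"])
  fix k
  have "(\<lambda>p. if (case p of (a, b) \<Rightarrow> a + b) = k then bigrade C p else {0})
      = (\<lambda>(a, b). if a + b = k then bigrade C (a, b) else {0})"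
    by auto
  then show "direct_sum (\<lambda>p. if (case p of (a, b) \<Rightarrow> a + b) = k then bigrade C p else {0}) (grade C k)"
    using bigrading by simp
qed

lemmas bigrade_component = component_in[OF bigrade_direct_sum, OF UNIV_I]
lemmas bigrade_component_of = component_of[OF bigrade_direct_sum]
lemmas bigrade_component_linear = component_linear[OF bigrade_direct_sum]

lemma bigrade_csubspace: "csubspace (bigrade C p)"
  by (rule direct_sum_csubspace[OF bigrade_direct_sum])

lemma bigrade_grade: "bigrade C (a, b) \<subseteq> grade C (a + b)"
  using direct_sum_subset[OF bigrading[of "a + b"], of "(a, b)"] by simp

lemma bigrade_expand:
  assumes x: "x \<in> grade C k"
  shows "x = (\<Sum>a\<le>k. component (bigrade C) x (a, k - a))"
proof -
  let ?V = "\<lambda>(a, b). if a + b = k then bigrade C (a, b) else {0}"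
  define c where "c = component ?V x"
  have dec: "is_decomposition ?V x c"
    unfolding c_def by (rule component_decomposition[OF bigrading x])
  have cV: "c p \<in> ?V p" for p
    using dec unfolding is_decomposition_def by blast
  have c0: "c (a, b) = 0" if "a + b \<noteq> k" for a b
    using cV[of "(a, b)"] that by simp
  have fin: "finite {(a, b). a + b = k}"
    by (rule finite_subset[of _ "{..k} \<times> {..k}"]) auto
  have "component (bigrade C) x = c"
  proof (intro component_eqI[OF bigrade_direct_sum] is_decompositionI[where I = "{(a, b). a + b = k}"] fin)
    show "c p \<in> bigrade C p" for p
      using cV[of p] bigrade_csubspace[of p] by (cases p) (auto split: if_splits simp: complex_vector.subspace_0)
    show "x = (\<Sum>p\<in>{(a, b). a + b = k}. c p)"
      using c0 by (intro is_decomposition_sum[OF dec fin]) auto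
  qed (use c0 in auto)
  moreover have "x = (\<Sum>a\<le>k. c (a, k - a))"
  proof -
    have "x = (\<Sum>p\<in>(\<lambda>a. (a, k - a)) ` {..k}. c p)"
    proof (rule is_decomposition_sum[OF dec])
      fix p assume "c p \<noteq> 0"
      then have "fst p + snd p = k" using c0[of "fst p" "snd p"] by auto
      then show "p \<in> (\<lambda>a. (a, k - a)) ` {..k}" by (cases p) (auto intro!: image_eqI)
    qed simp
    also have "\<dots> = (\<Sum>a\<le>k. c (a, k - a))"
      by (subst sum.reindex) (auto simp: inj_on_def)
    finally show ?thesis .
  qed
  ultimately show ?thesis by simp
qed

lemma emb_bigrade: "emb C b \<in> bigrade C (0, 0)"
  using bigrade_expand[OF emb_grade[of b]] bigrade_component[of "emb C b" "(0, 0)"] by simp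

lemma wstar_grade:
  assumes "x \<in> grade C k" shows "wstar C x \<in> grade C k"
proof -
  have "wstar C x = (\<Sum>a\<le>k. wstar C (component (bigrade C) x (a, k - a)))"
    using bigrade_expand[OF assms] conj_linear_sum[OF wstar_conj_linear] by metis
  also have "\<dots> \<in> grade C k"
  proof (intro csubspace_sum[OF grade_csubspace])
    fix a assume "a \<in> {..k}"
    moreover have "wstar C (component (bigrade C) x (a, k - a)) \<in> bigrade C (k - a, a)"
      using bigrade_star[of a "k - a"] bigrade_component by blast
    ultimately show "wstar C (component (bigrade C) x (a, k - a)) \<in> grade C k"
      using bigrade_grade[of "k - a" a] by auto
  qed
  finally show ?thesis .
qed

end

context hermitian_structure
begin

abbreviation "\<sigma> \<equiv> kform C"

lemma grade_zero: "k > 2 * cdim C \<Longrightarrow> x \<in> grade C k \<Longrightarrow> x = 0"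
  using total_degree(2) by auto

lemma grade_expand: "x = (\<Sum>k\<le>2 * cdim C. component (grade C) x k)"
proof (rule component_expand'[OF grading])
  show "i \<in> {..2 * cdim C}" if "component (grade C) x i \<noteq> 0" for i
    using that grade_zero[OF _ grade_component] by (metis atMost_iff linorder_not_less)
qed auto

lemma sigma_power_bigrade: "\<sigma> ^ r \<in> bigrade C (r, r)"
proof (induction r)
  case 0
  show ?case using emb_bigrade[of 1] by simp
next
  case (Suc r)
  show ?case using bigrade_mult[OF kform_degree Suc] by simp
qed

lemma sigma_power_central: "\<sigma> ^ r * x = x * \<sigma> ^ r"
proof (induction r)
  case (Suc r)
  have "\<sigma> * (\<sigma> ^ r * x) = \<sigma> * x * \<sigma> ^ r"
    by (simp add: Suc mult.assoc)
  also have "\<dots> = x * (\<sigma> * \<sigma> ^ r)"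
    by (simp add: kform_central mult.assoc)
  finally show ?case by (simp add: mult.assoc)
qed simp

lemma sigma_power_grade: "x \<in> grade C k \<Longrightarrow> \<sigma> ^ r * x \<in> grade C (2 * r + k)"
  using grade_mult[of "\<sigma> ^ r" "2 * r" x k] sigma_power_bigrade[of r] bigrade_grade[of r r] by (auto simp: mult_2)

lemma sigma_power_component:
  "component (bigrade C) (\<sigma> ^ r * x) (a + r, b + r) = \<sigma> ^ r * component (bigrade C) x (a, b)"
proof -
  let ?c = "component (bigrade C)"
  define I where "I = insert (a, b) {p. ?c x p \<noteq> 0}"
  have I: "finite I" "(a, b) \<in> I" unfolding I_def using component_finite[OF bigrade_direct_sum] by auto
  have "\<sigma> ^ r * x = \<sigma> ^ r * (\<Sum>p\<in>I. ?c x p)"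
    using component_expand'[OF bigrade_direct_sum, of x I] I by (auto simp: I_def)
  also have "\<dots> = (\<Sum>p\<in>I. \<sigma> ^ r * ?c x p)" by (rule sum_distrib_left)
  finally have "?c (\<sigma> ^ r * x) (a + r, b + r) = (\<Sum>p\<in>I. ?c (\<sigma> ^ r * ?c x p) (a + r, b + r))"
    by (simp only: clinear_sum[OF bigrade_component_linear])
  also have "\<dots> = (\<Sum>p\<in>I. if p = (a, b) then \<sigma> ^ r * ?c x p else 0)"
  proof (rule sum.cong[OF refl])
    fix p
    have "\<sigma> ^ r * ?c x p \<in> bigrade C (fst p + r, snd p + r)"
      using bigrade_mult[OF sigma_power_bigrade[of r], of "?c x p" "fst p" "snd p"] bigrade_component[of x p]
      by (simp add: add.commute)
    then show "?c (\<sigma> ^ r * ?c x p) (a + r, b + r) = (if p = (a, b) then \<sigma> ^ r * ?c x p else 0)"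
      by (auto simp: bigrade_component_of prod_eq_iff)
  qed
  also have "\<dots> = \<sigma> ^ r * ?c x (a, b)" using I by simp
  finally show ?thesis .
qed

text \<open>The bound \<open>a + b + j \<le> n\<close> loses nothing, since \<open>\<sigma>\<^sup>j \<alpha> = 0\<close> beyond it, and makes the formula for the
  Hodge map applicable.\<close>

definition
  "lefschetz_gens (k::nat) = {\<sigma> ^ j * \<alpha> | j \<alpha> a b. \<alpha> \<in> primitive C (a + b) \<and> \<alpha> \<in> bigrade C (a, b)
     \<and> a + b + j \<le> cdim C \<and> a + b + 2 * j = k}"

lemma lefschetz_gensI:
  "\<alpha> \<in> primitive C (a + b) \<Longrightarrow> \<alpha> \<in> bigrade C (a, b) \<Longrightarrow> a + b + j \<le> cdim C \<Longrightarrow> a + b + 2 * j = k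
    \<Longrightarrow> \<sigma> ^ j * \<alpha> \<in> lefschetz_gens k"
  unfolding lefschetz_gens_def by blast

text \<open>\<open>\<sigma>\<close> has bidegree \<open>(1, 1)\<close>, so the bidegree components of a primitive form are primitive.\<close>

lemma primitive_gens:
  assumes \<alpha>: "\<alpha> \<in> primitive C k" and k: "k \<le> cdim C"
  shows "\<alpha> \<in> complex_vector.span (lefschetz_gens k)"
proof -
  have g: "\<alpha> \<in> grade C k" and z: "\<sigma> ^ (cdim C - k + 1) * \<alpha> = 0"
    using \<alpha> k by (auto simp: primitive_def)
  have "component (bigrade C) \<alpha> (a, k - a) \<in> lefschetz_gens k" if "a \<le> k" for a
  proof -
    let ?\<beta> = "component (bigrade C) \<alpha> (a, k - a)"
    have \<beta>: "?\<beta> \<in> bigrade C (a, k - a)" by (rule bigrade_component)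
    moreover have "\<sigma> ^ (cdim C - k + 1) * ?\<beta> = 0"
      unfolding sigma_power_component[symmetric] z by (rule clinear_0[OF bigrade_component_linear])
    ultimately have "?\<beta> \<in> primitive C k"
      using bigrade_grade[of a "k - a"] that k by (auto simp: primitive_def)
    with \<beta> k that show ?thesis
      using lefschetz_gensI[of ?\<beta> a "k - a" 0 k] by simp
  qed
  then have "(\<Sum>a\<le>k. component (bigrade C) \<alpha> (a, k - a)) \<in> complex_vector.span (lefschetz_gens k)"
    by (intro complex_vector.span_sum) (auto intro: complex_vector.span_base)
  then show ?thesis using bigrade_expand[OF g] by simp
qed

lemma sigma_power_gens:
  assumes "x \<in> complex_vector.span (lefschetz_gens k)" "k + r \<le> cdim C"
  shows "\<sigma> ^ r * x \<in> complex_vector.span (lefschetz_gens (k + 2 * r))"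
proof -
  have "csubspace {x. \<sigma> ^ r * x \<in> complex_vector.span (lefschetz_gens (k + 2 * r))}"
    by (auto simp: csubspace_iff distrib_left mult_scaleC_right intro: complex_vector.span_zero
        complex_vector.span_add complex_vector.span_scale)
  moreover have "lefschetz_gens k \<subseteq> {x. \<sigma> ^ r * x \<in> complex_vector.span (lefschetz_gens (k + 2 * r))}"
  proof safe
    fix x assume "x \<in> lefschetz_gens k"
    then obtain j \<alpha> a b where x: "x = \<sigma> ^ j * \<alpha>" and \<alpha>: "\<alpha> \<in> primitive C (a + b)" "\<alpha> \<in> bigrade C (a, b)"
        and le: "a + b + j \<le> cdim C" "a + b + 2 * j = k"
      unfolding lefschetz_gens_def by blast
    have "\<sigma> ^ r * x = \<sigma> ^ (r + j) * \<alpha>"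
      by (simp add: x power_add mult.assoc)
    moreover have "\<sigma> ^ (r + j) * \<alpha> \<in> lefschetz_gens (k + 2 * r)"
      using \<alpha> le assms(2) by (intro lefschetz_gensI) auto
    ultimately show "\<sigma> ^ r * x \<in> complex_vector.span (lefschetz_gens (k + 2 * r))"
      by (auto intro: complex_vector.span_base)
  qed
  ultimately show ?thesis
    using assms(1) complex_vector.span_minimal by blast
qed

text \<open>In degree \<open>k \<le> n\<close>, surjectivity of \<open>L\<^sup>n\<^sup>-\<^sup>k\<^sup>+\<^sup>2\<close> from degree \<open>k - 2\<close> corrects a form by a multiple of
  \<open>\<sigma>\<close> to a primitive one.  Degrees above \<open>n\<close> are reached from below by the Lefschetz isomorphism.\<close>

lemma lefschetz_low: "k \<le> cdim C \<Longrightarrow> x \<in> grade C k \<Longrightarrow> x \<in> complex_vector.span (lefschetz_gens k)"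
proof (induction k arbitrary: x rule: less_induct)
  case (less k)
  show ?case
  proof (cases "k < 2")
    case True
    have "\<sigma> ^ (cdim C - k + 1) * x \<in> grade C (2 * (cdim C - k + 1) + k)"
      by (rule sigma_power_grade[OF less.prems(2)])
    then have "\<sigma> ^ (cdim C - k + 1) * x = 0"
      using True less.prems(1) by (intro grade_zero) auto
    then have "x \<in> primitive C k"
      using less.prems by (simp add: primitive_def)
    then show ?thesis by (rule primitive_gens[OF _ less.prems(1)])
  next
    case False
    have deg: "2 * (cdim C - k + 1) + k = 2 * cdim C - (k - 2)"
      using False less.prems(1) by simp
    have "\<sigma> ^ (cdim C - k + 1) * x \<in> grade C (2 * cdim C - (k - 2))"
      using sigma_power_grade[OF less.prems(2), of "cdim C - k + 1"] False less.prems(1)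
      by (metis (no_types, lifting) deg)
    moreover have "bij_betw (\<lambda>x. \<sigma> ^ (cdim C - (k - 2)) * x) (grade C (k - 2)) (grade C (2 * cdim C - (k - 2)))"
      using False less.prems(1) by (intro lefschetz) auto
    ultimately obtain y where y: "y \<in> grade C (k - 2)" "\<sigma> ^ (cdim C - k + 1) * x = \<sigma> ^ (cdim C - (k - 2)) * y"
      unfolding bij_betw_def by blast
    have "cdim C - (k - 2) = cdim C - k + 1 + 1" using False less.prems(1) by simp
    then have "\<sigma> ^ (cdim C - (k - 2)) * y = \<sigma> ^ (cdim C - k + 1) * (\<sigma> * y)"
      by (simp only: power_add power_one_right mult.assoc)
    then have "\<sigma> ^ (cdim C - k + 1) * (x - \<sigma> * y) = 0"
      using y(2) by (simp add: right_diff_distrib)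
    moreover have "\<sigma> * y \<in> grade C k"
      using sigma_power_grade[OF y(1), of 1] False by (simp add: numeral_2_eq_2 Suc_diff_Suc)
    then have "x - \<sigma> * y \<in> grade C k"
      by (rule csubspace_diff[OF grade_csubspace less.prems(2)])
    ultimately have "x - \<sigma> * y \<in> primitive C k"
      using less.prems(1) by (simp add: primitive_def)
    then have "x - \<sigma> * y \<in> complex_vector.span (lefschetz_gens k)"
      by (rule primitive_gens[OF _ less.prems(1)])
    moreover have "y \<in> complex_vector.span (lefschetz_gens (k - 2))"
      using False less.prems(1) y(1) by (intro less.IH) auto
    from sigma_power_gens[OF this, of 1] have "\<sigma> * y \<in> complex_vector.span (lefschetz_gens k)"
      using False less.prems(1) by (simp add: numeral_2_eq_2 Suc_diff_Suc)
    ultimately show ?thesis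
      using complex_vector.span_add by fastforce
  qed
qed

lemma lefschetz_decomposition:
  assumes x: "x \<in> grade C k"
  shows "x \<in> complex_vector.span (lefschetz_gens k)"
proof -
  consider "k \<le> cdim C" | "cdim C < k" "k \<le> 2 * cdim C" | "k > 2 * cdim C" by linarith
  then show ?thesis
  proof cases
    case 2
    define l where "l = 2 * cdim C - k"
    have l: "l < cdim C" "k = 2 * cdim C - l" "k = l + 2 * (cdim C - l)" using 2 by (auto simp: l_def)
    have "bij_betw (\<lambda>x. \<sigma> ^ (cdim C - l) * x) (grade C l) (grade C k)"
      using lefschetz[of l] l by simp
    with x obtain y where y: "y \<in> grade C l" "x = \<sigma> ^ (cdim C - l) * y"
      unfolding bij_betw_def by blast
    have "\<sigma> ^ (cdim C - l) * y \<in> complex_vector.span (lefschetz_gens (l + 2 * (cdim C - l)))"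
      using l by (intro sigma_power_gens lefschetz_low y) auto
    then show ?thesis using l(3) y(2) by simp
  qed (use lefschetz_low[OF _ x] grade_zero[OF _ x] in \<open>auto intro: complex_vector.span_zero\<close>)
qed

lemma lefschetz_induct:
  assumes "clinear f" "clinear g"
    and "\<And>j \<alpha> a b. \<alpha> \<in> primitive C (a + b) \<Longrightarrow> \<alpha> \<in> bigrade C (a, b) \<Longrightarrow> a + b + j \<le> cdim C \<Longrightarrow> f (\<sigma> ^ j * \<alpha>) = g (\<sigma> ^ j * \<alpha>)"
  shows "f x = g x"
proof -
  have sub: "csubspace {x. f x = g x}"
    using assms(1,2) by (auto simp: csubspace_iff clinear_simps)
  have "complex_vector.span (lefschetz_gens k) \<subseteq> {x. f x = g x}" for k
    by (rule complex_vector.span_minimal[OF _ sub]) (auto simp: lefschetz_gens_def assms(3))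
  then have "component (grade C) x k \<in> {x. f x = g x}" for k
    using lefschetz_decomposition[OF grade_component, of x k] by blast
  then have "(\<Sum>k\<le>2 * cdim C. component (grade C) x k) \<in> {x. f x = g x}"
    by (intro csubspace_sum[OF sub])
  then show ?thesis using grade_expand[of x] by simp
qed

lemma hodge_grade:
  assumes "x \<in> grade C k" shows "hodge C x \<in> grade C (2 * cdim C - k)"
proof -
  have "csubspace {x. hodge C x \<in> grade C (2 * cdim C - k)}"
    using grade_csubspace[of "2 * cdim C - k"] by (auto simp: csubspace_iff clinear_simps[OF hodge_linear])
  moreover have "lefschetz_gens k \<subseteq> {x. hodge C x \<in> grade C (2 * cdim C - k)}"
  proof safe
    fix x assume "x \<in> lefschetz_gens k"
    then obtain j \<alpha> a b where x: "x = \<sigma> ^ j * \<alpha>" and \<alpha>: "\<alpha> \<in> primitive C (a + b)" "\<alpha> \<in> bigrade C (a, b)"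
        and le: "a + b + j \<le> cdim C" "a + b + 2 * j = k"
      unfolding lefschetz_gens_def by blast
    have "\<sigma> ^ (cdim C - j - (a + b)) * \<alpha> \<in> grade C (2 * (cdim C - j - (a + b)) + (a + b))"
      using bigrade_grade \<alpha>(2) by (intro sigma_power_grade) auto
    moreover have "2 * (cdim C - j - (a + b)) + (a + b) = 2 * cdim C - k" using le by simp
    ultimately show "hodge C x \<in> grade C (2 * cdim C - k)"
      unfolding x hodge_formula[OF \<alpha> le(1)] by (intro complex_vector.subspace_scale[OF grade_csubspace]) simp
  qed
  ultimately show ?thesis
    using lefschetz_decomposition[OF assms] complex_vector.span_minimal by blast
qed

text \<open>\<open>B\<close> has bidegree \<open>(0, 0)\<close> and commutes with \<open>\<sigma>\<close>, so it preserves the spaces of primitive forms of a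
  given bidegree.\<close>

lemma hodge_right_linear: "hodge C (x * emb C b) = hodge C x * emb C b"
proof (rule lefschetz_induct[where f = "\<lambda>x. hodge C (x * emb C b)" and g = "\<lambda>x. hodge C x * emb C b"])
  fix j \<alpha> p q assume \<alpha>: "\<alpha> \<in> primitive C (p + q)" "\<alpha> \<in> bigrade C (p, q)" "p + q + j \<le> cdim C"
  have "\<alpha> * emb C b \<in> bigrade C (p, q)"
    using bigrade_mult[OF \<alpha>(2) emb_bigrade[of b]] by simp
  moreover have "\<alpha> * emb C b \<in> primitive C (p + q)"
    using \<alpha>(1,3) bigrade_grade[of p q] \<open>\<alpha> * emb C b \<in> bigrade C (p, q)\<close>
    by (auto simp: primitive_def mult.assoc[symmetric])
  ultimately show "hodge C (\<sigma> ^ j * \<alpha> * emb C b) = hodge C (\<sigma> ^ j * \<alpha>) * emb C b"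
    using hodge_formula[of "\<alpha> * emb C b" p q j] hodge_formula[OF \<alpha>] \<alpha>(3)
    by (simp add: mult.assoc mult_scaleC_left)
qed (simp_all add: clinear_iff distrib_right mult_scaleC_left clinear_simps[OF hodge_linear])

lemma hodge_left_linear: "hodge C (emb C b * x) = emb C b * hodge C x"
proof (rule lefschetz_induct[where f = "\<lambda>x. hodge C (emb C b * x)" and g = "\<lambda>x. emb C b * hodge C x"])
  fix j \<alpha> p q assume \<alpha>: "\<alpha> \<in> primitive C (p + q)" "\<alpha> \<in> bigrade C (p, q)" "p + q + j \<le> cdim C"
  have comm: "\<sigma> ^ r * (emb C b * y) = emb C b * (\<sigma> ^ r * y)" for r y
    by (metis mult.assoc sigma_power_central)
  have "emb C b * \<alpha> \<in> bigrade C (p, q)"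
    using bigrade_mult[OF emb_bigrade[of b] \<alpha>(2)] by simp
  moreover have "emb C b * \<alpha> \<in> primitive C (p + q)"
    using \<alpha>(1,3) bigrade_grade[of p q] \<open>emb C b * \<alpha> \<in> bigrade C (p, q)\<close> comm[of "Suc (cdim C - (p + q))" \<alpha>]
    by (auto simp: primitive_def)
  ultimately show "hodge C (emb C b * (\<sigma> ^ j * \<alpha>)) = emb C b * hodge C (\<sigma> ^ j * \<alpha>)"
    using hodge_formula[of "emb C b * \<alpha>" p q j] hodge_formula[OF \<alpha>] \<alpha>(3)
    by (simp add: comm mult_scaleC_right)
qed (simp_all add: clinear_iff distrib_left mult_scaleC_right clinear_simps[OF hodge_linear])

end


section \<open>Covariance of the metric\<close>

lemma add_subgroup_ctsub: "add_subgroup (ctsub U V)"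
  unfolding ctsub_def by (rule add_subgroup_add_span)

lemma ctsub_mono: "V \<subseteq> V' \<Longrightarrow> ctsub U V \<subseteq> ctsub U V'"
  unfolding ctsub_def by (intro hull_mono) blast

lemma ctmap_cbalanced: "clinear f \<Longrightarrow> clinear g \<Longrightarrow> cbalanced (\<lambda>x y. ctens (f x) (g y))"
  by (rule cbalanced_ctens_map[where s = "\<lambda>c. c"]) (auto simp: clinear_simps)

lemma ctmap_linear:
  assumes "clinear f" "clinear g" shows "clinear (ctmap f g)"
proof -
  note Bal = ctmap_cbalanced[OF assms]
  have "sw (\<lambda>x y. ctens (f x) (g y)) (scaleC c t) = scaleC c (sw (\<lambda>x y. ctens (f x) (g y)) t)" for c t
    by (rule sw_scaleC[OF Bal]) (simp add: clinear_simps[OF assms(1)] ctens_scaleC)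
  then show ?thesis
    unfolding ctmap_def clinear_iff by (simp add: sw_add[OF Bal])
qed

lemma ctmap_ctens: "clinear f \<Longrightarrow> clinear g \<Longrightarrow> ctmap f g (ctens a x) = ctens (f a) (g x)"
  unfolding ctmap_def by (rule sw_ctens[OF ctmap_cbalanced])

lemma ctmap_conj:
  assumes "conj_linear f" "conj_linear g"
  shows "ctmap f g (t + u) = ctmap f g t + ctmap f g u" "ctmap f g (scaleC c t) = scaleC (cnj c) (ctmap f g t)"
    "ctmap f g (ctens a x) = ctens (f a) (g x)"
proof -
  have Bal: "cbalanced (\<lambda>x y. ctens (f x) (g y))"
    by (rule cbalanced_ctens_map[where s = cnj]) (use assms in \<open>auto simp: conj_linear_def\<close>)
  show "ctmap f g (t + u) = ctmap f g t + ctmap f g u" "ctmap f g (ctens a x) = ctens (f a) (g x)"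
    unfolding ctmap_def by (rule sw_add[OF Bal], rule sw_ctens[OF Bal])
  show "ctmap f g (scaleC c t) = scaleC (cnj c) (ctmap f g t)"
    unfolding ctmap_def
    by (rule frag_induct_tensor[OF is_tensor_product_ctens, of "\<lambda>t. sw (\<lambda>x y. ctens (f x) (g y)) (scaleC c t)
        = scaleC (cnj c) (sw (\<lambda>x y. ctens (f x) (g y)) t)"])
      (use assms in \<open>simp_all add: sw_ctens[OF Bal] sw_diff[OF Bal] ctens_scaleC(1)[symmetric]
        complex_vector.scale_right_diff_distrib conj_linear_def\<close>)
qed

text \<open>Independence of the left legs makes \<open>id \<otimes> f\<close> injective for injective \<open>f\<close>.\<close>

lemma ctmap_id_kernel:
  assumes f: "clinear f" and t: "ctmap id f t = 0" and U: "csubspace U" "t \<in> ctsub UNIV U"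
  obtains S x where "finite S" "t = (\<Sum>a\<in>S. ctens a (x a))" "\<And>a. a \<in> S \<Longrightarrow> x a \<in> U" "\<And>a. a \<in> S \<Longrightarrow> f (x a) = 0"
proof -
  obtain S :: "'c set" and x \<phi> where S: "finite S" "\<And>a. a \<in> S \<Longrightarrow> x a \<in> U" "t = (\<Sum>a\<in>S. ctens a (x a))"
    and \<phi>: "\<And>a. a \<in> S \<Longrightarrow> clinear (\<phi> a)" "\<And>a b. a \<in> S \<Longrightarrow> b \<in> S \<Longrightarrow> \<phi> a b = (of_bool (a = b) :: complex)"
    by (rule ctensor_independent_left[OF U]) (rule that)
  have "f (x a) = 0" if a: "a \<in> S" for a
  proof -
    have "0 = sw (\<lambda>p y. scaleC (\<phi> a p) y) (ctmap id f t)"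
      unfolding t by (rule sw_0[OF cbalanced_scaled[OF \<phi>(1)[OF a]], symmetric])
    also have "\<dots> = (\<Sum>b\<in>S. scaleC (\<phi> a b) (f (x b)))"
      unfolding S(3) ctmap_sum[OF clinear_ident f] sw_sum_ctens[OF cbalanced_scaled[OF \<phi>(1)[OF a]]] by simp
    also have "\<dots> = f (x a)"
      using a S(1) by (simp add: \<phi>(2) of_bool_def if_distrib[of "\<lambda>c. scaleC c _"] scaleC_one cong: if_cong)
    finally show ?thesis ..
  qed
  with S that show ?thesis by blast
qed

context cqga_homogeneous_space
begin

lemma ctmap_incl_zero:
  assumes "ctmap id (incl X) t = 0" shows "t = 0"
proof -
  have "csubspace UNIV" "t \<in> ctsub UNIV UNIV"
    by (auto simp: ctsub_UNIV csubspace_iff)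
  from ctmap_id_kernel[OF incl_linear assms this]
  obtain S x where "t = (\<Sum>a\<in>S. ctens a (x a))" "\<And>a. a \<in> S \<Longrightarrow> incl X (x a) = 0" by metis
  then show ?thesis
    using incl_eq[of _ 0] by (simp add: clinear_0[OF incl_linear] biadditive_zero[OF ctens_biadditive])
qed

lemma bcoact_star: "bcoact X (bstar X b) = ctmap (hstar (total X)) (bstar X) (bcoact X b)"
proof -
  obtain T y where T: "bcoact X b = (\<Sum>t\<in>T. ctens t (y t))" by (rule ctensor_sum_rep)
  let ?d = "bcoact X (bstar X b) - ctmap (hstar (total X)) (bstar X) (bcoact X b)"
  have "ctmap id (incl X) ?d = 0"
    unfolding clinear_diff[OF ctmap_linear[OF clinear_ident incl_linear]] left_coideal incl_star
    by (simp add: A.comult_star_sum[OF comult_incl[OF T]] T ctmap_sum_conj[OF A.star_conj_linear bstar_conj_linear]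
        ctmap_sum[OF clinear_ident incl_linear] incl_star)
  then have "?d = 0" by (rule ctmap_incl_zero)
  then show ?thesis by simp
qed

end

context cqh_hermitian_space
begin

lemma wstar_add: "wstar C (x + y) = wstar C x + wstar C y"
  and wstar_scaleC: "wstar C (scaleC c x) = scaleC (cnj c) (wstar C x)"
  using wstar_conj_linear by (auto simp: conj_linear_def)

lemma wstar_0 [simp]: "wstar C 0 = 0"
  using wstar_add[of 0 0] by simp

lemmas wstar_sum = conj_linear_sum[OF wstar_conj_linear]

lemma wmult_zip:
  "ctzip (*) (*) (\<Sum>i\<in>I. ctens (a i) (x i)) (\<Sum>j\<in>J. ctens (b j) (y j))
    = (\<Sum>i\<in>I. \<Sum>j\<in>J. ctens (a i * b j) (x i * y j))"
  for a b :: "_ \<Rightarrow> 'r::complex_algebra_1" and x y :: "_ \<Rightarrow> 's::complex_algebra_1"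
  by (rule ctzip_sum[where s = "\<lambda>c. c"])
    (auto simp: biadditive_def distrib_left distrib_right mult_scaleC_left mult_scaleC_right)

lemma wcoact_emb_sum:
  "bcoact X b = (\<Sum>t\<in>T. ctens t (y t)) \<Longrightarrow> wcoact C (emb C b) = (\<Sum>t\<in>T. ctens t (emb C (y t)))"
  by (simp add: wcoact_emb ctmap_sum[OF clinear_ident emb_linear])

text \<open>Multiplicativity of the coaction holds for the factors \<open>b\<close> by the module axiom and for the
  factors \<open>d b\<close> because \<open>d b \<and> \<omega> = d(b \<omega>) - b d\<omega>\<close>; these generate \<open>\<Omega>\<^sup>\<bullet>\<close>.\<close>

lemma wcoact_mult: "wcoact C (x * y) = ctzip (*) (*) (wcoact C x) (wcoact C y)"
proof -
  define U where "U = {x. \<forall>y. wcoact C (x * y) = ctzip (*) (*) (wcoact C x) (wcoact C y)}"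
  have Bal: "cbalanced (\<lambda>x y. sw (\<lambda>u v. ctens (x * u) (y * v)) t)" for t :: "('a, 'w) ctensor"
    by (rule ctzip_cbalanced(1)[where s = "\<lambda>c. c"])
      (auto simp: biadditive_def distrib_left distrib_right mult_scaleC_left mult_scaleC_right)
  have emb: "emb C b \<in> U" for b
  proof -
    have "wcoact C (emb C b * y) = ctzip (*) (*) (wcoact C (emb C b)) (wcoact C y)" for y
    proof -
      obtain T z where T: "bcoact X b = (\<Sum>t\<in>T. ctens t (z t))" by (rule ctensor_sum_rep)
      obtain S x where S: "wcoact C y = (\<Sum>s\<in>S. ctens s (x s))" by (rule ctensor_sum_rep)
      show ?thesis
        unfolding Om.coact_lact_sum[OF T S] wcoact_emb_sum[OF T] S wmult_zip ..
    qed
    then show ?thesis by (simp add: U_def)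
  qed
  have d: "dform C (emb C b) \<in> U" for b
  proof -
    have "wcoact C (dform C (emb C b) * y) = ctzip (*) (*) (wcoact C (dform C (emb C b))) (wcoact C y)" for y
    proof -
      obtain T z where T: "wcoact C (emb C b) = (\<Sum>t\<in>T. ctens t (z t))" "\<And>t. t \<in> T \<Longrightarrow> z t \<in> grade C 0"
      proof -
        obtain T z where T: "bcoact X b = (\<Sum>t\<in>T. ctens t (z t))" by (rule ctensor_sum_rep)
        show ?thesis using that[OF wcoact_emb_sum[OF T]] emb_grade by blast
      qed
      obtain S x where S: "wcoact C y = (\<Sum>s\<in>S. ctens s (x s))" by (rule ctensor_sum_rep)
      have leib: "dform C (w * y) = dform C w * y + w * dform C y" if "w \<in> grade C 0" for w y
        using d_leibniz[OF that] by simp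
      note dlin = ctmap_sum[OF clinear_ident d_linear]
      have dS: "wcoact C (dform C y) = (\<Sum>s\<in>S. ctens s (dform C (x s)))"
        unfolding d_comodule_map S dlin by simp
      have "wcoact C (dform C (emb C b) * y) = wcoact C (dform C (emb C b * y)) - wcoact C (emb C b * dform C y)"
        by (simp add: leib[OF emb_grade] clinear_simps[OF Om.coact_linear])
      also have "wcoact C (dform C (emb C b * y)) = (\<Sum>t\<in>T. \<Sum>s\<in>S. ctens (t * s) (dform C (z t * x s)))"
      proof -
        have "wcoact C (emb C b * y) = (\<Sum>p\<in>T \<times> S. ctens (fst p * snd p) (z (fst p) * x (snd p)))"
          using emb[of b] by (simp add: U_def T S wmult_zip sum.cartesian_product split_beta)
        then show ?thesis
          unfolding d_comodule_map by (simp add: dlin sum.cartesian_product split_beta)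
      qed
      also have "wcoact C (emb C b * dform C y) = (\<Sum>t\<in>T. \<Sum>s\<in>S. ctens (t * s) (z t * dform C (x s)))"
        using emb[of b] by (simp add: U_def T dS wmult_zip)
      also have "(\<Sum>t\<in>T. \<Sum>s\<in>S. ctens (t * s) (dform C (z t * x s))) - (\<Sum>t\<in>T. \<Sum>s\<in>S. ctens (t * s) (z t * dform C (x s)))
          = (\<Sum>t\<in>T. \<Sum>s\<in>S. ctens (t * s) (dform C (z t) * x s))"
        by (simp add: sum_subtractf[symmetric] leib T(2) ctens_add)
      also have "\<dots> = ctzip (*) (*) (wcoact C (dform C (emb C b))) (wcoact C y)"
        unfolding d_comodule_map T(1) dlin S wmult_zip by simp
      finally show ?thesis .
    qed
    then show ?thesis by (simp add: U_def)
  qed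
  have "subalgebra U"
    unfolding subalgebra_def
  proof (intro conjI ballI)
    show "csubspace U"
    proof -
      have sc: "sw (\<lambda>x y. sw (\<lambda>u v. ctens (x * u) (y * v)) t) (scaleC c s)
          = scaleC c (sw (\<lambda>x y. sw (\<lambda>u v. ctens (x * u) (y * v)) t) s)" for c s and t :: "('a, 'w) ctensor"
      proof (rule sw_scaleC[OF Bal])
        fix x :: 'a and y :: 'w
        obtain R q where R: "t = (\<Sum>r\<in>R. ctens r (q r))" by (rule ctensor_sum_rep)
        have B: "cbalanced (\<lambda>u v. ctens (x * u) (y * v))" for x :: 'a and y :: 'w
          by (rule ctmap_cbalanced) (auto simp: clinear_iff distrib_left mult_scaleC_right)
        show "sw (\<lambda>u v. ctens (scaleC c x * u) (y * v)) t = scaleC c (sw (\<lambda>u v. ctens (x * u) (y * v)) t)"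
          unfolding R sw_sum_ctens[OF B] by (simp add: mult_scaleC_left ctens_scaleC scaleC_sum_right)
      qed
      show ?thesis
        by (auto simp: csubspace_iff U_def distrib_right mult_scaleC_left clinear_simps[OF Om.coact_linear]
            ctzip_def sw_0[OF Bal] sw_add[OF Bal] sc)
    qed
    show "1 \<in> U" using emb[of 1] by simp
    show "x * x' \<in> U" if "x \<in> U" "x' \<in> U" for x x'
    proof -
      have "wcoact C (x * x' * y) = ctzip (*) (*) (wcoact C (x * x')) (wcoact C y)" for y
      proof -
        obtain R r where R: "wcoact C x = (\<Sum>s\<in>R. ctens s (r s))" by (rule ctensor_sum_rep)
        obtain S x'' where S: "wcoact C x' = (\<Sum>s\<in>S. ctens s (x'' s))" by (rule ctensor_sum_rep)
        obtain T z where T: "wcoact C y = (\<Sum>t\<in>T. ctens t (z t))" by (rule ctensor_sum_rep)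
        have 1: "wcoact C (x * x') = (\<Sum>p\<in>R \<times> S. ctens (fst p * snd p) (r (fst p) * x'' (snd p)))"
          using that(1) by (simp add: U_def R S wmult_zip sum.cartesian_product split_beta)
        have 2: "wcoact C (x' * y) = (\<Sum>p\<in>S \<times> T. ctens (fst p * snd p) (x'' (fst p) * z (snd p)))"
          using that(2) by (simp add: U_def T S wmult_zip sum.cartesian_product split_beta)
        have "wcoact C (x * (x' * y)) = ctzip (*) (*) (wcoact C x) (wcoact C (x' * y))"
          using that(1) by (simp add: U_def)
        also have "\<dots> = (\<Sum>s\<in>R. \<Sum>p\<in>S \<times> T. ctens (s * (fst p * snd p)) (r s * (x'' (fst p) * z (snd p))))"
          unfolding R 2 wmult_zip ..
        also have "\<dots> = ctzip (*) (*) (wcoact C (x * x')) (wcoact C y)"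
          unfolding 1 T wmult_zip by (simp add: sum.cartesian_product' mult.assoc)
        finally show ?thesis by (simp add: mult.assoc)
      qed
      then show ?thesis by (simp add: U_def)
    qed
  qed
  moreover have "range (emb C) \<union> range (\<lambda>b. dform C (emb C b)) \<subseteq> U"
    using emb d by blast
  ultimately have "subalgebra hull (range (emb C) \<union> range (\<lambda>b. dform C (emb C b))) \<subseteq> U"
    by (intro hull_minimal)
  then show ?thesis
    unfolding generated U_def by blast
qed

lemma wcoact_mult_sum:
  assumes "wcoact C x = (\<Sum>i\<in>I. ctens (a i) (p i))" "wcoact C y = (\<Sum>j\<in>J. ctens (c j) (q j))"
  shows "wcoact C (x * y) = (\<Sum>i\<in>I. \<Sum>j\<in>J. ctens (a i * c j) (p i * q j))"
  unfolding wcoact_mult assms wmult_zip ..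

lemma wcoact_grade:
  assumes "x \<in> grade C k" shows "wcoact C x \<in> ctsub UNIV (grade C k)"
proof -
  have "wcoact C x = (\<Sum>a\<le>k. wcoact C (component (bigrade C) x (a, k - a)))"
    using bigrade_expand[OF assms] clinear_sum[OF Om.coact_linear] by metis
  also have "\<dots> \<in> ctsub UNIV (grade C k)"
  proof (intro add_subgroup_sum[OF add_subgroup_ctsub])
    fix a assume "a \<in> {..k}"
    then show "wcoact C (component (bigrade C) x (a, k - a)) \<in> ctsub UNIV (grade C k)"
      using bigrade_covariant[OF bigrade_component, of x "(a, k - a)"]
        ctsub_mono[OF bigrade_grade[of a "k - a"], of UNIV] by auto
  qed
  finally show ?thesis .
qed

lemma wcoact_grade_rep:
  assumes "x \<in> grade C k"
  obtains S p where "finite S" "wcoact C x = (\<Sum>s\<in>S. ctens s (p s))" "\<And>s. s \<in> S \<Longrightarrow> p s \<in> grade C k"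
  using ctensor_independent_left[OF grade_csubspace wcoact_grade[OF assms]] by metis

lemma wcoact_component: "wcoact C (component (grade C) x k) = ctmap id (\<lambda>x. component (grade C) x k) (wcoact C x)"
proof -
  let ?c = "component (grade C)"
  note lin = ctmap_linear[OF clinear_ident grade_component_linear]
  have 1: "ctmap id (\<lambda>x. ?c x k) (wcoact C y) = (if l = k then wcoact C y else 0)" if y: "y \<in> grade C l" for y l
  proof -
    obtain S p where S: "wcoact C y = (\<Sum>s\<in>S. ctens s (p s))" "\<And>s. s \<in> S \<Longrightarrow> p s \<in> grade C l"
      using wcoact_grade_rep[OF y] by metis
    have "ctmap id (\<lambda>x. ?c x k) (wcoact C y) = (\<Sum>s\<in>S. ctens s (?c (p s) k))"
      unfolding S(1) ctmap_sum[OF clinear_ident grade_component_linear] by simp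
    also have "\<dots> = (\<Sum>s\<in>S. if l = k then ctens s (p s) else 0)"
      by (intro sum.cong refl) (auto simp: grade_component_of[OF S(2)] biadditive_zero[OF ctens_biadditive])
    finally show ?thesis by (simp add: S(1))
  qed
  have "ctmap id (\<lambda>x. ?c x k) (wcoact C x) = ctmap id (\<lambda>x. ?c x k) (wcoact C (\<Sum>l\<le>2 * cdim C. ?c x l))"
    using grade_expand[of x] by simp
  also have "\<dots> = (\<Sum>l\<le>2 * cdim C. if l = k then wcoact C (?c x l) else 0)"
    by (simp add: clinear_sum[OF Om.coact_linear] clinear_sum[OF lin] 1[OF grade_component])
  also have "\<dots> = wcoact C (?c x k)"
  proof (cases "k \<le> 2 * cdim C")
    case False
    then have "?c x k = 0" using grade_zero[OF _ grade_component, of k x] by simp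
    with False show ?thesis by (simp add: clinear_0[OF Om.coact_linear])
  qed simp
  finally show ?thesis ..
qed

lemma grade_component_mult:
  "component (grade C) (x * y) k = (\<Sum>i\<le>2 * cdim C. \<Sum>j\<le>2 * cdim C.
     if i + j = k then component (grade C) x i * component (grade C) y j else 0)"
proof -
  let ?c = "component (grade C)"
  have "x * y = (\<Sum>i\<le>2 * cdim C. ?c x i) * (\<Sum>j\<le>2 * cdim C. ?c y j)"
    using grade_expand[of x] grade_expand[of y] by simp
  then have "?c (x * y) k = (\<Sum>i\<le>2 * cdim C. \<Sum>j\<le>2 * cdim C. ?c (?c x i * ?c y j) k)"
    by (simp add: sum_product clinear_sum[OF grade_component_linear])
  also have "\<dots> = (\<Sum>i\<le>2 * cdim C. \<Sum>j\<le>2 * cdim C. if i + j = k then ?c x i * ?c y j else 0)"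
    by (intro sum.cong refl) (auto simp: grade_component_of[OF grade_mult[OF grade_component grade_component]])
  finally show ?thesis .
qed

text \<open>The sign rule for \<open>(\<omega> \<and> \<nu>)\<^sup>*\<close> requires homogeneous factors; the coaction preserves degrees, so the forms whose
  homogeneous components satisfy the equation are a subalgebra.  It contains \<open>b\<close> and \<open>db\<close>.\<close>

lemma wcoact_star: "wcoact C (wstar C x) = ctmap (hstar (total X)) (wstar C) (wcoact C x)"
proof -
  let ?st = "ctmap (hstar (total X)) (wstar C)" and ?c = "component (grade C)"
  note st = ctmap_conj[OF A.star_conj_linear wstar_conj_linear]
  note st_sum = ctmap_sum_conj[OF A.star_conj_linear wstar_conj_linear]
  define Good where "Good = {x. wcoact C (wstar C x) = ?st (wcoact C x)}"
  have st0: "?st 0 = 0"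
    using st(1)[of 0 0] by simp
  have Good: "csubspace Good"
    by (auto simp: csubspace_iff Good_def wstar_add wstar_scaleC clinear_simps[OF Om.coact_linear] st st0)
  have mult: "x * y \<in> Good" if x: "x \<in> grade C k" "x \<in> Good" and y: "y \<in> grade C l" "y \<in> Good" for x y k l
  proof -
    obtain S p where S: "wcoact C x = (\<Sum>s\<in>S. ctens s (p s))" "\<And>s. s \<in> S \<Longrightarrow> p s \<in> grade C k"
      using wcoact_grade_rep[OF x(1)] by metis
    obtain T q where T: "wcoact C y = (\<Sum>s\<in>T. ctens s (q s))" "\<And>s. s \<in> T \<Longrightarrow> q s \<in> grade C l"
      using wcoact_grade_rep[OF y(1)] by metis
    have Sx: "wcoact C (wstar C x) = (\<Sum>s\<in>S. ctens (hstar (total X) s) (wstar C (p s)))"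
      using x(2) by (simp add: Good_def S(1) st_sum)
    have Ty: "wcoact C (wstar C y) = (\<Sum>s\<in>T. ctens (hstar (total X) s) (wstar C (q s)))"
      using y(2) by (simp add: Good_def T(1) st_sum)
    have "?st (wcoact C (x * y)) = ?st (\<Sum>r\<in>S \<times> T. ctens (fst r * snd r) (p (fst r) * q (snd r)))"
      by (simp add: wcoact_mult_sum[OF S(1) T(1)] sum.cartesian_product split_beta)
    also have "\<dots> = (\<Sum>s\<in>S. \<Sum>t\<in>T. ctens (hstar (total X) (s * t)) (wstar C (p s * q t)))"
      unfolding st_sum by (simp add: sum.cartesian_product split_beta)
    also have "\<dots> = scaleC ((- 1) ^ (k * l)) (\<Sum>t\<in>T. \<Sum>s\<in>S. ctens (hstar (total X) t * hstar (total X) s) (wstar C (q t) * wstar C (p s)))"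
      by (subst sum.swap) (simp add: A.star_mult wstar_mult[OF S(2) T(2)] power_minus_one_mult ctens_scaleC scaleC_sum_right)
    also have "\<dots> = wcoact C (wstar C (x * y))"
      by (simp add: wstar_mult[OF x(1) y(1)] power_minus_one_mult clinear_scaleC[OF Om.coact_linear]
          wcoact_mult_sum[OF Ty Sx])
    finally show ?thesis by (simp add: Good_def)
  qed
  have emb_Good: "emb C b \<in> Good" for b
  proof -
    obtain T y where T: "bcoact X b = (\<Sum>t\<in>T. ctens t (y t))" by (rule ctensor_sum_rep)
    show ?thesis
      unfolding Good_def mem_Collect_eq wstar_emb wcoact_emb bcoact_star T
        ctmap_sum_conj[OF A.star_conj_linear bstar_conj_linear] ctmap_sum[OF clinear_ident emb_linear] st_sum
      by (simp add: wstar_emb)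
  qed
  define U where "U = {x. \<forall>k. ?c x k \<in> Good}"
  have "subalgebra U"
    unfolding subalgebra_def
  proof (intro conjI ballI)
    show "csubspace U"
      using Good by (auto simp: csubspace_iff U_def clinear_simps[OF grade_component_linear])
    have "1 \<in> Good" using emb_Good[of 1] by simp
    then show "1 \<in> U"
      using grade_component_of[of 1 0] emb_grade[of 1] complex_vector.subspace_0[OF Good] by (simp add: U_def)
    show "x * y \<in> U" if "x \<in> U" "y \<in> U" for x y
    proof -
      have "?c (x * y) k \<in> Good" for k
        unfolding grade_component_mult[of x y k] using that complex_vector.subspace_0[OF Good]
        by (intro csubspace_sum[OF Good]) (simp add: U_def mult[OF grade_component _ grade_component])
      then show ?thesis by (simp add: U_def)
    qed
  qed
  moreover have "emb C b \<in> U" for b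
    using grade_component_of[OF emb_grade[of b]] emb_Good[of b] complex_vector.subspace_0[OF Good] by (simp add: U_def)
  moreover have "dform C (emb C b) \<in> U" for b
  proof -
    obtain T y where T: "bcoact X b = (\<Sum>t\<in>T. ctens t (y t))" by (rule ctensor_sum_rep)
    have "dform C (emb C b) \<in> Good"
      unfolding Good_def mem_Collect_eq wstar_d[symmetric] wstar_emb d_comodule_map wcoact_emb bcoact_star T
        ctmap_sum_conj[OF A.star_conj_linear bstar_conj_linear] ctmap_sum[OF clinear_ident emb_linear]
        ctmap_sum[OF clinear_ident d_linear] st_sum
      by (simp add: wstar_emb flip: wstar_d)
    then show ?thesis
      using grade_component_of[OF d_grade[OF emb_grade[of b]]] complex_vector.subspace_0[OF Good] by (simp add: U_def)
  qed
  ultimately have "subalgebra hull (range (emb C) \<union> range (\<lambda>b. dform C (emb C b))) \<subseteq> U"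
    by (intro hull_minimal) auto
  then have "?c x k \<in> Good" for k
    unfolding generated by (auto simp: U_def)
  then have "(\<Sum>k\<le>2 * cdim C. ?c x k) \<in> Good"
    by (intro csubspace_sum[OF Good])
  then show ?thesis using grade_expand[of x] by (simp add: Good_def)
qed

lemma wcoact_sigma_power: "wcoact C (\<sigma> ^ r) = ctens 1 (\<sigma> ^ r)"
proof (induction r)
  case 0
  have "bcoact X 1 - ctens 1 1 = 0"
  proof -
    have "ctmap id (incl X) (bcoact X 1 - ctens 1 1) = 0"
      by (simp add: clinear_diff[OF ctmap_linear[OF clinear_ident incl_linear]] left_coideal A.comult_one
          ctmap_ctens[OF clinear_ident incl_linear])
    then show ?thesis by (rule ctmap_incl_zero)
  qed
  then show ?case
    using wcoact_emb[of 1] ctmap_ctens[OF clinear_ident emb_linear, of 1 1] by simp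
next
  case (Suc r)
  show ?case
    using wcoact_mult_sum[of \<sigma> "\<lambda>_. 1" "\<lambda>_. \<sigma>" "{()}" "\<sigma> ^ r" "\<lambda>_. 1" "\<lambda>_. \<sigma> ^ r" "{()}"] Suc kform_coinvariant
    by simp
qed

lemma wcoact_sigma_mult:
  "wcoact C (\<sigma> ^ r * x) = ctmap id (\<lambda>x. \<sigma> ^ r * x) (wcoact C x)"
proof -
  obtain S p where S: "wcoact C x = (\<Sum>s\<in>S. ctens s (p s))" by (rule ctensor_sum_rep)
  have lin: "clinear (\<lambda>x. \<sigma> ^ r * x)"
    by (simp add: clinear_iff distrib_left mult_scaleC_right)
  show ?thesis
    using wcoact_mult_sum[of "\<sigma> ^ r" "\<lambda>_. 1" "\<lambda>_. \<sigma> ^ r" "{()}", OF _ S] wcoact_sigma_power[of r]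
    by (simp add: S ctmap_sum[OF clinear_ident lin])
qed

text \<open>Coinvariance of \<open>\<sigma>\<close> makes the primitive forms of each bidegree a subcomodule, on which the Hodge map is
  multiplication by a power of \<open>\<sigma>\<close>.\<close>

lemma wcoact_hodge: "wcoact C (hodge C x) = ctmap id (hodge C) (wcoact C x)"
proof (rule lefschetz_induct[where f = "\<lambda>x. wcoact C (hodge C x)" and g = "\<lambda>x. ctmap id (hodge C) (wcoact C x)"])
  show "clinear (\<lambda>x. wcoact C (hodge C x))"
    by (rule clinear_compose[OF Om.coact_linear hodge_linear])
  show "clinear (\<lambda>x. ctmap id (hodge C) (wcoact C x))"
    by (rule clinear_compose[OF ctmap_linear[OF clinear_ident hodge_linear] Om.coact_linear])
next
  fix j \<alpha> a b assume \<alpha>: "\<alpha> \<in> primitive C (a + b)" "\<alpha> \<in> bigrade C (a, b)" "a + b + j \<le> cdim C"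
  define k where "k = cdim C - (a + b) + 1"
  have lin: "clinear (\<lambda>x. \<sigma> ^ r * x)" for r
    by (simp add: clinear_iff distrib_left mult_scaleC_right)
  have "\<sigma> ^ k * \<alpha> = 0"
    using \<alpha>(1,3) by (auto simp: primitive_def k_def split: if_splits)
  then have "ctmap id (\<lambda>x. \<sigma> ^ k * x) (wcoact C \<alpha>) = 0"
    unfolding wcoact_sigma_mult[symmetric] by (simp add: clinear_0[OF Om.coact_linear])
  then obtain S p where S: "wcoact C \<alpha> = (\<Sum>s\<in>S. ctens s (p s))" "\<And>s. s \<in> S \<Longrightarrow> p s \<in> bigrade C (a, b)"
      "\<And>s. s \<in> S \<Longrightarrow> \<sigma> ^ k * p s = 0"
    using ctmap_id_kernel[OF lin _ bigrade_csubspace bigrade_covariant[OF \<alpha>(2)]] by metis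
  have prim: "p s \<in> primitive C (a + b)" if "s \<in> S" for s
    using S(2,3)[OF that] bigrade_grade[of a b] \<alpha>(3) by (auto simp: primitive_def k_def)
  let ?k = "(- 1) ^ ((a + b) * (a + b + 1) div 2) * \<i> powi (int a - int b) * (fact j / fact (cdim C - j - (a + b)))"
  have "wcoact C (hodge C (\<sigma> ^ j * \<alpha>)) = (\<Sum>s\<in>S. ctens s (scaleC ?k (\<sigma> ^ (cdim C - j - (a + b)) * p s)))"
    unfolding hodge_formula[OF \<alpha>] clinear_scaleC[OF Om.coact_linear] wcoact_sigma_mult S(1)
      ctmap_sum[OF clinear_ident lin]
    by (simp add: ctens_scaleC scaleC_sum_right)
  also have "\<dots> = (\<Sum>s\<in>S. ctens s (hodge C (\<sigma> ^ j * p s)))"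
    by (intro sum.cong refl) (simp add: hodge_formula[OF prim S(2) \<alpha>(3)])
  also have "\<dots> = ctmap id (hodge C) (wcoact C (\<sigma> ^ j * \<alpha>))"
    unfolding wcoact_sigma_mult S(1) ctmap_sum[OF clinear_ident lin] ctmap_sum[OF clinear_ident hodge_linear] by simp
  finally show "wcoact C (hodge C (\<sigma> ^ j * \<alpha>)) = ctmap id (hodge C) (wcoact C (\<sigma> ^ j * \<alpha>))" .
qed

text \<open>The metric before \<open>\<Omega>\<^sup>0\<close> is identified with \<open>B\<close>.\<close>

definition metric_form where
  "metric_form \<omega> \<nu> = (\<Sum>k\<le>2 * cdim C. hodge C (hodge C (wstar C (component (grade C) \<omega> k)) * component (grade C) \<nu> k))"

lemma emb_metric: "emb C (metric C \<omega> \<nu>) = metric_form \<omega> \<nu>"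
proof -
  have "hodge C (hodge C (wstar C (component (grade C) \<omega> k)) * component (grade C) \<nu> k) \<in> grade C 0" if "k \<le> 2 * cdim C" for k
  proof -
    have "hodge C (wstar C (component (grade C) \<omega> k)) * component (grade C) \<nu> k \<in> grade C (2 * cdim C - k + k)"
      by (intro grade_mult hodge_grade wstar_grade grade_component)
    then show ?thesis using hodge_grade that by fastforce
  qed
  then have "metric_form \<omega> \<nu> \<in> grade C 0"
    unfolding metric_form_def by (intro csubspace_sum[OF grade_csubspace]) auto
  then show ?thesis
    unfolding metric_def metric_form_def[symmetric] emb_range[symmetric] using f_the_inv_into_f[OF emb_inj] by auto
qed

lemmas form_lin = clinear_simps[OF hodge_linear] clinear_simps[OF grade_component_linear]

lemma metric_form_biadditive: "biadditive metric_form"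
  by (auto simp: biadditive_def metric_form_def form_lin wstar_add distrib_left distrib_right sum.distrib)

lemma metric_form_scaleC: "metric_form \<omega> (scaleC c \<nu>) = scaleC c (metric_form \<omega> \<nu>)"
    "metric_form (scaleC c \<omega>) \<nu> = scaleC (cnj c) (metric_form \<omega> \<nu>)"
  by (simp_all add: metric_form_def form_lin wstar_scaleC mult_scaleC_left mult_scaleC_right scaleC_sum_right)

lemma metric_biadditive: "biadditive (metric C)"
  and metric_scaleC_right: "metric C \<omega> (scaleC c \<nu>) = scaleC c (metric C \<omega> \<nu>)"
  and metric_scaleC_left: "metric C (scaleC c \<omega>) \<nu> = scaleC (cnj c) (metric C \<omega> \<nu>)"
  by (simp_all add: biadditive_def emb_eq[symmetric] emb_metric clinear_simps[OF emb_linear] metric_form_scaleC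
      biadditive_left[OF metric_form_biadditive] biadditive_right[OF metric_form_biadditive] del: emb_eq)

lemma wstar_mult_emb: "wstar C (\<omega> * emb C b) = emb C (bstar X b) * wstar C \<omega>"
  and wstar_emb_mult: "wstar C (emb C b * \<omega>) = wstar C \<omega> * emb C (bstar X b)"
proof -
  let ?c = "component (grade C) \<omega>"
  have "wstar C (?c k * emb C b) = emb C (bstar X b) * wstar C (?c k)"
    "wstar C (emb C b * ?c k) = wstar C (?c k) * emb C (bstar X b)" for k
    using wstar_mult[OF grade_component emb_grade] wstar_mult[OF emb_grade grade_component] by (simp_all add: wstar_emb)
  then have "wstar C ((\<Sum>k\<le>2 * cdim C. ?c k) * emb C b) = emb C (bstar X b) * wstar C (\<Sum>k\<le>2 * cdim C. ?c k)"
    "wstar C (emb C b * (\<Sum>k\<le>2 * cdim C. ?c k)) = wstar C (\<Sum>k\<le>2 * cdim C. ?c k) * emb C (bstar X b)"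
    by (simp_all add: sum_distrib_left sum_distrib_right wstar_sum)
  then show "wstar C (\<omega> * emb C b) = emb C (bstar X b) * wstar C \<omega>"
    "wstar C (emb C b * \<omega>) = wstar C \<omega> * emb C (bstar X b)"
    using grade_expand[of \<omega>] by simp_all
qed

lemma grade_component_emb: "component (grade C) (\<omega> * emb C b) k = component (grade C) \<omega> k * emb C b"
proof -
  let ?c = "component (grade C)"
  have "?c (\<omega> * emb C b) k = ?c ((\<Sum>i\<le>2 * cdim C. ?c \<omega> i) * emb C b) k"
    using grade_expand[of \<omega>] by simp
  also have "\<dots> = (\<Sum>i\<le>2 * cdim C. if i = k then ?c \<omega> i * emb C b else 0)"
    unfolding sum_distrib_right clinear_sum[OF grade_component_linear]
    by (intro sum.cong refl) (auto simp: grade_component_of[OF grade_mult[OF grade_component emb_grade]])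
  also have "\<dots> = component (grade C) \<omega> k * emb C b"
    using grade_zero[OF _ grade_component, of k \<omega>] by (cases "k \<le> 2 * cdim C") auto
  finally show ?thesis .
qed

lemma metric_mult_right: "metric C \<omega> (\<nu> * emb C b) = metric C \<omega> \<nu> * b"
  and metric_mult_left: "metric C (\<omega> * emb C b) \<nu> = bstar X b * metric C \<omega> \<nu>"
proof -
  have "emb C (metric C \<omega> (\<nu> * emb C b)) = emb C (metric C \<omega> \<nu> * b)"
    unfolding emb_metric emb_mult
    by (simp add: metric_form_def grade_component_emb hodge_right_linear sum_distrib_right flip: mult.assoc)
  then show "metric C \<omega> (\<nu> * emb C b) = metric C \<omega> \<nu> * b" by simp
  have "emb C (metric C (\<omega> * emb C b) \<nu>) = emb C (bstar X b * metric C \<omega> \<nu>)"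
    unfolding emb_metric emb_mult
    by (simp add: metric_form_def grade_component_emb wstar_mult_emb hodge_left_linear mult.assoc sum_distrib_left)
  then show "metric C (\<omega> * emb C b) \<nu> = bstar X b * metric C \<omega> \<nu>" by simp
qed

definition bform :: "'w \<Rightarrow> 'w \<Rightarrow> complex" where
  "bform \<omega> \<nu> = epsB (metric C \<omega> \<nu>)"

lemma bform_psd: "psd_form bform"
proof (rule psd_formI)
  show "bform x x \<in> nonneg_Reals" for x
  proof (cases "x = 0")
    case True
    then show ?thesis
      by (simp add: bform_def biadditive_zero[OF metric_biadditive] clinear_0[OF epsB_linear])
  next
    case False
    then show ?thesis unfolding bform_def by (intro epsB_bpos positive_definite)
  qed
qed (simp_all add: bform_def biadditive_left[OF metric_biadditive] biadditive_right[OF metric_biadditive]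
    metric_scaleC_right metric_scaleC_left clinear_simps[OF epsB_linear] scaleC_complex_def)

text \<open>Every ingredient of the metric is a comodule map or multiplicative, so the coaction of a value of \<open>g\<close> is
  \<open>\<omega>\<^sub>(\<^sub>-\<^sub>1\<^sub>)\<^sup>* \<nu>\<^sub>(\<^sub>-\<^sub>1\<^sub>) \<otimes> g(\<omega>\<^sub>(\<^sub>0\<^sub>), \<nu>\<^sub>(\<^sub>0\<^sub>))\<close>; now apply \<open>\<epsilon>\<close> to the second leg.\<close>

lemma metric_covariant:
  assumes \<omega>: "wcoact C \<omega> = (\<Sum>i\<in>I. ctens (a i) (p i))" and \<nu>: "wcoact C \<nu> = (\<Sum>j\<in>J. ctens (c j) (q j))"
  shows "incl X (metric C \<omega> \<nu>) = (\<Sum>i\<in>I. \<Sum>j\<in>J. scaleC (bform (p i) (q j)) (hstar (total X) (a i) * c j))"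
proof -
  let ?c = "component (grade C)" and ?s = "hstar (total X)"
  have "wcoact C (metric_form \<omega> \<nu>) = (\<Sum>i\<in>I. \<Sum>j\<in>J. ctens (?s (a i) * c j) (metric_form (p i) (q j)))"
  proof -
    have "wcoact C (hodge C (hodge C (wstar C (?c \<omega> k)) * ?c \<nu> k))
        = (\<Sum>i\<in>I. \<Sum>j\<in>J. ctens (?s (a i) * c j) (hodge C (hodge C (wstar C (?c (p i) k)) * ?c (q j) k)))" for k
    proof -
      have 1: "wcoact C (hodge C (wstar C (?c \<omega> k))) = (\<Sum>i\<in>I. ctens (?s (a i)) (hodge C (wstar C (?c (p i) k))))"
        unfolding wcoact_hodge wcoact_star wcoact_component \<omega> ctmap_sum[OF clinear_ident grade_component_linear]
          ctmap_sum_conj[OF A.star_conj_linear wstar_conj_linear] ctmap_sum[OF clinear_ident hodge_linear] by simp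
      have 2: "wcoact C (?c \<nu> k) = (\<Sum>j\<in>J. ctens (c j) (?c (q j) k))"
        unfolding wcoact_component \<nu> ctmap_sum[OF clinear_ident grade_component_linear] by simp
      have "wcoact C (hodge C (wstar C (?c \<omega> k)) * ?c \<nu> k)
          = (\<Sum>r\<in>I \<times> J. ctens (?s (a (fst r)) * c (snd r)) (hodge C (wstar C (?c (p (fst r)) k)) * ?c (q (snd r)) k))"
        by (simp add: wcoact_mult_sum[OF 1 2] sum.cartesian_product split_beta)
      then show ?thesis
        unfolding wcoact_hodge by (simp add: ctmap_sum[OF clinear_ident hodge_linear] sum.cartesian_product split_beta)
    qed
    then have "wcoact C (metric_form \<omega> \<nu>) = (\<Sum>k\<le>2 * cdim C. \<Sum>i\<in>I. \<Sum>j\<in>J. ctens (?s (a i) * c j)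
        (hodge C (hodge C (wstar C (?c (p i) k)) * ?c (q j) k)))"
      by (simp add: metric_form_def clinear_sum[OF Om.coact_linear])
    also have "\<dots> = (\<Sum>i\<in>I. \<Sum>j\<in>J. ctens (?s (a i) * c j) (metric_form (p i) (q j)))"
      unfolding metric_form_def biadditive_sum_right[OF ctens_biadditive]
      by (subst sum.swap, rule sum.cong[OF refl], rule sum.swap)
    finally show ?thesis .
  qed
  then have wco: "wcoact C (emb C (metric C \<omega> \<nu>)) = (\<Sum>i\<in>I. \<Sum>j\<in>J. ctens (?s (a i) * c j) (emb C (metric C (p i) (q j))))"
    by (simp add: emb_metric)
  define e where "e w = epsB (the_inv (emb C) (?c w 0))" for w
  have elin: "clinear e"
  proof -
    define r where "r w = the_inv (emb C) (?c w 0)" for w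
    have "emb C (r w) = ?c w 0" for w
      unfolding r_def using grade_component[of w 0] emb_range f_the_inv_into_f[OF emb_inj] by auto
    then have "clinear r"
      by (simp add: clinear_iff emb_eq[symmetric] clinear_simps[OF emb_linear] clinear_simps[OF grade_component_linear] del: emb_eq)
    then show ?thesis
      unfolding e_def r_def[symmetric] by (rule clinear_compose[OF epsB_linear])
  qed
  have e_emb: "e (emb C b) = epsB b" for b
    by (simp add: e_def grade_component_of[OF emb_grade])
  note Bal = cbalanced_scaled'[OF elin]
  obtain T y where T: "bcoact X (metric C \<omega> \<nu>) = (\<Sum>t\<in>T. ctens t (y t))" by (rule ctensor_sum_rep)
  have "incl X (metric C \<omega> \<nu>) = sw (\<lambda>a w. scaleC (e w) a) (wcoact C (emb C (metric C \<omega> \<nu>)))"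
    unfolding incl_counit[OF T] wcoact_emb_sum[OF T] sw_sum_ctens[OF Bal] e_emb ..
  also have "\<dots> = (\<Sum>i\<in>I. \<Sum>j\<in>J. scaleC (bform (p i) (q j)) (?s (a i) * c j))"
    unfolding wco by (simp add: sw_sum[OF Bal] sw_ctens[OF Bal] e_emb bform_def)
  finally show ?thesis .
qed

text \<open>Applying \<open>*\<close> to \<open>\<Omega> B\<^sup>+ \<subseteq> B\<^sup>+ \<Omega>\<close> gives the opposite inclusion, so the form \<open>\<epsilon> \<circ> g\<close>, which
  vanishes on \<open>\<Omega> B\<^sup>+\<close>, lives on the fibre \<open>\<Omega> / B\<^sup>+ \<Omega>\<close>.\<close>

lemma bform_mult_right: "bform \<omega> (\<nu> * emb C b) = bform \<omega> \<nu> * epsB b"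
  by (simp add: bform_def metric_mult_right epsB_mult)

lemma bform_mult_left: "bform \<omega> (emb C b * \<nu>) = epsB b * bform \<omega> \<nu>"
proof -
  note lin = psd_clinear[OF bform_psd]
  have zero: "bform \<omega> (emb C b * \<nu>) = 0" if b: "b \<in> bplus X" for b
  proof -
    have "bstar X b \<in> bplus X"
      using b by (simp add: epsB_bplus epsB_star)
    then have "wstar C \<nu> * emb C (bstar X b) \<in> Om.BplusF"
      using Om.ract_minus_counit[of "wstar C \<nu>" "bstar X b"] by (simp add: epsB_bplus)
    then have "bform \<omega> (wstar C (wstar C \<nu> * emb C (bstar X b))) = 0"
    proof (induction rule: add_span_induct)
      case (base x)
      then show ?case by (auto simp: wstar_emb_mult bform_mult_right epsB_star epsB_bplus)
    next
      case (diff x y)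
      have "wstar C (x - y) = wstar C x - wstar C y"
        using wstar_add[of "x - y" y] by simp
      with diff show ?case by (simp add: clinear_simps[OF lin])
    qed (simp add: clinear_simps[OF lin])
    then show ?thesis by (simp add: wstar_mult_emb wstar_involution)
  qed
  have "b - scaleC (epsB b) 1 \<in> bplus X"
    by (simp add: epsB_bplus clinear_simps[OF epsB_linear] scaleC_complex_def)
  from zero[OF this] show ?thesis
    by (simp add: clinear_simps[OF emb_linear] left_diff_distrib clinear_simps[OF lin] mult_scaleC_left scaleC_complex_def)
qed

lemma wcoord_mult_right: "Om.coord (bform e) (\<omega> * emb C b) = Om.coord (bform e) \<omega> * incl X b"
proof -
  obtain S p where S: "wcoact C \<omega> = (\<Sum>s\<in>S. ctens s (p s))" by (rule ctensor_sum_rep)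
  obtain T y where T: "bcoact X b = (\<Sum>t\<in>T. ctens t (y t))" by (rule ctensor_sum_rep)
  have "wcoact C (\<omega> * emb C b) = (\<Sum>r\<in>S \<times> T. ctens (fst r * snd r) (p (fst r) * emb C (y (snd r))))"
    using wcoact_mult_sum[OF S wcoact_emb_sum[OF T]] by (simp add: sum.cartesian_product split_beta)
  note 1 = Om.coord_sum[OF psd_clinear[OF bform_psd] this] Om.coord_sum[OF psd_clinear[OF bform_psd] S]
  show ?thesis
    unfolding 1 incl_counit[OF T]
    by (simp add: sum.cartesian_product' sum_distrib_left sum_distrib_right mult_scaleC_left mult_scaleC_right
        bform_mult_right scaleC_scaleC scaleC_sum_right mult.commute) (rule sum.swap)
qed

lemmas bform_basis = Om.coinvariant_basis[OF bform_psd bform_mult_left]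

lemma metric_coords:
  assumes "\<And>x \<omega>. bform x \<omega> = (\<Sum>i<(m::nat). bform (e i) \<omega> * bform x (e i))"
  shows "incl X (metric C \<omega> \<nu>) = (\<Sum>i<m. hstar (total X) (Om.coord (bform (e i)) \<omega>) * Om.coord (bform (e i)) \<nu>)"
  by (rule Om.form_coords[OF bform_psd assms]) (rule metric_covariant)

end


section \<open>Exterior multiplication on a Hermitian module is bounded\<close>

lemma (in cqga) haar_sum_list_zero:
  assumes "haar H (\<Sum>c\<leftarrow>cs. hstar H c * c) = 0" shows "(\<Sum>c\<leftarrow>cs. hstar H c * c) = 0"
proof -
  have nn: "haar H (\<Sum>c\<leftarrow>cs. hstar H c * c) \<in> nonneg_Reals" for cs
    by (induction cs) (auto simp: clinear_simps[OF haar_linear] haar_state intro: nonneg_Reals_add_I)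
  show ?thesis
    using assms
  proof (induction cs)
    case (Cons c cs)
    have "haar H (hstar H c * c) = 0" "haar H (\<Sum>c\<leftarrow>cs. hstar H c * c) = 0"
      using Cons.prems nn[of cs] haar_state[of c]
      by (auto simp: clinear_simps[OF haar_linear] complex_nonneg_Reals_iff complex_eq_iff)
    then show ?case using Cons.IH haar_faithful[of c] by simp
  qed simp
qed

context cqga_homogeneous_space
begin

lemma incl_sum_list: "incl X (\<Sum>c\<leftarrow>cs. bstar X c * c) = (\<Sum>c\<leftarrow>map (incl X) cs. hstar (total X) c * c)"
  by (induction cs) (auto simp: incl_simps incl_star)

text \<open>Positivity in \<open>B\<close> becomes strict positivity of the integral, since the Haar state is faithful.\<close>

lemma haar_bpos:
  assumes "b \<in> bpos (bstar X)"
  shows "haar (total X) (incl X b) \<in> nonneg_Reals" "haar (total X) (incl X b) \<noteq> 0"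
proof -
  obtain cs where cs: "b \<noteq> 0" "b = (\<Sum>c\<leftarrow>cs. bstar X c * c)"
    using assms by (auto simp: bpos_def)
  have "haar (total X) (\<Sum>c\<leftarrow>cs. hstar (total X) c * c) \<in> nonneg_Reals" for cs
    by (induction cs) (auto simp: clinear_simps[OF A.haar_linear] A.haar_state intro: nonneg_Reals_add_I)
  then show "haar (total X) (incl X b) \<in> nonneg_Reals"
    unfolding cs(2) incl_sum_list .
  show "haar (total X) (incl X b) \<noteq> 0"
  proof
    assume "haar (total X) (incl X b) = 0"
    then have "incl X b = 0"
      unfolding cs(2) incl_sum_list by (rule A.haar_sum_list_zero)
    then show False
      using cs(1) incl_eq[of b 0] by (simp add: clinear_0[OF incl_linear])
  qed
qed

end

context covariant_hermitian_holomorphic_module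
begin

lemma herm_right_dual: "herm M f \<in> right_dual (ract M)"
  and herm_add_left: "herm M (f + g) k = herm M f k + herm M g k"
  and herm_adjoint: "herm M (conj_ract (bstar X) (lact M) f b) k = herm M f (lact M b k)"
  and herm_sym: "herm M f k = bstar X (herm M k f)"
  and herm_pos: "f \<noteq> 0 \<Longrightarrow> herm M f f \<in> bpos (bstar X)"
  using weak_hermitian unfolding weak_hermitian_def bij_betw_def by blast+

lemma herm_add_right: "herm M f (k + l) = herm M f k + herm M f l"
  and herm_ract: "herm M f (ract M k b) = herm M f k * b"
  using herm_right_dual by (auto simp: right_dual_def)

lemma herm_lact: "herm M (lact M b f) k = herm M f (lact M (bstar X b) k)"
  using herm_adjoint[of f "bstar X b" k] by (simp add: conj_ract_def)

lemma herm_scaleC_right: "herm M f (scaleC c k) = scaleC c (herm M f k)"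
  using herm_ract[of f k "scaleC c 1"] by (simp add: F.ract_scalar mult_scaleC_right)

lemma herm_scaleC_left: "herm M (scaleC c f) k = scaleC (cnj c) (herm M f k)"
  using herm_sym[of "scaleC c f" k] herm_sym[of f k] by (simp add: herm_scaleC_right bstar_scaleC)

lemma herm_biadditive: "biadditive (herm M)"
  by (simp add: biadditive_def herm_add_left herm_add_right)

lemma herm_0: "herm M 0 k = 0" "herm M f 0 = 0"
  using biadditive_zero[OF herm_biadditive] by auto

definition fform :: "'f \<Rightarrow> 'f \<Rightarrow> complex" where
  "fform f k = epsB (herm M f k)"

lemma fform_psd: "psd_form fform"
proof (rule psd_formI)
  show "fform x x \<in> nonneg_Reals" for x
    by (cases "x = 0") (simp_all add: fform_def herm_0 clinear_0[OF epsB_linear] epsB_bpos herm_pos)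
qed (simp_all add: fform_def herm_add_left herm_add_right herm_scaleC_left herm_scaleC_right
    clinear_simps[OF epsB_linear] scaleC_complex_def)

lemma bcoact_herm_sum:
  assumes "fcoact M f = (\<Sum>i\<in>I. ctens (a i) (x i))" "fcoact M k = (\<Sum>j\<in>J. ctens (d j) (y j))"
  shows "bcoact X (herm M f k) = (\<Sum>i\<in>I. \<Sum>j\<in>J. ctens (hstar (total X) (a i) * d j) (herm M (x i) (y j)))"
  unfolding herm_covariant assms
  by (rule ctzip_sum[where s = cnj])
    (auto simp: herm_add_left herm_add_right biadditive_def distrib_left distrib_right mult_scaleC_left mult_scaleC_right
      A.star_add A.star_scaleC herm_scaleC_left herm_scaleC_right)

lemma herm_cov:
  assumes "fcoact M f = (\<Sum>i\<in>I. ctens (a i) (x i))" "fcoact M k = (\<Sum>j\<in>J. ctens (d j) (y j))"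
  shows "incl X (herm M f k) = (\<Sum>i\<in>I. \<Sum>j\<in>J. scaleC (fform (x i) (y j)) (hstar (total X) (a i) * d j))"
proof -
  have "bcoact X (herm M f k) = (\<Sum>p\<in>I \<times> J. ctens (hstar (total X) (a (fst p)) * d (snd p)) (herm M (x (fst p)) (y (snd p))))"
    using bcoact_herm_sum[OF assms] by (simp add: sum.cartesian_product split_beta)
  from incl_counit[OF this] show ?thesis
    by (simp add: fform_def sum.cartesian_product split_beta)
qed

definition hip :: "'f \<Rightarrow> 'f \<Rightarrow> complex" where
  "hip f k = haar (total X) (incl X (herm M f k))"

lemma hip_psd: "psd_form hip"
proof (rule psd_formI)
  show "hip x x \<in> nonneg_Reals" for x
    by (cases "x = 0") (simp_all add: hip_def herm_0 clinear_0[OF incl_linear] clinear_0[OF A.haar_linear] haar_bpos herm_pos)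
qed (simp_all add: hip_def herm_add_left herm_add_right herm_scaleC_left herm_scaleC_right
    incl_simps clinear_simps[OF A.haar_linear] scaleC_complex_def)

lemma hip_definite: "hip f f = 0 \<Longrightarrow> f = 0"
  using haar_bpos(2)[OF herm_pos] by (auto simp: hip_def)

lemma hip_invariant:
  assumes "fcoact M f = (\<Sum>i\<in>I. ctens (a i) (x i))" "fcoact M k = (\<Sum>j\<in>J. ctens (d j) (y j))"
  shows "(\<Sum>i\<in>I. \<Sum>j\<in>J. scaleC (hip (x i) (y j)) (hstar (total X) (a i) * d j)) = scaleC (hip f k) 1"
proof -
  have "bcoact X (herm M f k) = (\<Sum>p\<in>I \<times> J. ctens (hstar (total X) (a (fst p)) * d (snd p)) (herm M (x (fst p)) (y (snd p))))"
    using bcoact_herm_sum[OF assms] by (simp add: sum.cartesian_product split_beta)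
  from A.haar_right_sum[OF comult_incl[OF this]] show ?thesis
    by (simp add: hip_def sum.cartesian_product split_beta)
qed

lemmas tens_biadditive = tensor_biadditive[OF tens]
lemmas tens_balanced = tensor_balanced[OF tens]
lemmas tens_scaleC = tensor_scaleC[OF tens]
lemmas tens_induct = frag_induct_tensor[OF tens]

lemma wedge_balanced:
  "biadditive (\<lambda>\<nu> f. tens M (\<omega> * \<nu>) f)" "tens M (\<omega> * (\<nu> * emb C b)) f = tens M (\<omega> * \<nu>) (lact M b f)"
  by (simp_all add: biadditive_def distrib_left biadditive_left[OF tens_biadditive]
      biadditive_right[OF tens_biadditive] tens_balanced[symmetric] mult.assoc)

lemma wedge_tens: "wedge M \<omega> (tens M \<nu> f) = tens M (\<omega> * \<nu>) f"
  unfolding wedge_def by (rule tlift_tensor[OF tens wedge_balanced(1), OF wedge_balanced(2)])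

lemma wedge_diff: "wedge M \<omega> (x - y) = wedge M \<omega> x - wedge M \<omega> y"
  and wedge_add: "wedge M \<omega> (x + y) = wedge M \<omega> x + wedge M \<omega> y"
  unfolding wedge_def
  by (rule tlift_diff[OF tens wedge_balanced(1), OF wedge_balanced(2)],
      rule tlift_add[OF tens wedge_balanced(1), OF wedge_balanced(2)])

lemma wedge_scaleC: "wedge M \<omega> (scaleC c x) = scaleC c (wedge M \<omega> x)"
  by (rule tens_induct[of "\<lambda>x. wedge M \<omega> (scaleC c x) = scaleC c (wedge M \<omega> x)"])
    (simp_all add: tens_scaleC[symmetric] wedge_tens mult_scaleC_right wedge_diff complex_vector.scale_right_diff_distrib)

lemma wedge_linear: "clinear (wedge M \<omega>)"
  by (simp add: clinear_iff wedge_add wedge_scaleC)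

lemma wedge_mult: "wedge M (\<omega> * \<nu>) x = wedge M \<omega> (wedge M \<nu> x)"
  by (rule tens_induct[of "\<lambda>x. wedge M (\<omega> * \<nu>) x = wedge M \<omega> (wedge M \<nu> x)"])
    (simp_all add: wedge_tens wedge_diff mult.assoc)

lemma wedge_add_left: "wedge M (\<omega> + \<nu>) x = wedge M \<omega> x + wedge M \<nu> x"
  by (rule tens_induct[of "\<lambda>x. wedge M (\<omega> + \<nu>) x = wedge M \<omega> x + wedge M \<nu> x"])
    (simp_all add: wedge_tens wedge_diff distrib_right biadditive_left[OF tens_biadditive])

lemma rmul_balanced:
  "biadditive (\<lambda>\<nu> f. tens M \<nu> (ract M f b))" "tens M (\<nu> * emb C c) (ract M f b) = tens M \<nu> (ract M (lact M c f) b)"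
  by (simp_all add: biadditive_def biadditive_left[OF tens_biadditive] biadditive_left[OF F.ract_biadditive]
      biadditive_right[OF tens_biadditive] tens_balanced F.lact_ract)

lemma rmul_tens: "rmul M (tens M \<nu> f) b = tens M \<nu> (ract M f b)"
  unfolding rmul_def by (rule tlift_tensor[OF tens rmul_balanced(1), OF rmul_balanced(2)])

lemma rmul_diff: "rmul M (x - y) b = rmul M x b - rmul M y b"
  unfolding rmul_def by (rule tlift_diff[OF tens rmul_balanced(1), OF rmul_balanced(2)])

lemma wedge_rmul: "wedge M \<omega> (rmul M x b) = rmul M (wedge M \<omega> x) b"
  by (rule tens_induct[of "\<lambda>x. wedge M \<omega> (rmul M x b) = rmul M (wedge M \<omega> x) b"])
    (simp_all add: wedge_tens rmul_tens wedge_diff rmul_diff)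

lemma metricF_inner_balanced:
  "biadditive (\<lambda>\<nu> k. herm M f (lact M (metric C \<omega> \<nu>) k))"
  "herm M f (lact M (metric C \<omega> (\<nu> * emb C b)) k) = herm M f (lact M (metric C \<omega> \<nu>) (lact M b k))"
  by (simp_all add: biadditive_def biadditive_right[OF metric_biadditive] biadditive_left[OF F.lact_biadditive]
      biadditive_right[OF F.lact_biadditive] herm_add_right metric_mult_right F.lact_mult)

text \<open>The metric on the tensor product is a nested lift; both layers are balanced because \<open>g\<close> is \<open>B\<close>-linear on
  the right in each argument and \<open>B\<close> acts on \<open>\<F>\<close> by adjointable operators.\<close>

lemma metricF_outer_balanced:
  "biadditive (\<lambda>\<omega> f. tlift (tens M) (\<lambda>\<nu> k. herm M f (lact M (metric C \<omega> \<nu>) k)) y)" (is ?A)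
  "tlift (tens M) (\<lambda>\<nu> k. herm M f (lact M (metric C (\<omega> * emb C b) \<nu>) k)) y
    = tlift (tens M) (\<lambda>\<nu> k. herm M (lact M b f) (lact M (metric C \<omega> \<nu>) k)) y" (is ?B)
proof -
  define g where "g \<omega> f = tlift (tens M) (\<lambda>\<nu> k. herm M f (lact M (metric C \<omega> \<nu>) k))" for \<omega> f
  have g: "g \<omega> f (tens M \<nu> k) = herm M f (lact M (metric C \<omega> \<nu>) k)"
    "g \<omega> f (x - y) = g \<omega> f x - g \<omega> f y" for \<omega> f \<nu> k x y
    unfolding g_def
    by (rule tlift_tensor[OF tens metricF_inner_balanced(1), OF metricF_inner_balanced(2)],
        rule tlift_diff[OF tens metricF_inner_balanced(1), OF metricF_inner_balanced(2)])
  have "g (\<omega> + \<omega>') f y = g \<omega> f y + g \<omega>' f y" for \<omega> \<omega>' f y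
    by (rule tens_induct[of "\<lambda>y. g (\<omega> + \<omega>') f y = g \<omega> f y + g \<omega>' f y"])
      (simp_all add: g biadditive_left[OF metric_biadditive] biadditive_left[OF F.lact_biadditive] herm_add_right)
  moreover have "g \<omega> (f + f') y = g \<omega> f y + g \<omega> f' y" for \<omega> f f' y
    by (rule tens_induct[of "\<lambda>y. g \<omega> (f + f') y = g \<omega> f y + g \<omega> f' y"])
      (simp_all add: g herm_add_left)
  ultimately show ?A by (simp add: biadditive_def flip: g_def)
  have "g (\<omega> * emb C b) f y = g \<omega> (lact M b f) y"
    by (rule tens_induct[of "\<lambda>y. g (\<omega> * emb C b) f y = g \<omega> (lact M b f) y"])
      (simp_all add: g metric_mult_left F.lact_mult herm_lact)
  then show ?B by (simp only: g_def)
qed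

lemma metricF_tens_left:
  "metricF C M (tens M \<omega> f) y = tlift (tens M) (\<lambda>\<nu> k. herm M f (lact M (metric C \<omega> \<nu>) k)) y"
  unfolding metricF_def
  by (rule tlift_tensor[OF tens]) (rule metricF_outer_balanced(1), rule metricF_outer_balanced(2))

lemma metricF_tens: "metricF C M (tens M \<omega> f) (tens M \<nu> k) = herm M f (lact M (metric C \<omega> \<nu>) k)"
  unfolding metricF_tens_left
  by (rule tlift_tensor[OF tens]) (rule metricF_inner_balanced(1), rule metricF_inner_balanced(2))

lemma metricF_diff_left: "metricF C M (x - x') y = metricF C M x y - metricF C M x' y"
  unfolding metricF_def
  by (rule tlift_diff[OF tens]) (rule metricF_outer_balanced(1), rule metricF_outer_balanced(2))

lemma metricF_range: "range (metricF C M) = right_dual (rmul M)"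
  using hermitian by (simp add: weak_hermitian_def bij_betw_def)

lemma metricF_right_dual: "metricF C M x \<in> right_dual (rmul M)"
  unfolding metricF_range[symmetric] by simp

lemma metricF_lmul: "metricF C M (lmul C M (bstar X b) x) y = metricF C M x (lmul C M b y)"
proof -
  have "\<forall>b x y. metricF C M (conj_ract (bstar X) (lmul C M) x b) y = metricF C M x (lmul C M b y)"
    using hermitian unfolding weak_hermitian_def by (elim conjE)
  then have "\<forall>b x y. metricF C M (lmul C M (bstar X b) x) y = metricF C M x (lmul C M b y)"
    unfolding conj_ract_def .
  from this[rule_format] show ?thesis .
qed

lemma metricF_add_right: "metricF C M x (y + y') = metricF C M x y + metricF C M x y'"
  and metricF_rmul: "metricF C M x (rmul M y b) = metricF C M x y * b"
  using metricF_right_dual by (auto simp: right_dual_def)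

lemma metricF_diff_right: "metricF C M x (y - y') = metricF C M x y - metricF C M x y'"
  using metricF_add_right[of x "y - y'" y'] by simp

text \<open>Multiplication by a form is right \<open>B\<close>-linear, and the metric identifies the right dual of the tensor product
  with its conjugate.\<close>

lemma wedge_adjoint: "\<exists>x'. \<forall>y. metricF C M x (wedge M \<omega> y) = metricF C M x' y"
proof -
  have "(\<lambda>y. metricF C M x (wedge M \<omega> y)) \<in> right_dual (rmul M)"
    by (simp add: right_dual_def wedge_add wedge_rmul metricF_add_right metricF_rmul)
  then have "(\<lambda>y. metricF C M x (wedge M \<omega> y)) \<in> range (metricF C M)"
    by (simp only: metricF_range)
  then show ?thesis by (metis (no_types, lifting) rangeE)
qed

end

locale module_with_left_metric = covariant_hermitian_holomorphic_module X C M
  for X :: "('a::complex_algebra_1, 'q::complex_algebra_1, 'b::complex_algebra_1) hom_space"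
    and C :: "('a, 'b, 'w::complex_algebra_1) calculus"
    and M :: "('a, 'b, 'w, 'f::complex_vector, 't::complex_vector) hmod" +
  fixes ang :: "'f \<Rightarrow> 'f \<Rightarrow> 'b"
  assumes left_metric: "left_metric X M ang"
begin

text \<open>\<open>\<epsilon> \<circ> h\<close> vanishes on \<open>\<F>B\<^sup>+\<close> because \<open>h\<close> is right linear, hence on \<open>B\<^sup>+\<F>\<close>.\<close>

lemma fform_lact: "fform f (lact M b k) = epsB b * fform f k"
proof -
  note L = left_metric[unfolded left_metric_def bij_betw_def]
  have biadd: "biadditive ang"
    using L by (elim conjE)
  have "\<forall>b c f k. ang (lact M b f) (lact M c k) = b * ang f k * bstar X c"
    using L by (elim conjE)
  note sesq = this[rule_format]
  have "\<forall>f k. ang f k = bstar X (ang k f)"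
    using L by (elim conjE)
  note sym = this[rule_format]
  have inj: "inj (\<lambda>k f. ang f k)"
    using L by (elim conjE)
  have "\<forall>f k. bcoact X (ang f k) = ctzip (\<lambda>a c. a * hstar (total X) c) ang (fcoact M f) (fcoact M k)"
    using L by (elim conjE)
  note cov = this[rule_format]
  have nondeg: "f = 0" if "\<And>k. ang f k = 0" for f
  proof -
    have "ang k f = ang k 0" for k
      using sym[of k f] that[of k] by (simp add: biadditive_zero[OF biadd])
    then show ?thesis using injD[OF inj, of f 0] by blast
  qed
  have zero: "fform f (lact M b k) = 0" if b: "b \<in> bplus X" for b
  proof -
    have "lact M b k \<in> add_span {ract M f c | f c. c \<in> bplus X}"
      by (rule F.left_bplus_in_right_bplus[OF biadd sesq cov nondeg hip_psd hip_definite hip_invariant b])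
    then show ?thesis
      by (induction rule: add_span_induct)
        (auto simp: fform_def herm_ract epsB_mult epsB_bplus herm_0 clinear_simps[OF epsB_linear]
          biadditive_diff_right[OF herm_biadditive])
  qed
  have "b - scaleC (epsB b) 1 \<in> bplus X"
    by (simp add: epsB_bplus clinear_simps[OF epsB_linear] scaleC_complex_def)
  from zero[OF this] show ?thesis
    by (simp add: biadditive_diff_left[OF F.lact_biadditive] F.lact_scalar
        clinear_simps[OF psd_clinear[OF fform_psd]] scaleC_complex_def)
qed

lemmas fform_basis = F.coinvariant_basis[OF fform_psd fform_lact]
lemma herm_coords:
  assumes "\<And>x f. fform x f = (\<Sum>i<(l::nat). fform (\<phi> i) f * fform x (\<phi> i))"
  shows "incl X (herm M f k) = (\<Sum>i<l. hstar (total X) (F.coord (fform (\<phi> i)) f) * F.coord (fform (\<phi> i)) k)"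
  by (rule F.form_coords[OF fform_psd assms]) (rule herm_cov)
lemmas fcoord_linear = F.coord_linear[OF psd_clinear[OF fform_psd]]
lemmas fcoord_lact = F.coord_lact[OF psd_clinear[OF fform_psd] fform_lact]
lemmas wcoord_linear = Om.coord_linear[OF psd_clinear[OF bform_psd]]

text \<open>Left multiplication by a form preserves the null space of \<open>\<epsilon> \<circ> g\<close>: after tensoring with a vector
  of norm one in the fibre of \<open>\<F>\<close>, it has an adjoint for the module metric.\<close>

lemma bform_null_mult:
  assumes f: "fform f f \<noteq> 0" and null: "\<And>z. bform z \<nu> = 0"
  shows "bform x (\<omega> * \<nu>) = 0"
proof -
  have tens_form: "epsB (metricF C M (tens M \<omega> k) (tens M \<nu> f)) = bform \<omega> \<nu> * fform k f" for \<omega> \<nu> k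
    using fform_lact[of k "metric C \<omega> \<nu>" f] by (simp add: metricF_tens fform_def bform_def)
  obtain x' where x': "\<And>y. metricF C M (tens M x f) (wedge M \<omega> y) = metricF C M x' y"
    using wedge_adjoint by blast
  have "epsB (metricF C M x' (tens M \<nu> f)) = 0"
    by (rule tens_induct[of "\<lambda>x'. epsB (metricF C M x' (tens M \<nu> f)) = 0"])
      (simp_all add: tens_form null metricF_diff_left clinear_simps[OF epsB_linear])
  then have "bform x (\<omega> * \<nu>) * fform f f = 0"
    by (simp only: x'[symmetric] wedge_tens tens_form)
  then show ?thesis using f by simp
qed

lemma bform_mult_expand:
  assumes f: "fform f f \<noteq> 0"
    and basis: "\<And>x \<omega>. bform x \<omega> = (\<Sum>i<(m::nat). bform (e i) \<omega> * bform x (e i))"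
  shows "bform x (\<omega> * \<nu>) = (\<Sum>i<m. bform (e i) \<nu> * bform x (\<omega> * e i))"
proof -
  let ?r = "\<nu> - (\<Sum>i<m. scaleC (bform (e i) \<nu>) (e i))"
  note lin = clinear_simps[OF psd_clinear[OF bform_psd]] scaleC_complex_def
  have "bform z ?r = 0" for z
    using basis[of z \<nu>] by (simp add: lin)
  from bform_null_mult[OF f this, of x \<omega>] show ?thesis
    by (simp add: lin right_diff_distrib sum_distrib_left mult_scaleC_right)
qed

lemma wcoord_mult:
  assumes f: "fform f f \<noteq> 0"
    and basis: "\<And>x \<omega>. bform x \<omega> = (\<Sum>i<(m::nat). bform (e i) \<omega> * bform x (e i))"
  obtains K where "\<And>x \<nu>. Om.coord (bform x) (\<omega> * \<nu>) = (\<Sum>l<m. K x l * Om.coord (bform (e l)) \<nu>)"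
proof -
  obtain S p where S: "wcoact C \<omega> = (\<Sum>s\<in>S. ctens s (p s))" by (rule ctensor_sum_rep)
  have "Om.coord (bform x) (\<omega> * \<nu>) = (\<Sum>l<m. (\<Sum>s\<in>S. scaleC (bform x (p s * e l)) s) * Om.coord (bform (e l)) \<nu>)" for x \<nu>
  proof -
    obtain T q where T: "wcoact C \<nu> = (\<Sum>t\<in>T. ctens t (q t))" by (rule ctensor_sum_rep)
    have "wcoact C (\<omega> * \<nu>) = (\<Sum>r\<in>S \<times> T. ctens (fst r * snd r) (p (fst r) * q (snd r)))"
      using wcoact_mult_sum[OF S T] by (simp add: sum.cartesian_product split_beta)
    note 1 = Om.coord_sum[OF psd_clinear[OF bform_psd] this]
    have "Om.coord (bform x) (\<omega> * \<nu>) = (\<Sum>s\<in>S. \<Sum>t\<in>T. \<Sum>l<m. scaleC (bform (e l) (q t) * bform x (p s * e l)) (s * t))"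
      unfolding 1 by (subst bform_mult_expand[OF f basis]) (simp add: sum.cartesian_product' scaleC_sum_left)
    also have "\<dots> = (\<Sum>l<m. \<Sum>s\<in>S. \<Sum>t\<in>T. scaleC (bform (e l) (q t) * bform x (p s * e l)) (s * t))"
      by (rule trans[OF _ sum.swap], rule sum.cong[OF refl], rule sum.swap)
    also have "\<dots> = (\<Sum>l<m. (\<Sum>s\<in>S. scaleC (bform x (p s * e l)) s) * Om.coord (bform (e l)) \<nu>)"
      unfolding Om.coord_sum[OF psd_clinear[OF bform_psd] T]
      by (simp add: sum_product mult_scaleC_left mult_scaleC_right scaleC_scaleC mult.commute)
    finally show ?thesis .
  qed
  then show ?thesis by (rule that)
qed

definition tcoord :: "'w \<Rightarrow> 'f \<Rightarrow> 't \<Rightarrow> 'a" where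
  "tcoord e \<phi> = tlift (tens M) (\<lambda>\<omega> f. Om.coord (bform e) \<omega> * F.coord (fform \<phi>) f)"

lemma tcoord_balanced:
  "biadditive (\<lambda>\<omega> f. Om.coord (bform e) \<omega> * F.coord (fform \<phi>) f)"
  "Om.coord (bform e) (\<omega> * emb C b) * F.coord (fform \<phi>) f = Om.coord (bform e) \<omega> * F.coord (fform \<phi>) (lact M b f)"
  by (simp_all add: biadditive_def clinear_simps[OF wcoord_linear] clinear_simps[OF fcoord_linear]
      distrib_left distrib_right wcoord_mult_right fcoord_lact mult.assoc)

lemma tcoord_tens: "tcoord e \<phi> (tens M \<omega> f) = Om.coord (bform e) \<omega> * F.coord (fform \<phi>) f"
  and tcoord_diff: "tcoord e \<phi> (x - y) = tcoord e \<phi> x - tcoord e \<phi> y"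
  unfolding tcoord_def
  by (rule tlift_tensor[OF tens tcoord_balanced(1), OF tcoord_balanced(2)], rule tlift_diff[OF tens tcoord_balanced(1), OF tcoord_balanced(2)])

lemma tcoord_linear: "clinear (tcoord e \<phi>)"
proof -
  have "tcoord e \<phi> (x + y) = tcoord e \<phi> x + tcoord e \<phi> y" for x y
    unfolding tcoord_def by (rule tlift_add[OF tens tcoord_balanced(1), OF tcoord_balanced(2)])
  moreover have "tcoord e \<phi> (scaleC c x) = scaleC c (tcoord e \<phi> x)" for c x
    by (rule tens_induct[of "\<lambda>x. tcoord e \<phi> (scaleC c x) = scaleC c (tcoord e \<phi> x)"])
      (simp_all add: tens_scaleC[symmetric] tcoord_tens clinear_simps[OF wcoord_linear] mult_scaleC_left
        complex_vector.scale_right_diff_distrib tcoord_diff)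
  ultimately show ?thesis by (simp add: clinear_iff)
qed

text \<open>The coordinates of \<open>\<Omega>\<close> and of \<open>\<F>\<close> multiply to coordinates of the tensor product, in which the
  metric is the standard one of \<open>A\<^sup>N\<close>.\<close>

lemma metricF_coords:
  assumes e: "\<And>x \<omega>. bform x \<omega> = (\<Sum>i<(m::nat). bform (e i) \<omega> * bform x (e i))"
    and \<phi>: "\<And>x f. fform x f = (\<Sum>j<(l::nat). fform (\<phi> j) f * fform x (\<phi> j))"
  shows "incl X (metricF C M x y) = (\<Sum>i<m. \<Sum>j<l. hstar (total X) (tcoord (e i) (\<phi> j) x) * tcoord (e i) (\<phi> j) y)"
proof (rule tens_induct[of "\<lambda>x. incl X (metricF C M x y) = (\<Sum>i<m. \<Sum>j<l. hstar (total X) (tcoord (e i) (\<phi> j) x) * tcoord (e i) (\<phi> j) y)"])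
  show "incl X (metricF C M (tens M \<omega> f) y) = (\<Sum>i<m. \<Sum>j<l. hstar (total X) (tcoord (e i) (\<phi> j) (tens M \<omega> f)) * tcoord (e i) (\<phi> j) y)" for \<omega> f
  proof (rule tens_induct[of "\<lambda>y. incl X (metricF C M (tens M \<omega> f) y) = (\<Sum>i<m. \<Sum>j<l. hstar (total X) (tcoord (e i) (\<phi> j) (tens M \<omega> f)) * tcoord (e i) (\<phi> j) y)"])
    fix \<nu> k
    have "incl X (metricF C M (tens M \<omega> f) (tens M \<nu> k))
        = (\<Sum>j<l. hstar (total X) (F.coord (fform (\<phi> j)) f) * (incl X (metric C \<omega> \<nu>) * F.coord (fform (\<phi> j)) k))"
      unfolding metricF_tens herm_coords[OF \<phi>] fcoord_lact ..
    also have "\<dots> = (\<Sum>i<m. \<Sum>j<l. hstar (total X) (tcoord (e i) (\<phi> j) (tens M \<omega> f)) * tcoord (e i) (\<phi> j) (tens M \<nu> k))"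
      unfolding metric_coords[OF e] tcoord_tens A.star_mult
      by (simp add: sum_distrib_left sum_distrib_right mult.assoc) (rule sum.swap)
    finally show "incl X (metricF C M (tens M \<omega> f) (tens M \<nu> k))
      = (\<Sum>i<m. \<Sum>j<l. hstar (total X) (tcoord (e i) (\<phi> j) (tens M \<omega> f)) * tcoord (e i) (\<phi> j) (tens M \<nu> k))" .
  qed (simp add: metricF_diff_right incl_simps tcoord_diff right_diff_distrib sum_subtractf)
qed (simp add: metricF_diff_left incl_simps tcoord_diff A.star_diff left_diff_distrib sum_subtractf)

lemma tcoord_wedge:
  assumes "\<And>x \<nu>. Om.coord (bform x) (\<omega> * \<nu>) = (\<Sum>l<(m::nat). K x l * Om.coord (bform (e l)) \<nu>)"
  shows "tcoord z \<phi> (wedge M \<omega> x) = (\<Sum>l<m. K z l * tcoord (e l) \<phi> x)"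
  by (rule tens_induct[of "\<lambda>x. tcoord z \<phi> (wedge M \<omega> x) = (\<Sum>l<m. K z l * tcoord (e l) \<phi> x)"])
    (simp_all add: wedge_tens wedge_diff tcoord_tens tcoord_diff assms sum_distrib_right mult.assoc
      right_diff_distrib sum_subtractf)

text \<open>In coordinates both claims concern \<open>A\<^sup>N\<close> with the inner product of the Haar state, on which matrices over \<open>A\<close>
  act boundedly.\<close>

lemma module_inner_psd: "psd_form (module_inner X C M)"
  and module_inner_wedge_bounded:
    "\<exists>K\<ge>0. \<forall>x. Re (module_inner X C M (wedge M \<omega> x) (wedge M \<omega> x)) \<le> K * Re (module_inner X C M x x)"
proof -
  let ?h = "haar (total X)" and ?s = "hstar (total X)"
  obtain m :: nat and e where e: "\<And>i j. i < m \<Longrightarrow> j < m \<Longrightarrow> bform (e i) (e j) = of_bool (i = j)"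
      "\<And>x \<omega>. bform x \<omega> = (\<Sum>i<m. bform (e i) \<omega> * bform x (e i))"
    by (rule bform_basis) (rule that)
  obtain l :: nat and \<phi> where \<phi>: "\<And>i j. i < l \<Longrightarrow> j < l \<Longrightarrow> fform (\<phi> i) (\<phi> j) = of_bool (i = j)"
      "\<And>x f. fform x f = (\<Sum>j<l. fform (\<phi> j) f * fform x (\<phi> j))"
    by (rule fform_basis) (rule that)
  have ip: "module_inner X C M x y = (\<Sum>i<m. \<Sum>j<l. ?h (?s (tcoord (e i) (\<phi> j) x) * tcoord (e i) (\<phi> j) y))" for x y
    unfolding module_inner_def metricF_coords[OF e(2) \<phi>(2)] by (simp add: clinear_simps[OF A.haar_linear])
  show "psd_form (module_inner X C M)"
  proof (rule psd_formI)
    show "module_inner X C M x x \<in> nonneg_Reals" for x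
      unfolding ip using A.haar_state by (auto simp: complex_nonneg_Reals_iff intro!: sum_nonneg sum.neutral)
  qed (simp_all add: ip clinear_simps[OF tcoord_linear] A.star_add A.star_scaleC distrib_left distrib_right
      mult_scaleC_left mult_scaleC_right clinear_simps[OF A.haar_linear] sum.distrib sum_distrib_left scaleC_complex_def)
  show "\<exists>K\<ge>0. \<forall>x. Re (module_inner X C M (wedge M \<omega> x) (wedge M \<omega> x)) \<le> K * Re (module_inner X C M x x)"
  (* Without basis vectors in the fibre of F the inner product is zero. *)
  proof (cases "l = 0")
    case True
    then show ?thesis by (auto simp: ip)
  next
    case False
    then have "fform (\<phi> 0) (\<phi> 0) \<noteq> 0" using \<phi>(1)[of 0 0] by simp
    from wcoord_mult[OF this e(2), of \<omega>]
    obtain K where K: "\<And>x \<nu>. Om.coord (bform x) (\<omega> * \<nu>) = (\<Sum>l<m. K x l * Om.coord (bform (e l)) \<nu>)"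
      by metis
    note wedge = tcoord_wedge[OF K]
    have nn: "0 \<le> Re (?h (?s y * y))" for y
      using psd_nonneg[OF A.haar_psd] .
    obtain B where B: "B \<ge> 0" "\<And>f. Re (?h (?s (\<Sum>i<m. f i) * (\<Sum>i<m. f i))) \<le> B * (\<Sum>i<m. Re (?h (?s (f i) * f i)))"
      using A.hnorm2_sum[of "{..<m}"] by auto
    have "\<exists>D. \<forall>i k. D i k \<ge> 0 \<and> (\<forall>y. Re (?h (?s (K (e i) k * y) * (K (e i) k * y))) \<le> D i k * Re (?h (?s y * y)))"
    proof -
      have "\<exists>d\<ge>0. \<forall>y. Re (?h (?s (z * y) * (z * y))) \<le> d * Re (?h (?s y * y))" for z
        by (rule A.left_mult_bounded[of z]) blast
      then obtain d where "\<forall>z. d z \<ge> 0 \<and> (\<forall>y. Re (?h (?s (z * y) * (z * y))) \<le> d z * Re (?h (?s y * y)))"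
        by metis
      then show ?thesis by (intro exI[of _ "\<lambda>i k. d (K (e i) k)"]) blast
    qed
    then obtain D where D: "\<And>i k. D i k \<ge> 0"
        "\<And>i k y. Re (?h (?s (K (e i) k * y) * (K (e i) k * y))) \<le> D i k * Re (?h (?s y * y))" by blast
    define N where "N = B * (\<Sum>i<m. \<Sum>k<m. D i k)"
    have "Re (module_inner X C M (wedge M \<omega> x) (wedge M \<omega> x)) \<le> N * Re (module_inner X C M x x)" for x
    proof -
      let ?n = "\<lambda>i j. Re (?h (?s (tcoord (e i) (\<phi> j) x) * tcoord (e i) (\<phi> j) x))"
      have total: "Re (module_inner X C M x x) = (\<Sum>j<l. \<Sum>i<m. ?n i j)"
        unfolding ip by (simp add: sum.swap[of _ "{..<l}"])
      have "Re (module_inner X C M (wedge M \<omega> x) (wedge M \<omega> x)) \<le> (\<Sum>i<m. \<Sum>j<l. B * (\<Sum>k<m. D i k * ?n k j))"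
        unfolding ip Re_sum wedge
        by (intro sum_mono order_trans[OF B(2)] mult_left_mono B(1) D(2))
      also have "\<dots> \<le> (\<Sum>i<m. \<Sum>j<l. B * ((\<Sum>k<m. D i k) * (\<Sum>k<m. ?n k j)))"
      proof (intro sum_mono mult_left_mono B(1))
        fix i j
        have "(\<Sum>k<m. D i k * ?n k j) \<le> (\<Sum>k<m. D i k * (\<Sum>k<m. ?n k j))"
          using nn by (intro sum_mono mult_left_mono D(1) member_le_sum) auto
        then show "(\<Sum>k<m. D i k * ?n k j) \<le> (\<Sum>k<m. D i k) * (\<Sum>k<m. ?n k j)"
          by (simp add: sum_distrib_right)
      qed
      also have "\<dots> = N * Re (module_inner X C M x x)"
      proof -
        have "(\<Sum>i<m. \<Sum>j<l. B * (d i * q j)) = B * (\<Sum>i<m. d i) * (\<Sum>j<l. q j)" for d q :: "nat \<Rightarrow> real"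
          unfolding mult.assoc sum_product unfolding sum_distrib_left ..
        then show ?thesis unfolding N_def total .
      qed
      finally show ?thesis .
    qed
    moreover have "N \<ge> 0"
      unfolding N_def using B(1) D(1) by (intro mult_nonneg_nonneg sum_nonneg) auto
    ultimately show ?thesis by blast
  qed
qed

end


section \<open>Commutators of connections with multiplication operators\<close>

context cqh_hermitian_space
begin

lemma bigrade_component_emb: "component (bigrade C) (x * emb C b) p = component (bigrade C) x p * emb C b"
    "component (bigrade C) (emb C b * x) p = emb C b * component (bigrade C) x p"
proof -
  let ?c = "component (bigrade C)"
  define I where "I = insert p {p. ?c x p \<noteq> 0}"
  have I: "finite I" "p \<in> I"
    unfolding I_def using component_finite[OF bigrade_direct_sum] by auto
  have x: "x = (\<Sum>q\<in>I. ?c x q)"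
    using component_expand'[OF bigrade_direct_sum, of x I] I by (auto simp: I_def)
  have mult: "?c x q * emb C b \<in> bigrade C q" "emb C b * ?c x q \<in> bigrade C q" for q
    using bigrade_mult[OF _ emb_bigrade, of "?c x q" "fst q" "snd q" b]
      bigrade_mult[OF emb_bigrade, of "?c x q" "fst q" "snd q" b] bigrade_component[of x q] by simp_all
  have "?c (x * emb C b) p = (\<Sum>q\<in>I. ?c (?c x q * emb C b) p)" "?c (emb C b * x) p = (\<Sum>q\<in>I. ?c (emb C b * ?c x q) p)"
    by (subst x, simp add: sum_distrib_left sum_distrib_right clinear_sum[OF bigrade_component_linear])+
  then show "?c (x * emb C b) p = ?c x p * emb C b" "?c (emb C b * x) p = emb C b * ?c x p"
    using I by (simp_all add: bigrade_component_of[OF mult(1)] bigrade_component_of[OF mult(2)] cong: if_cong)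
qed

lemma degree_sign_linear: "clinear (degree_sign C)"
  unfolding degree_sign_def power_minus_one_mult
  by (intro clinear_sum_fun) (simp add: clinear_iff clinear_simps[OF grade_component_linear] scaleC_add_right scaleC_scaleC mult.commute)

lemma degree_sign_grade: "x \<in> grade C k \<Longrightarrow> degree_sign C x = (- 1) ^ k * x"
proof -
  assume x: "x \<in> grade C k"
  have "degree_sign C x = (\<Sum>l\<le>2 * cdim C. if l = k then (- 1) ^ k * x else 0)"
    unfolding degree_sign_def by (intro sum.cong refl) (simp add: grade_component_of[OF x])
  then show ?thesis
    using grade_zero[OF _ x] by (cases "k \<le> 2 * cdim C") auto
qed

lemma degree_sign_emb: "degree_sign C (x * emb C b) = degree_sign C x * emb C b"
  and degree_sign_emb_left: "degree_sign C (emb C b * x) = emb C b * degree_sign C x"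
proof -
  have left: "component (grade C) (emb C b * x) k = emb C b * component (grade C) x k" for k
  proof -
    let ?c = "component (grade C)"
    have "?c (emb C b * x) k = ?c (emb C b * (\<Sum>i\<le>2 * cdim C. ?c x i)) k"
      using grade_expand[of x] by simp
    also have "\<dots> = (\<Sum>i\<le>2 * cdim C. if i = k then emb C b * ?c x i else 0)"
      unfolding sum_distrib_left clinear_sum[OF grade_component_linear]
      by (intro sum.cong refl) (auto simp: grade_component_of[OF grade_mult[OF emb_grade grade_component]])
    also have "\<dots> = emb C b * ?c x k"
      using grade_zero[OF _ grade_component, of k x] by (cases "k \<le> 2 * cdim C") auto
    finally show ?thesis .
  qed
  show "degree_sign C (x * emb C b) = degree_sign C x * emb C b"
    by (simp add: degree_sign_def grade_component_emb sum_distrib_right power_minus_one_mult mult_scaleC_left)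
  show "degree_sign C (emb C b * x) = emb C b * degree_sign C x"
    by (simp add: degree_sign_def left sum_distrib_left power_minus_one_mult mult_scaleC_right)
qed

text \<open>The part of the graded Leibniz rule with one factor in \<open>B\<close>, for inhomogeneous \<open>x\<close>; it is what makes
  \<open>conn_ext\<close> well defined and determines its commutators.\<close>

definition derivation_like :: "('w \<Rightarrow> 'w) \<Rightarrow> bool" where
  "derivation_like D \<longleftrightarrow> clinear D
     \<and> (\<forall>x b. D (x * emb C b) = D x * emb C b + degree_sign C x * D (emb C b))
     \<and> (\<forall>x b. D (emb C b * x) = D (emb C b) * x + emb C b * D x)"

lemma derivation_likeI:
  assumes D: "clinear D"
    and right: "\<And>p q x b. x \<in> bigrade C (p, q) \<Longrightarrow> D (x * emb C b) = D x * emb C b + (- 1) ^ (p + q) * (x * D (emb C b))"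
    and left: "\<And>p q x b. x \<in> bigrade C (p, q) \<Longrightarrow> D (emb C b * x) = D (emb C b) * x + emb C b * D x"
  shows "derivation_like D"
  unfolding derivation_like_def
proof (intro conjI allI D)
  fix x b
  let ?c = "component (bigrade C)"
  have x: "x = (\<Sum>q | ?c x q \<noteq> 0. ?c x q)"
    by (rule component_expand[OF bigrade_direct_sum]) simp
  have "D (?c x q * emb C b) = D (?c x q) * emb C b + degree_sign C (?c x q) * D (emb C b)"
    "D (emb C b * ?c x q) = D (emb C b) * ?c x q + emb C b * D (?c x q)" for q
  proof -
    have q: "?c x q \<in> bigrade C (fst q, snd q)"
      using bigrade_component[of x q] by simp
    then have "degree_sign C (?c x q) = (- 1) ^ (fst q + snd q) * ?c x q"
      using bigrade_grade[of "fst q" "snd q"] by (intro degree_sign_grade) auto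
    then show "D (?c x q * emb C b) = D (?c x q) * emb C b + degree_sign C (?c x q) * D (emb C b)"
      "D (emb C b * ?c x q) = D (emb C b) * ?c x q + emb C b * D (?c x q)"
      using right[OF q] left[OF q] by (simp_all add: mult.assoc)
  qed
  then have "D ((\<Sum>q | ?c x q \<noteq> 0. ?c x q) * emb C b) = D (\<Sum>q | ?c x q \<noteq> 0. ?c x q) * emb C b
      + degree_sign C (\<Sum>q | ?c x q \<noteq> 0. ?c x q) * D (emb C b)"
    "D (emb C b * (\<Sum>q | ?c x q \<noteq> 0. ?c x q)) = D (emb C b) * (\<Sum>q | ?c x q \<noteq> 0. ?c x q)
      + emb C b * D (\<Sum>q | ?c x q \<noteq> 0. ?c x q)"
    by (simp_all add: sum_distrib_left sum_distrib_right clinear_sum[OF D] clinear_sum[OF degree_sign_linear] sum.distrib)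
  then show "D (x * emb C b) = D x * emb C b + degree_sign C x * D (emb C b)"
    "D (emb C b * x) = D (emb C b) * x + emb C b * D x"
    unfolding x[symmetric] by simp_all
qed

lemma d_derivation: "derivation_like (dform C)"
proof (rule derivation_likeI[OF d_linear])
  fix p q x b assume "x \<in> bigrade C (p, q)"
  then have "x \<in> grade C (p + q)" using bigrade_grade by blast
  from d_leibniz[OF this]
  show "dform C (x * emb C b) = dform C x * emb C b + (- 1) ^ (p + q) * (x * dform C (emb C b))" .
  show "dform C (emb C b * x) = dform C (emb C b) * x + emb C b * dform C x"
    using d_leibniz[OF emb_grade[of b], of x] by simp
qed

text \<open>The Leibniz rules for \<open>\<partial>\<close> and \<open>\<partial>-bar\<close> are the two bidegree components of the one for \<open>d\<close>.\<close>

lemma del_delbar_leibniz: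
  assumes x: "x \<in> bigrade C (p, q)" and y: "y \<in> bigrade C (r, s)"
  shows "del C (x * y) = del C x * y + (- 1) ^ (p + q) * (x * del C y)"
    and "delbar C (x * y) = delbar C x * y + (- 1) ^ (p + q) * (x * delbar C y)"
proof -
  let ?c = "component (bigrade C)"
  let ?P = "(Suc (p + r), q + s)" and ?Q = "(p + r, Suc (q + s))"
  have xg: "x \<in> grade C (p + q)" using x bigrade_grade by blast
  have xy: "x * y \<in> bigrade C (p + r, q + s)" by (rule bigrade_mult[OF x y])
  have P: "del C (x * y) \<in> bigrade C ?P" "del C x * y + (- 1) ^ (p + q) * (x * del C y) \<in> bigrade C ?P"
    using del_degree[OF xy] bigrade_mult[OF del_degree[OF x] y] bigrade_mult[OF x del_degree[OF y]] bigrade_csubspace[of ?P]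
    by (auto simp: csubspace_iff power_minus_one_mult)
  have Q: "delbar C (x * y) \<in> bigrade C ?Q" "delbar C x * y + (- 1) ^ (p + q) * (x * delbar C y) \<in> bigrade C ?Q"
    using delbar_degree[OF xy] bigrade_mult[OF delbar_degree[OF x] y] bigrade_mult[OF x delbar_degree[OF y]] bigrade_csubspace[of ?Q]
    by (auto simp: csubspace_iff power_minus_one_mult)
  have eq: "del C (x * y) + delbar C (x * y) = (del C x * y + (- 1) ^ (p + q) * (x * del C y))
      + (delbar C x * y + (- 1) ^ (p + q) * (x * delbar C y))"
    using d_leibniz[OF xg, of y] by (simp add: d_split algebra_simps)
  have "?c (del C (x * y) + delbar C (x * y)) ?P = del C (x * y)"
    "?c (del C (x * y) + delbar C (x * y)) ?Q = delbar C (x * y)"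
    by (simp_all add: clinear_add[OF bigrade_component_linear] bigrade_component_of[OF P(1)] bigrade_component_of[OF Q(1)])
  moreover have "?c (del C (x * y) + delbar C (x * y)) ?P = del C x * y + (- 1) ^ (p + q) * (x * del C y)"
    "?c (del C (x * y) + delbar C (x * y)) ?Q = delbar C x * y + (- 1) ^ (p + q) * (x * delbar C y)"
    unfolding eq clinear_add[OF bigrade_component_linear, of "_ + _" "_ + _"]
    by (simp_all only: bigrade_component_of[OF P(2)] bigrade_component_of[OF Q(2)]) simp_all
  ultimately show "del C (x * y) = del C x * y + (- 1) ^ (p + q) * (x * del C y)"
    "delbar C (x * y) = delbar C x * y + (- 1) ^ (p + q) * (x * delbar C y)" by simp_all
qed

lemma del_derivation: "derivation_like (del C)"
  by (rule derivation_likeI[OF del_linear])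
    (use del_delbar_leibniz(1)[OF _ emb_bigrade] del_delbar_leibniz(1)[OF emb_bigrade] in auto)

lemma delbar_derivation: "derivation_like (delbar C)"
  by (rule derivation_likeI[OF delbar_linear])
    (use del_delbar_leibniz(2)[OF _ emb_bigrade] del_delbar_leibniz(2)[OF emb_bigrade] in auto)

end

context covariant_hermitian_holomorphic_module
begin

text \<open>In the commutator of a connection with \<open>b\<close> only the derivative of \<open>b\<close> survives.\<close>

lemma conn_ext_commutator:
  assumes D: "derivation_like D" and nab: "connection C M D U nab"
  shows "commutator (conn_ext C M D nab) (lmul C M b) = wedge M (D (emb C b))"
proof
  fix x
  let ?f = "\<lambda>\<omega> f. tens M (D \<omega>) f + wedge M (degree_sign C \<omega>) (nab f)"
  have Dlin: "clinear D" and Dr: "\<And>x b. D (x * emb C b) = D x * emb C b + degree_sign C x * D (emb C b)"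
    and Dl: "\<And>x b. D (emb C b * x) = D (emb C b) * x + emb C b * D x"
    using D unfolding derivation_like_def by blast+
  have nlin: "clinear nab" and nl: "\<And>b f. nab (lact M b f) = tens M (D (emb C b)) f + lmul C M b (nab f)"
    using nab unfolding connection_def by blast+
  have f: "biadditive ?f"
    by (simp add: biadditive_def clinear_simps[OF Dlin] clinear_simps[OF nlin] clinear_simps[OF degree_sign_linear]
        biadditive_left[OF tens_biadditive] biadditive_right[OF tens_biadditive] wedge_add wedge_add_left)
  have f': "?f (\<omega> * emb C b) k = ?f \<omega> (lact M b k)" for \<omega> b k
    by (simp add: Dr nl biadditive_left[OF tens_biadditive] tens_balanced degree_sign_emb wedge_add wedge_tens
        wedge_mult lmul_def)
  have ext: "conn_ext C M D nab (tens M \<omega> k) = ?f \<omega> k"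
    "conn_ext C M D nab (x - y) = conn_ext C M D nab x - conn_ext C M D nab y" for \<omega> k x y
    unfolding conn_ext_def by (rule tlift_tensor[OF tens f], rule f', rule tlift_diff[OF tens f], rule f')
  show "commutator (conn_ext C M D nab) (lmul C M b) x = wedge M (D (emb C b)) x"
    unfolding commutator_def lmul_def
  proof (rule tens_induct[of "\<lambda>x. conn_ext C M D nab (wedge M (emb C b) x) - wedge M (emb C b) (conn_ext C M D nab x) = wedge M (D (emb C b)) x"])
    show "conn_ext C M D nab (wedge M (emb C b) (tens M m n)) - wedge M (emb C b) (conn_ext C M D nab (tens M m n))
        = wedge M (D (emb C b)) (tens M m n)" for m n
      by (simp add: ext wedge_tens Dl degree_sign_emb_left wedge_mult wedge_add biadditive_left[OF tens_biadditive])
  qed (simp add: ext wedge_diff algebra_simps)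
qed

text \<open>The projection to bidegree \<open>(1, 0)\<close> turns \<open>db\<close> into \<open>\<partial>b\<close>.\<close>

lemma form_part_connection:
  assumes "connection C M (dform C) U nab"
  shows "connection C M (del C) UNIV (\<lambda>f. form_part C M (1, 0) (nab f))"
proof -
  define p :: "nat \<times> nat" where "p = (1, 0)"
  let ?g = "\<lambda>\<omega> f. tens M (component (bigrade C) \<omega> p) f"
  have g: "biadditive ?g"
    by (simp add: biadditive_def clinear_simps[OF bigrade_component_linear]
        biadditive_left[OF tens_biadditive] biadditive_right[OF tens_biadditive])
  have g': "?g (\<omega> * emb C b) k = ?g \<omega> (lact M b k)" for \<omega> b k
    by (simp add: bigrade_component_emb tens_balanced)
  have part: "form_part C M p (tens M \<omega> k) = ?g \<omega> k"
    "form_part C M p (x - y) = form_part C M p x - form_part C M p y"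
    "form_part C M p (x + y) = form_part C M p x + form_part C M p y" for \<omega> k x y
    unfolding form_part_def
    by (rule tlift_tensor[OF tens g], rule g', rule tlift_diff[OF tens g], rule g', rule tlift_add[OF tens g], rule g')
  have nlin: "clinear nab" and nl: "\<And>b f. nab (lact M b f) = tens M (dform C (emb C b)) f + lmul C M b (nab f)"
    using assms unfolding connection_def by blast+
  have scale: "form_part C M p (scaleC c x) = scaleC c (form_part C M p x)" for c x
    by (rule tens_induct[of "\<lambda>x. form_part C M p (scaleC c x) = scaleC c (form_part C M p x)"])
      (simp_all add: tens_scaleC[symmetric] part clinear_simps[OF bigrade_component_linear]
        complex_vector.scale_right_diff_distrib)
  have lmul: "form_part C M p (lmul C M b x) = lmul C M b (form_part C M p x)" for b x
    unfolding lmul_def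
    by (rule tens_induct[of "\<lambda>x. form_part C M p (wedge M (emb C b) x) = wedge M (emb C b) (form_part C M p x)"])
      (simp_all add: wedge_tens part bigrade_component_emb wedge_diff)
  have comp: "component (bigrade C) (dform C (emb C b)) p = del C (emb C b)" for b
    unfolding p_def using bigrade_component_of[OF del_degree[OF emb_bigrade[of b]], of "(1, 0)"]
      bigrade_component_of[OF delbar_degree[OF emb_bigrade[of b]], of "(1, 0)"]
    by (simp add: d_split clinear_add[OF bigrade_component_linear])
  have "x \<in> form_tens M UNIV" for x
  proof (rule tens_induct[of "\<lambda>x. x \<in> form_tens M UNIV"])
    show "tens M m n \<in> form_tens M UNIV" for m n
      unfolding form_tens_def by (rule add_span_base) blast
  qed (simp add: form_tens_def add_span_diff)
  then show ?thesis
    unfolding connection_def p_def[symmetric]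
    by (auto simp: clinear_iff clinear_simps[OF nlin] part(3) scale nl part(1) comp lmul)
qed

lemma lmul_linear: "clinear (lmul C M b)"
  unfolding lmul_def by (rule wedge_linear)

lemma module_inner_lmul: "module_inner X C M (lmul C M b x) y = module_inner X C M x (lmul C M (bstar X b) y)"
  using metricF_lmul[of "bstar X b" x y] by (simp add: module_inner_def)

lemma module_inner_definite: "module_inner X C M x x = 0 \<Longrightarrow> x = 0"
proof -
  have "\<forall>x. x \<noteq> 0 \<longrightarrow> metricF C M x x \<in> bpos (bstar X)"
    using hermitian unfolding weak_hermitian_def by (elim conjE)
  then show "module_inner X C M x x = 0 \<Longrightarrow> x = 0"
    unfolding module_inner_def using haar_bpos(2) by blast
qed

end


section \<open>Bounded operators on pre-Hilbert spaces\<close>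

text \<open>Boundedness in terms of squared norms, which avoids square roots for sums and adjoints.\<close>

definition form_bounded :: "('t \<Rightarrow> 't \<Rightarrow> complex) \<Rightarrow> ('t \<Rightarrow> 't) \<Rightarrow> bool" where
  "form_bounded ip T \<longleftrightarrow> (\<exists>K\<ge>0. \<forall>x. Re (ip (T x) (T x)) \<le> K * Re (ip x x))"

context
  fixes ip :: "'t::complex_vector \<Rightarrow> 't \<Rightarrow> complex"
  assumes psd: "psd_form ip"
begin

lemma form_bounded_add:
  assumes "form_bounded ip S" "form_bounded ip T"
  shows "form_bounded ip (\<lambda>x. S x + T x)"
proof -
  obtain K L where K: "K \<ge> 0" "\<And>x. Re (ip (S x) (S x)) \<le> K * Re (ip x x)"
    and L: "L \<ge> 0" "\<And>x. Re (ip (T x) (T x)) \<le> L * Re (ip x x)"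
    using assms unfolding form_bounded_def by blast
  have "Re (ip (S x + T x) (S x + T x)) \<le> (2 * K + 2 * L) * Re (ip x x)" for x
  proof -
    have "Re (ip (S x + T x) (S x + T x)) + Re (ip (S x - T x) (S x - T x)) = 2 * Re (ip (S x) (S x)) + 2 * Re (ip (T x) (T x))"
      by (simp add: psd_add_left[OF psd] psd_diff_left[OF psd] clinear_simps[OF psd_clinear[OF psd]])
    then show ?thesis
      using psd_nonneg[OF psd, of "S x - T x"] K(2)[of x] L(2)[of x] by (simp add: algebra_simps)
  qed
  moreover have "2 * K + 2 * L \<ge> 0" using K(1) L(1) by simp
  ultimately show ?thesis unfolding form_bounded_def by blast
qed

text \<open>If \<open>T\<close> is bounded, \<open>|Sx|\<^sup>2 = \<langle>x, T S x\<rangle> \<le> |x| |T| |S x|\<close> for its formal adjoint \<open>S\<close>.\<close>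

lemma form_bounded_adjoint:
  assumes T: "form_bounded ip T" and adj: "\<And>x y. ip (S x) y = ip x (T y)"
  shows "form_bounded ip S"
proof -
  obtain K where K: "K \<ge> 0" "\<And>x. Re (ip (T x) (T x)) \<le> K * Re (ip x x)"
    using T unfolding form_bounded_def by blast
  have "Re (ip (S x) (S x)) \<le> K * Re (ip x x)" for x
  proof -
    define s where "s = Re (ip (S x) (S x))"
    have s: "s \<ge> 0" unfolding s_def by (rule psd_nonneg[OF psd])
    have "s\<^sup>2 \<le> (cmod (ip x (T (S x))))\<^sup>2"
      unfolding s_def adj using abs_le_square_iff[of "Re (ip x (T (S x)))" "cmod (ip x (T (S x)))"]
      by (simp add: abs_Re_le_cmod)
    also have "\<dots> \<le> Re (ip x x) * Re (ip (T (S x)) (T (S x)))"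
      by (rule psd_Cauchy_Schwarz[OF psd])
    also have "\<dots> \<le> Re (ip x x) * (K * s)"
      unfolding s_def by (intro mult_left_mono K(2) psd_nonneg[OF psd])
    finally have "s * s \<le> (K * Re (ip x x)) * s"
      by (simp add: power2_eq_square mult_ac)
    then show ?thesis
      using s K(1) psd_nonneg[OF psd, of x] unfolding s_def[symmetric] by (cases "s = 0") auto
  qed
  with K(1) show ?thesis unfolding form_bounded_def by blast
qed

lemma adjoint_clinear:
  assumes definite: "\<And>x. ip x x = 0 \<Longrightarrow> x = 0" and adj: "\<And>x y. ip (S x) y = ip x (T y)"
  shows "clinear S"
proof -
  have eqI: "x = y" if "\<And>z. ip x z = ip y z" for x y
    using definite[of "x - y"] that by (simp add: psd_diff_left[OF psd])
  show ?thesis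
    unfolding clinear_iff
    by (intro conjI allI eqI) (simp_all add: adj psd_add_left[OF psd] psd_scale_left[OF psd])
qed

end

lemma cinner_scaleC_left: "cinner (scaleC c x) y = cnj c * cinner x y" for x y :: "'l::chilbert_space"
  using cinner_commute[of "scaleC c x" y] cinner_commute[of x y] by (simp add: cinner_scaleC_right)

lemma norm_scaleC: "norm (scaleC c x) = cmod c * norm x" for x :: "'l::chilbert_space"
proof -
  have "cinner (scaleC c x) (scaleC c x) = complex_of_real ((cmod c)\<^sup>2) * cinner x x"
    by (simp only: cinner_scaleC_left cinner_scaleC_right complex_norm_square mult_ac)
  then have "Re (cinner (scaleC c x) (scaleC c x)) = (cmod c)\<^sup>2 * Re (cinner x x)"
    by (simp del: of_real_power)
  then show ?thesis
    by (simp add: norm_eq_sqrt_cinner real_sqrt_mult)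
qed

lemma tendsto_scaleC: "(f \<longlongrightarrow> x) F \<Longrightarrow> ((\<lambda>n. scaleC c (f n)) \<longlongrightarrow> scaleC c x) F" for x :: "'l::chilbert_space"
proof -
  assume "(f \<longlongrightarrow> x) F"
  then have "((\<lambda>n. norm (f n - x)) \<longlongrightarrow> 0) F"
    by (intro tendsto_norm_zero) (simp add: LIM_zero_iff)
  then have "((\<lambda>n. cmod c * norm (f n - x)) \<longlongrightarrow> 0) F"
    by (rule tendsto_mult_right_zero)
  then have "((\<lambda>n. norm (scaleC c (f n) - scaleC c x)) \<longlongrightarrow> 0) F"
    by (simp add: norm_scaleC[symmetric] complex_vector.scale_right_diff_distrib)
  then show ?thesis
    by (simp add: tendsto_norm_zero_iff LIM_zero_iff)
qed

lemma bounded_extension: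
  fixes j :: "'t::complex_vector \<Rightarrow> 'l::chilbert_space"
  assumes psd: "psd_form ip" and j: "is_completion ip j" and T: "clinear T" "form_bounded ip T"
  shows "bounded_and_extends ip j T"
proof -
  obtain K where K: "K \<ge> 0" "\<And>x. Re (ip (T x) (T x)) \<le> K * Re (ip x x)"
    using T(2) unfolding form_bounded_def by blast
  have jlin: "clinear j" and jip: "\<And>x y. cinner (j x) (j y) = ip x y" and dense: "closure (range j) = UNIV"
    using j unfolding is_completion_def by blast+
  have norm_j: "norm (j x) = sqrt (Re (ip x x))" for x
    by (simp add: norm_eq_sqrt_cinner jip)
  have bound: "sqrt (Re (ip (T x) (T x))) \<le> sqrt K * sqrt (Re (ip x x))" for x
    using K(2)[of x] by (simp flip: real_sqrt_mult)
  have bound_j: "norm (j (T x)) \<le> sqrt K * norm (j x)" for x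
    using bound by (simp add: norm_j)
  have well: "j (T x) = j (T y)" if "j x = j y" for x y
  proof -
    have "norm (j (T (x - y))) \<le> sqrt K * norm (j (x - y))" by (rule bound_j)
    then show ?thesis using that by (simp add: clinear_simps[OF jlin] clinear_simps[OF T(1)])
  qed
  define g where "g v = j (T (inv_into UNIV j v))" for v
  have g: "g (j x) = j (T x)" for x
    unfolding g_def by (rule well) (simp add: f_inv_into_f)
  have "(sqrt K)-lipschitz_on (range j) g"
  proof (rule lipschitz_onI)
    show "dist (g v) (g w) \<le> sqrt K * dist v w" if vw: "v \<in> range j" "w \<in> range j" for v w
    proof -
      obtain x y where "v = j x" "w = j y" using vw by blast
      then show ?thesis
        using bound_j[of "x - y"] by (simp add: g dist_norm clinear_simps[OF jlin] clinear_simps[OF T(1)])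
    qed
  qed (use K(1) in simp)
  then have "uniformly_continuous_on (range j) g"
    by (rule lipschitz_on_uniformly_continuous)
  then obtain T' where T': "uniformly_continuous_on UNIV T'" "\<And>v. v \<in> range j \<Longrightarrow> g v = T' v"
    using uniformly_continuous_on_extension_on_closure[of "range j" g] unfolding dense by metis
  have T'j: "T' (j x) = j (T x)" for x
    using T'(2)[of "j x"] by (simp add: g)
  have approx: "\<exists>x. (\<lambda>n. j (x n)) \<longlonglongrightarrow> v" for v
  proof -
    have "v \<in> closure (range j)" by (simp add: dense)
    then obtain w where w: "\<And>n. w n \<in> range j" "w \<longlonglongrightarrow> v"
      unfolding closure_sequential by blast
    have "(\<lambda>n. j (inv_into UNIV j (w n))) = w"
      using w(1) by (intro ext f_inv_into_f)
    with w(2) have "(\<lambda>n. j (inv_into UNIV j (w n))) \<longlonglongrightarrow> v" by simp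
    then show ?thesis by (rule exI[where x = "\<lambda>n. inv_into UNIV j (w n)"])
  qed
  have cont: "(\<lambda>n. S (w n)) \<longlonglongrightarrow> S v" if "continuous_on UNIV S" "w \<longlonglongrightarrow> v" for S :: "'l \<Rightarrow> 'l" and w v
    using that continuous_on_tendsto_compose[OF that] by simp
  note contT = cont[OF uniformly_continuous_imp_continuous[OF T'(1)]]
  have add: "T' (u + v) = T' u + T' v" for u v
  proof -
    obtain x y where x: "(\<lambda>n. j (x n)) \<longlonglongrightarrow> u" and y: "(\<lambda>n. j (y n)) \<longlonglongrightarrow> v" using approx by metis
    have "(\<lambda>n. T' (j (x n) + j (y n))) \<longlonglongrightarrow> T' (u + v)"
      by (rule contT[OF tendsto_add[OF x y]])
    moreover have "(\<lambda>n. T' (j (x n)) + T' (j (y n))) \<longlonglongrightarrow> T' u + T' v"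
      by (rule tendsto_add[OF contT[OF x] contT[OF y]])
    moreover have "T' (j p + j q) = T' (j p) + T' (j q)" for p q
      using T'j[of "p + q"] by (simp add: T'j clinear_simps[OF jlin] clinear_simps[OF T(1)])
    ultimately show ?thesis using LIMSEQ_unique by simp
  qed
  have scale: "T' (scaleC c u) = scaleC c (T' u)" for c u
  proof -
    obtain x where x: "(\<lambda>n. j (x n)) \<longlonglongrightarrow> u" using approx by metis
    have "(\<lambda>n. T' (scaleC c (j (x n)))) \<longlonglongrightarrow> T' (scaleC c u)"
      by (rule contT[OF tendsto_scaleC[OF x]])
    moreover have "(\<lambda>n. scaleC c (T' (j (x n)))) \<longlonglongrightarrow> scaleC c (T' u)"
      by (rule tendsto_scaleC[OF contT[OF x]])
    moreover have "T' (scaleC c (j p)) = scaleC c (T' (j p))" for p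
      using T'j[of "scaleC c p"] by (simp add: T'j clinear_simps[OF jlin] clinear_simps[OF T(1)])
    ultimately show ?thesis using LIMSEQ_unique by simp
  qed
  have norm: "norm (T' u) \<le> sqrt K * norm u" for u
  proof -
    obtain x where x: "(\<lambda>n. j (x n)) \<longlonglongrightarrow> u" using approx by metis
    show ?thesis
    proof (rule LIMSEQ_le)
      show "(\<lambda>n. norm (T' (j (x n)))) \<longlonglongrightarrow> norm (T' u)" by (rule tendsto_norm[OF contT[OF x]])
      show "(\<lambda>n. sqrt K * norm (j (x n))) \<longlonglongrightarrow> sqrt K * norm u"
        by (intro tendsto_mult_left tendsto_norm x)
    qed (simp add: T'j bound_j)
  qed
  have "bounded_clinear T'"
    unfolding bounded_clinear_def
  proof
    show "clinear T'" by (simp add: clinear_iff add scale)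
    show "bounded_linear T'"
      by (rule bounded_linear_intro[where K = "sqrt K"]) (simp_all add: add scale scaleR_scaleC norm mult.commute)
  qed
  moreover have "S = T'" if S: "bounded_clinear S" "\<And>x. S (j x) = j (T x)" for S
  proof
    fix v
    obtain x where x: "(\<lambda>n. j (x n)) \<longlonglongrightarrow> v" using approx by metis
    have "(\<lambda>n. S (j (x n))) \<longlonglongrightarrow> S v"
    proof -
      have "bounded_linear S" using S(1) by (simp add: bounded_clinear_def)
      from bounded_linear.tendsto[OF this x] show ?thesis .
    qed
    then show "S v = T' v"
      using contT[OF x] unfolding S(2) T'j by (rule LIMSEQ_unique)
  qed
  ultimately have "\<exists>!T'. bounded_clinear T' \<and> (\<forall>x. T' (j x) = j (T x))"
    using T'j by blast
  moreover have "bounded_wrt ip T"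
    unfolding bounded_wrt_def using bound by blast
  ultimately show ?thesis by (simp add: bounded_and_extends_def)
qed

text \<open>\<open>[S, L]\<close> is adjoint to \<open>- [T, L']\<close>.\<close>

lemma commutator_adjoint_bounded:
  assumes psd: "psd_form ip" and definite: "\<And>x. ip x x = 0 \<Longrightarrow> x = 0"
    and L: "\<And>x y. ip (L x) y = ip x (L' y)" and adj: "is_adjoint ip T S"
    and T: "form_bounded ip (commutator T L')"
  shows "clinear (commutator S L) \<and> form_bounded ip (commutator S L)"
proof -
  have S: "ip (S x) y = ip x (T y)" for x y
    using adj by (simp add: is_adjoint_def)
  have comm: "ip (commutator S L x) y = ip x (- commutator T L' y)" for x y
    by (simp add: commutator_def psd_diff_left[OF psd] clinear_simps[OF psd_clinear[OF psd]] S L)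
  have "ip (- x) (- x) = ip x x" for x
    using psd_scale_left[OF psd, of "- 1" x "- x"] by (simp add: scaleC_minus_one clinear_simps[OF psd_clinear[OF psd]] scaleC_one)
  then have neg: "form_bounded ip (\<lambda>x. - commutator T L' x)"
    using T by (simp add: form_bounded_def)
  have "form_bounded ip (commutator S L)"
    by (rule form_bounded_adjoint[OF psd neg]) (rule comm)
  moreover have "clinear (commutator S L)"
    by (rule adjoint_clinear[OF psd, where T = "\<lambda>x. - commutator T L' x"]) (erule definite, rule comm)
  ultimately show ?thesis by simp
qed

theorem proposition3p12:
  fixes X :: "('a::complex_algebra_1, 'q::complex_algebra_1, 'b::complex_algebra_1) hom_space"
    and C :: "('a, 'b, 'w::complex_algebra_1) calculus"
    and M :: "('a, 'b, 'w, 'f::complex_vector, 't::complex_vector) hmod"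
    and ang :: "'f \<Rightarrow> 'f \<Rightarrow> 'b"
    and nab :: "'f \<Rightarrow> 't"
    and nabla nabla_adj delF delF_adj delbarF delbarF_adj :: "'t \<Rightarrow> 't"
    and ip :: "'t \<Rightarrow> 't \<Rightarrow> complex"
    and j :: "'t \<Rightarrow> 'l::chilbert_space"
    and b :: 'b
  defines "nabla \<equiv> nabla_op C M nab"
    and "delF \<equiv> delF_op C M nab"
    and "delbarF \<equiv> delbarF_op C M"
    and "ip \<equiv> module_inner X C M"
  assumes "cqh_hermitian_space X C"
    and "covariant_hermitian_holomorphic_module X C M"
    and "left_metric X M ang"
    and "chern_connection X C M ang nab"
    and "is_adjoint ip nabla nabla_adj"
    and "is_adjoint ip delF delF_adj"
    and "is_adjoint ip delbarF delbarF_adj"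
    and "is_completion ip j"
  shows "\<forall>T \<in> {nabla, delF, delbarF,
               nabla_adj, delF_adj, delbarF_adj,
               \<lambda>x. nabla x + nabla_adj x, \<lambda>x. delF x + delF_adj x, \<lambda>x. delbarF x + delbarF_adj x}.
           bounded_and_extends ip j (commutator T (lmul C M b))"
proof -
  interpret module_with_left_metric X C M ang
    using assms(6,7) by (simp add: module_with_left_metric_def module_with_left_metric_axioms_def)
  have psd: "psd_form ip"
    unfolding ip_def by (rule module_inner_psd)
  have definite: "x = 0" if "ip x x = 0" for x
    using that unfolding ip_def by (rule module_inner_definite)
  have wedge: "clinear (wedge M \<omega>) \<and> form_bounded ip (wedge M \<omega>)" for \<omega>
    unfolding ip_def form_bounded_def using wedge_linear module_inner_wedge_bounded by blast
  have conn: "connection C M (dform C) (grade C 1) nab"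
    using assms(8) by (simp add: chern_connection_def)
  have comm: "commutator nabla (lmul C M c) = wedge M (dform C (emb C c))"
    "commutator delF (lmul C M c) = wedge M (del C (emb C c))"
    "commutator delbarF (lmul C M c) = wedge M (delbar C (emb C c))" for c
    unfolding nabla_def nabla_op_def delF_def delF_op_def delbarF_def delbarF_op_def
    by (rule conn_ext_commutator[OF d_derivation conn],
        rule conn_ext_commutator[OF del_derivation form_part_connection[OF conn]],
        rule conn_ext_commutator[OF delbar_derivation dbarF_connection])
  have first: "clinear (commutator T (lmul C M c)) \<and> form_bounded ip (commutator T (lmul C M c))"
    if "T \<in> {nabla, delF, delbarF}" for T c
    using that comm wedge by auto
  have adjoint: "clinear (commutator S (lmul C M b)) \<and> form_bounded ip (commutator S (lmul C M b))"
    if "T \<in> {nabla, delF, delbarF}" "is_adjoint ip T S" for T S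
    by (rule commutator_adjoint_bounded[OF psd definite _ that(2)])
      (use first[OF that(1)] module_inner_lmul in \<open>auto simp: ip_def\<close>)
  have sum: "clinear (commutator (\<lambda>x. T x + S x) (lmul C M b)) \<and> form_bounded ip (commutator (\<lambda>x. T x + S x) (lmul C M b))"
    if T: "T \<in> {nabla, delF, delbarF}" and S: "is_adjoint ip T S" for T S
  proof -
    have "commutator (\<lambda>x. T x + S x) (lmul C M b) = (\<lambda>x. commutator T (lmul C M b) x + commutator S (lmul C M b) x)"
      by (auto simp: commutator_def clinear_simps[OF lmul_linear])
    then show ?thesis
      using first[OF T, of b] adjoint[OF T S] by (simp add: clinear_plus form_bounded_add[OF psd])
  qed
  show ?thesis
    using first[of _ b] adjoint[OF _ assms(9)] adjoint[OF _ assms(10)] adjoint[OF _ assms(11)]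
      sum[OF _ assms(9)] sum[OF _ assms(10)] sum[OF _ assms(11)] bounded_extension[OF psd assms(12)]
    by auto
qed


end
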